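(* Let $p$ be a prime. For any saturated fusion system $\mathcal F$ over a finite $p$-group $S$, there is a bijective correspondence between subgroups $$H\le\Gamma_{p'}(\mathcal F)=\mathrm{Out}_{\mathcal F}(S)/\mathrm{Out}^0_{\mathcal F}(S)$$ and saturated fusion subsystems $\mathcal F_H$ of $\mathcal F$ over $S$ of index prime to $p$ in $\mathcal F$. The correspondence is given by associating to $H$ the fusion system $\mathcal F_H$ generated by $\widehat\theta^{-1}(\mathcal B(H))$.
   Context: Fusion systems. Let $S$ be a finite $p$-group. Write $c_x(g)=xgx^{-1}$; for $P,Q\le S$ let $\mathrm{Hom}_S(P,Q)=\{c_x|_P: x\in S,\ xPx^{-1}\le Q\}$, $\mathrm{Aut}_S(P)=\mathrm{Hom}_S(P,P)$, and let $\mathrm{Inj}(P,Q)$ be the set of injective homomorphisms. A fusion system $\mathcal F$ over $S$ is a category whose objects are all subgroups of $S$, with $\mathrm{Hom}_S(P,Q)\subseteq\mathrm{Hom}_{\mathcal F}(P,Q)\subseteq\mathrm{Inj}(P,Q)$, and such that each morphism is the composite of an isomorphism in $\mathcal F$ followed by an inclusion. Write $\mathrm{Aut}_{\mathcal F}(P)=\mathrm{Hom}_{\mathcal F}(P,P)$ and $\mathrm{Out}_{\mathcal F}(P)=\mathrm{Aut}_{\mathcal F}(P)/\mathrm{Inn}(P)$. Subgroups isomorphic in $\mathcal F$ are called $\mathcal F$-conjugate. $P\le S$ is fully centralized (resp. fully normalized) in $\mathcal F$ if $|C_S(P)|\ge|C_S(P')|$ (resp. $|N_S(P)|\ge|N_S(P')|$)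 for all $P'$ $\mathcal F$-conjugate to $P$. $\mathcal F$ is saturated if: (I) every fully normalized $P$ is fully centralized and $\mathrm{Aut}_S(P)\in\mathrm{Syl}_p(\mathrm{Aut}_{\mathcal F}(P))$; (II) if $\varphi\in\mathrm{Hom}_{\mathcal F}(P,S)$ is such that $\varphi(P)$ is fully centralized, then $\varphi$ extends to some $\overline\varphi\in\mathrm{Hom}_{\mathcal F}(N_\varphi,S)$, where $N_\varphi=\{g\in N_S(P): \varphi c_g\varphi^{-1}\in\mathrm{Aut}_S(\varphi(P))\}$. $P\le S$ is $\mathcal F$-centric if $C_S(P')=Z(P')$ for all $P'$ $\mathcal F$-conjugate to $P$; $\mathcal F^c\subseteq\mathcal F$ is the full subcategory on the $\mathcal F$-centric subgroups. Index prime to $p$. For a finite group $G$, $O^{p'}(G)$ is the smallest normal subgroup of index prime to $p$. A saturated fusion subsystem $\mathcal F'\subseteq\mathcal F$ over the same group $S$ is of index prime to $p$ in $\mathcal F$ if $\mathrm{Aut}_{\mathcal F'}(P)\ge O^{p'}(\mathrm{Aut}_{\mathcal F}(P))$ for all $P\le S$. $O^{p'}_*(\mathcal F)\subseteq\mathcal F$ is the smallest fusion subsystem over $S$ (not necessarily saturated) which contains the groups $O^{p'}(\mathrm{Aut}_{\mathcal F}(P))$ for all $P\le S$; $O^{p'}_*(\mathcal F)^c$ is its full subcategory on the $\mathcal F$-centric subgroups. $\mathrm{Out}^0_{\mathcal F}(S)=\langle\alpha\in\mathrm{Out}_{\mathcal F}(S): \alpha|_P\in\mathrm{Mor}_{O^{p'}_*(\mathcal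 F)}(P,S)\text{ for some }\mathcal F\text{-centric }P\le S\rangle$, a normal subgroup of $\mathrm{Out}_{\mathcal F}(S)$. For a group $\Gamma$, $\mathcal B(\Gamma)$ is the category with one object and morphism monoid $\Gamma$. $\widehat\theta:\mathcal F^c\to\mathcal B(\mathrm{Out}_{\mathcal F}(S)/\mathrm{Out}^0_{\mathcal F}(S))$ is the unique functor such that $\widehat\theta(\alpha)=[\alpha]$ for all $\alpha\in\mathrm{Aut}_{\mathcal F}(S)$, and $\widehat\theta(\varphi)=1$ for all $\varphi\in\mathrm{Mor}(O^{p'}_*(\mathcal F)^c)$ (so $\widehat\theta$ sends inclusions to the identity). (Explicitly, every morphism in $\mathcal F^c$ is of the form $\varphi'\circ\alpha|_P$ with $\alpha\in\mathrm{Aut}_{\mathcal F}(S)$ and $\varphi'\in\mathrm{Mor}(O^{p'}_*(\mathcal F)^c)$, and is sent to $[\alpha]$.) $\widehat\theta^{-1}(\mathcal B(H))$ consists of the morphisms of $\mathcal F^c$ sent by $\widehat\theta$ into $H$; the fusion system generated by it is the smallest fusion system over $S$ containing it. The group $\Gamma_{p'}(\mathcal F)$ is by definition $\pi_1(|\mathcal F^c|)$ modulo the intersection of its normal subgroups of finite index prime to $p$; it is identified with $\mathrm{Out}_{\mathcal F}(S)/\mathrm{Out}^0_{\mathcal F}(S)$ via the isomorphism induced by $\widehat\theta$. *)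

theory Defs
  imports "HOL-Algebra.Sylow" "HOL-Algebra.Zassenhaus" "HOL-Algebra.Generated_Groups"
begin

section \<open>Finite groups\<close>

definition finite_p_group :: "nat \<Rightarrow> ('a, 'b) monoid_scheme \<Rightarrow> bool" where
  "finite_p_group p S \<longleftrightarrow> group S \<and> finite (carrier S) \<and> (\<exists>n. order S = p ^ n)"

definition centralizer :: "('a, 'b) monoid_scheme \<Rightarrow> 'a set \<Rightarrow> 'a set" where
  "centralizer G P = {g \<in> carrier G. \<forall>x\<in>P. g \<otimes>\<^bsub>G\<^esub> x = x \<otimes>\<^bsub>G\<^esub> g}"

definition center :: "('a, 'b) monoid_scheme \<Rightarrow> 'a set \<Rightarrow> 'a set" where
  "center G P = {z \<in> P. \<forall>x\<in>P. z \<otimes>\<^bsub>G\<^esub> x = x \<otimes>\<^bsub>G\<^esub> z}"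

definition is_Sylow :: "nat \<Rightarrow> ('a, 'b) monoid_scheme \<Rightarrow> 'a set \<Rightarrow> bool" where
  "is_Sylow p G H \<longleftrightarrow> subgroup H G \<and> card H = p ^ multiplicity p (order G)"

text \<open>The smallest normal subgroup of index prime to \<open>p\<close>, for a finite group \<open>G\<close> and
  a prime \<open>p\<close>.\<close>

definition O_p' :: "nat \<Rightarrow> ('a, 'b) monoid_scheme \<Rightarrow> 'a set" where
  "O_p' p G = \<Inter> {N. N \<lhd> G \<and> coprime p (card (rcosets\<^bsub>G\<^esub> N))}"


section \<open>Fusion systems\<close>

text \<open>
  A morphism \<open>P \<rightarrow> Q\<close> is a function that is \<^const>\<open>undefined\<close> outside \<open>P\<close>, and a category
  whose objects are subgroups of \<open>S\<close> is given by its family of morphism sets, so that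
  composition is \<^const>\<open>compose\<close> and \<open>\<le>\<close> is the relation of being a subfamily. The family
  has to be empty at arguments that are not objects; fusion systems are then equal as
  functions if and only if they have the same morphisms.
\<close>

type_synonym 'a hom_family = "'a set \<Rightarrow> 'a set \<Rightarrow> ('a \<Rightarrow> 'a) set"

definition conj_map :: "('a, 'b) monoid_scheme \<Rightarrow> 'a \<Rightarrow> 'a set \<Rightarrow> 'a \<Rightarrow> 'a" where
  "conj_map S x P = (\<lambda>g\<in>P. x \<otimes>\<^bsub>S\<^esub> g \<otimes>\<^bsub>S\<^esub> inv\<^bsub>S\<^esub> x)"

definition Hom_S :: "('a, 'b) monoid_scheme \<Rightarrow> 'a hom_family" where
  "Hom_S S P Q = {conj_map S x P | x. x \<in> carrier S \<and> conj_map S x P ` P \<subseteq> Q}"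

definition Inj :: "('a, 'b) monoid_scheme \<Rightarrow> 'a hom_family" where
  "Inj S P Q = mon (S\<lparr>carrier := P\<rparr>) (S\<lparr>carrier := Q\<rparr>) \<inter> extensional P"

definition isos :: "'a hom_family \<Rightarrow> 'a hom_family" where
  "isos F P Q = {\<phi> \<in> F P Q. \<exists>\<psi>\<in>F Q P. compose P \<psi> \<phi> = (\<lambda>x\<in>P. x) \<and> compose Q \<phi> \<psi> = (\<lambda>x\<in>Q. x)}"

definition fusion_system :: "('a, 'b) monoid_scheme \<Rightarrow> 'a hom_family \<Rightarrow> bool" where
  "fusion_system S F \<longleftrightarrow>
     (\<forall>P Q. F P Q \<noteq> {} \<longrightarrow> subgroup P S \<and> subgroup Q S) \<and>
     (\<forall>P. subgroup P S \<longrightarrow> (\<lambda>x\<in>P. x) \<in> F P P) \<and>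
     (\<forall>P Q R. \<forall>\<phi>\<in>F P Q. \<forall>\<psi>\<in>F Q R. compose P \<psi> \<phi> \<in> F P R) \<and>
     (\<forall>P Q. subgroup P S \<and> subgroup Q S \<longrightarrow> Hom_S S P Q \<subseteq> F P Q \<and> F P Q \<subseteq> Inj S P Q) \<and>
     (\<forall>P Q. \<forall>\<phi>\<in>F P Q. \<exists>R. subgroup R S \<and> R \<subseteq> Q \<and>
        (\<exists>\<chi>\<in>isos F P R. \<phi> = compose P (\<lambda>x\<in>R. x) \<chi>))"

definition F_conjugate :: "'a hom_family \<Rightarrow> 'a set \<Rightarrow> 'a set \<Rightarrow> bool" where
  "F_conjugate F P P' \<longleftrightarrow> isos F P P' \<noteq> {}"

definition Aut_F :: "'a hom_family \<Rightarrow> 'a set \<Rightarrow> ('a \<Rightarrow> 'a) monoid" where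
  "Aut_F F P = (BijGroup P)\<lparr>carrier := F P P\<rparr>"

definition Inn :: "('a, 'b) monoid_scheme \<Rightarrow> 'a set \<Rightarrow> ('a \<Rightarrow> 'a) set" where
  "Inn S P = {conj_map S x P | x. x \<in> P}"

definition Out_F :: "('a, 'b) monoid_scheme \<Rightarrow> 'a hom_family \<Rightarrow> 'a set \<Rightarrow> ('a \<Rightarrow> 'a) set monoid" where
  "Out_F S F P = Aut_F F P Mod Inn S P"

definition fully_centralized :: "('a, 'b) monoid_scheme \<Rightarrow> 'a hom_family \<Rightarrow> 'a set \<Rightarrow> bool" where
  "fully_centralized S F P \<longleftrightarrow>
     (\<forall>P'. F_conjugate F P P' \<longrightarrow> card (centralizer S P) \<ge> card (centralizer S P'))"

definition fully_normalized :: "('a, 'b) monoid_scheme \<Rightarrow> 'a hom_family \<Rightarrow> 'a set \<Rightarrow> bool" where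
  "fully_normalized S F P \<longleftrightarrow>
     (\<forall>P'. F_conjugate F P P' \<longrightarrow> card (normalizer S P) \<ge> card (normalizer S P'))"

definition N_phi :: "('a, 'b) monoid_scheme \<Rightarrow> 'a set \<Rightarrow> ('a \<Rightarrow> 'a) \<Rightarrow> 'a set" where
  "N_phi S P \<phi> = {g \<in> normalizer S P.
     (\<lambda>y\<in>\<phi> ` P. \<phi> (conj_map S g P (inv_into P \<phi> y))) \<in> Hom_S S (\<phi> ` P) (\<phi> ` P)}"

definition saturated :: "nat \<Rightarrow> ('a, 'b) monoid_scheme \<Rightarrow> 'a hom_family \<Rightarrow> bool" where
  "saturated p S F \<longleftrightarrow>
     fusion_system S F \<and>
     (\<forall>P. subgroup P S \<and> fully_normalized S F P \<longrightarrow>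
        fully_centralized S F P \<and> is_Sylow p (Aut_F F P) (Hom_S S P P)) \<and>
     (\<forall>P. \<forall>\<phi>\<in>F P (carrier S). fully_centralized S F (\<phi> ` P) \<longrightarrow>
        (\<exists>\<phi>'\<in>F (N_phi S P \<phi>) (carrier S). restrict \<phi>' P = \<phi>))"

definition centric :: "('a, 'b) monoid_scheme \<Rightarrow> 'a hom_family \<Rightarrow> 'a set \<Rightarrow> bool" where
  "centric S F P \<longleftrightarrow>
     subgroup P S \<and> (\<forall>P'. F_conjugate F P P' \<longrightarrow> centralizer S P' = center S P')"

definition full_subcategory :: "'a set set \<Rightarrow> 'a hom_family \<Rightarrow> 'a hom_family" where
  "full_subcategory X F P Q = (if P \<in> X \<and> Q \<in> X then F P Q else {})"

definition centric_cat :: "('a, 'b) monoid_scheme \<Rightarrow> 'a hom_family \<Rightarrow> 'a hom_family" where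
  "centric_cat S F = full_subcategory {P. centric S F P} F"

text \<open>\<^const>\<open>Inf\<close> is the argumentwise intersection of families of morphism sets; an intersection
  of fusion systems over \<open>S\<close> is again one.\<close>

definition generated_fusion_system :: "('a, 'b) monoid_scheme \<Rightarrow> 'a hom_family \<Rightarrow> 'a hom_family" where
  "generated_fusion_system S M = Inf {F. fusion_system S F \<and> M \<le> F}"


section \<open>Subsystems of index prime to \<open>p\<close>\<close>

definition index_prime_to_p ::
    "nat \<Rightarrow> ('a, 'b) monoid_scheme \<Rightarrow> 'a hom_family \<Rightarrow> 'a hom_family \<Rightarrow> bool" where
  "index_prime_to_p p S F F' \<longleftrightarrow>
     saturated p S F' \<and> F' \<le> F \<and>
     (\<forall>P. subgroup P S \<longrightarrow> O_p' p (Aut_F F P) \<subseteq> carrier (Aut_F F' P))"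

definition O_star :: "nat \<Rightarrow> ('a, 'b) monoid_scheme \<Rightarrow> 'a hom_family \<Rightarrow> 'a hom_family" where
  "O_star p S F = Inf {F'. fusion_system S F' \<and> F' \<le> F \<and>
     (\<forall>P. subgroup P S \<longrightarrow> O_p' p (Aut_F F P) \<subseteq> carrier (Aut_F F' P))}"

text \<open>The full subcategory on the subgroups that are centric in \<open>F\<close>, not in \<open>O_star p S F\<close>.\<close>

definition O_star_centric :: "nat \<Rightarrow> ('a, 'b) monoid_scheme \<Rightarrow> 'a hom_family \<Rightarrow> 'a hom_family" where
  "O_star_centric p S F = full_subcategory {P. centric S F P} (O_star p S F)"

text \<open>Whether \<open>\<alpha>|\<^sub>P\<close> lies in \<open>O_star p S F\<close> does not depend on the representative
  \<open>\<alpha>\<close> of a class \<open>a\<close> in \<open>Out\<^sub>F(S)\<close>.\<close>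

definition Out0 :: "nat \<Rightarrow> ('a, 'b) monoid_scheme \<Rightarrow> 'a hom_family \<Rightarrow> ('a \<Rightarrow> 'a) set set" where
  "Out0 p S F = generate (Out_F S F (carrier S))
     {a \<in> carrier (Out_F S F (carrier S)).
        \<exists>\<alpha>\<in>a. \<exists>P. centric S F P \<and> restrict \<alpha> P \<in> O_star p S F P (carrier S)}"

text \<open>\<open>\<Gamma>\<^sub>p\<^sub>'(F)\<close>, under its identification with \<open>Out\<^sub>F(S)/Out\<^sup>0\<^sub>F(S)\<close>.\<close>

definition Gamma_p' ::
    "nat \<Rightarrow> ('a, 'b) monoid_scheme \<Rightarrow> 'a hom_family \<Rightarrow> ('a \<Rightarrow> 'a) set set monoid" where
  "Gamma_p' p S F = Out_F S F (carrier S) Mod Out0 p S F"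

definition Gamma_class ::
    "nat \<Rightarrow> ('a, 'b) monoid_scheme \<Rightarrow> 'a hom_family \<Rightarrow> ('a \<Rightarrow> 'a) \<Rightarrow> ('a \<Rightarrow> 'a) set set" where
  "Gamma_class p S F \<alpha> =
     Out0 p S F #>\<^bsub>Out_F S F (carrier S)\<^esub> (Inn S (carrier S) #>\<^bsub>Aut_F F (carrier S)\<^esub> \<alpha>)"

text \<open>A functor to the one-object category \<open>B(\<Gamma>)\<close>, on the category with object set \<open>X\<close> and
  morphism sets \<open>C\<close>, is a map on morphisms; these are identified by domain, codomain and
  underlying function.\<close>

definition functor_to_B ::
    "'a set set \<Rightarrow> 'a hom_family \<Rightarrow> 'c monoid \<Rightarrow> ('a set \<Rightarrow> 'a set \<Rightarrow> ('a \<Rightarrow> 'a) \<Rightarrow> 'c) \<Rightarrow> bool" where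
  "functor_to_B X C \<Gamma> \<theta> \<longleftrightarrow>
     (\<forall>P Q. \<forall>\<phi>\<in>C P Q. \<theta> P Q \<phi> \<in> carrier \<Gamma>) \<and>
     (\<forall>P\<in>X. \<theta> P P (\<lambda>x\<in>P. x) = \<one>\<^bsub>\<Gamma>\<^esub>) \<and>
     (\<forall>P Q R. \<forall>\<phi>\<in>C P Q. \<forall>\<psi>\<in>C Q R. \<theta> P R (compose P \<psi> \<phi>) = \<theta> Q R \<psi> \<otimes>\<^bsub>\<Gamma>\<^esub> \<theta> P Q \<phi>)"

text \<open>The last clause fixes the value at triples that are not morphisms, so that the functor
  is unique as a HOL function.\<close>

definition is_theta_hat ::
    "nat \<Rightarrow> ('a, 'b) monoid_scheme \<Rightarrow> 'a hom_family \<Rightarrow>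
     ('a set \<Rightarrow> 'a set \<Rightarrow> ('a \<Rightarrow> 'a) \<Rightarrow> ('a \<Rightarrow> 'a) set set) \<Rightarrow> bool" where
  "is_theta_hat p S F \<theta> \<longleftrightarrow>
     functor_to_B {P. centric S F P} (centric_cat S F) (Gamma_p' p S F) \<theta> \<and>
     (\<forall>\<alpha>\<in>F (carrier S) (carrier S). \<theta> (carrier S) (carrier S) \<alpha> = Gamma_class p S F \<alpha>) \<and>
     (\<forall>P Q. \<forall>\<phi>\<in>O_star_centric p S F P Q. \<theta> P Q \<phi> = \<one>\<^bsub>Gamma_p' p S F\<^esub>) \<and>
     (\<forall>P Q \<phi>. \<phi> \<notin> centric_cat S F P Q \<longrightarrow> \<theta> P Q \<phi> = undefined)"

definition theta_hat ::
    "nat \<Rightarrow> ('a, 'b) monoid_scheme \<Rightarrow> 'a hom_family \<Rightarrow>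
     'a set \<Rightarrow> 'a set \<Rightarrow> ('a \<Rightarrow> 'a) \<Rightarrow> ('a \<Rightarrow> 'a) set set" where
  "theta_hat p S F = (THE \<theta>. is_theta_hat p S F \<theta>)"

definition theta_hat_preimage ::
    "nat \<Rightarrow> ('a, 'b) monoid_scheme \<Rightarrow> 'a hom_family \<Rightarrow> ('a \<Rightarrow> 'a) set set set \<Rightarrow> 'a hom_family" where
  "theta_hat_preimage p S F H P Q = {\<phi> \<in> centric_cat S F P Q. theta_hat p S F P Q \<phi> \<in> H}"

definition F_sub ::
    "nat \<Rightarrow> ('a, 'b) monoid_scheme \<Rightarrow> 'a hom_family \<Rightarrow> ('a \<Rightarrow> 'a) set set set \<Rightarrow> 'a hom_family" where
  "F_sub p S F H = generated_fusion_system S (theta_hat_preimage p S F H)"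

end

theory Submission
  imports Defs "HOL-Algebra.Multiplicative_Group"
begin

text \<open>
  Let \<open>F\<close> be a saturated fusion system over \<open>S\<close>, and write \<open>O\<close> for \<open>O\<^sup>p\<^sup>'\<^sub>*(F)\<close>. In a finite group the
  elements of \<open>p\<close>-power order generate \<open>O\<^sup>p\<^sup>'(G)\<close>, so \<open>O\<close> is the smallest fusion system over \<open>S\<close> that
  contains all automorphisms of \<open>p\<close>-power order in \<open>F\<close> of subgroups of \<open>S\<close>. It is invariant under
  conjugation by \<open>Aut\<^sub>F(S)\<close>.

  Everything rests on one fact, \<open>generation\<close>: each morphism of \<open>F\<close>, from any subgroup \<open>P\<close>, has the
  form \<open>\<mu> \<circ> \<alpha>|\<^sub>P\<close> with \<open>\<alpha>\<close> in \<open>Aut\<^sub>F(S)\<close> and \<open>\<mu>\<close> in \<open>O\<close>. Indeed let \<open>Q\<close> be fully normalized and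
  \<open>\<psi> : P \<rightarrow> Q\<close> an isomorphism. By Sylow's theorem an automorphism of \<open>Q\<close> in \<open>O\<close> moves
  \<open>\<psi> Aut\<^sub>S(P) \<psi>\<^sup>-\<^sup>1\<close> into \<open>Aut\<^sub>S(Q)\<close>. After this correction \<open>\<psi>\<close> extends to \<open>N\<^sub>S(P)\<close>, and induction applies.
  If \<open>P\<close> is centric, two such factorizations of the same morphism differ in \<open>\<alpha>\<close> by an automorphism of
  \<open>S\<close> that belongs to \<open>O\<close> on a centric subgroup, hence represents \<open>1\<close> in \<open>\<Gamma>\<^sub>p\<^sub>'(F)\<close>. So the functor
  \<open>\<theta>\<close> exists and sends \<open>\<mu> \<circ> \<alpha>|\<^sub>P\<close> to \<open>[\<alpha>]\<close>.

  For a subgroup \<open>H\<close> of \<open>\<Gamma>\<^sub>p\<^sub>'(F)\<close> let \<open>A\<close> be its preimage in \<open>Aut\<^sub>F(S)\<close>, and let \<open>E\<close> consist of all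
  \<open>\<mu> \<circ> \<alpha>|\<^sub>P\<close> with \<open>\<alpha>\<close> in \<open>A\<close>, for all \<open>P\<close>, centric or not. On centric subgroups this is \<open>\<theta>\<^sup>-\<^sup>1(H)\<close>.
  Moreover \<open>O\<close> is generated by its centric part (\<open>O_rel_centric_generated\<close>), since an automorphism of
  \<open>p\<close>-power order of a fully normalized \<open>Q\<close> extends to one of the centric group \<open>Q C\<^sub>S(Q)\<close>. Therefore
  \<open>E\<close> is the fusion system \<open>F\<^sub>H\<close>, and \<open>H\<close> is recovered from \<open>Aut\<^sub>E(S) = A\<close>.

  It has to be shown that \<open>E\<close> is saturated. Since \<open>F\<close> is \<open>E\<close> up to automorphisms of \<open>S\<close>, the notions of
  fully normalized, fully centralized and centric subgroups are the same for \<open>E\<close> and \<open>F\<close>, and the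
  Sylow axiom is inherited. The extension axiom is proved by descending induction on the order of
  \<open>P\<close>. Let \<open>f\<close> be a morphism of \<open>E\<close> from \<open>P\<close> whose image \<open>Q\<close> is fully centralized. After a move within
  \<open>E\<close> (see \<open>extension_E\<close>) \<open>P\<close> is fully centralized too, so that \<open>P C\<^sub>S(P)\<close> is centric. Now \<open>f\<close> extends
  in \<open>F\<close>, and an extension that lies in \<open>E\<close> on some centric subgroup lies in \<open>E\<close> altogether
  (\<open>E_extends\<close>). So it is enough to find an extension that is in \<open>E\<close> on \<open>P C\<^sub>S(P)\<close>. This takes two
  steps. The first, \<open>extend_to_centralizer\<close>, extends \<open>f\<close> within \<open>E\<close> to \<open>P C\<^sub>S(P)\<close>. If \<open>P\<close> is not
  centric then, as \<open>E\<close> is generated by its centric part, only restrictions of morphisms from strictly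
  larger subgroups \<open>R\<close> need to be treated. There Sylow's theorem, in the group of automorphisms of \<open>R\<close>
  that fix \<open>P\<close> elementwise, allows \<open>R\<close> to be enlarged step by step until it contains \<open>C\<^sub>S(P)\<close>. The
  second, \<open>extension_fully_cent\<close>, compares this extension with one to \<open>N\<^sub>f\<close> in \<open>F\<close>. They differ by an
  automorphism of \<open>Q C\<^sub>S(Q)\<close> that fixes \<open>Q\<close> elementwise, and one more application of Sylow's theorem,
  in a twisted form, reconciles them.

  Conversely let \<open>F'\<close> be of index prime to \<open>p\<close>. Then \<open>F'\<close> contains \<open>O\<close>, and \<open>generation\<close> in \<open>F'\<close> says
  that \<open>F'\<close> consists of all \<open>\<mu> \<circ> \<alpha>|\<^sub>P\<close> with \<open>\<mu>\<close> in \<open>O\<close> and \<open>\<alpha>\<close> in \<open>Aut\<^sub>F\<^sub>'(S)\<close>. By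
  \<open>automorphism_in_subsystem\<close> and \<open>cls_kernel\<close> that group contains every automorphism of \<open>S\<close> that
  represents \<open>1\<close> in \<open>\<Gamma>\<^sub>p\<^sub>'(F)\<close>, so \<open>F'\<close> is \<open>F\<^sub>H\<close> for its image \<open>H\<close>.
\<close>

section \<open>Fixed points of \<open>p\<close>-groups and Sylow subgroups\<close>

lemma (in group) inv_cancel:
  assumes "a \<in> carrier G" "b \<in> carrier G"
  shows "inv a \<otimes> (a \<otimes> b) = b" "a \<otimes> (inv a \<otimes> b) = b"
  using assms by (simp_all flip: m_assoc)

lemma prime_power_dvd_cases:
  fixes p :: nat
  assumes "prime p" "d dvd p ^ n"
  shows "d = 1 \<or> p dvd d"
proof -
  obtain i where "d = p ^ i" using assms divides_primepow_nat by blast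
  then show ?thesis by (cases i) auto
qed

lemma (in group_action) orbit_of_coprime_card:
  assumes "finite E" and "\<not> p dvd card E"
  obtains x where "x \<in> E" and "\<not> p dvd card (orbit G \<phi> x)"
proof -
  have "card E = (\<Sum>orb\<in>orbits G E \<phi>. card orb)"
    using disjoint_sum[OF assms(1), of "\<lambda>_. 1::nat"] by simp
  then have "\<exists>orb\<in>orbits G E \<phi>. \<not> p dvd card orb"
    using assms(2) by (metis dvd_sum)
  then show ?thesis using that by (auto simp: orbits_def)
qed

lemma group_actionI:
  assumes "group K"
    and "\<And>k x. k \<in> carrier K \<Longrightarrow> x \<in> X \<Longrightarrow> act k x \<in> X"
    and one: "\<And>x. x \<in> X \<Longrightarrow> act \<one>\<^bsub>K\<^esub> x = x"
    and mult: "\<And>k l x. k \<in> carrier K \<Longrightarrow> l \<in> carrier K \<Longrightarrow> x \<in> X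
      \<Longrightarrow> act (k \<otimes>\<^bsub>K\<^esub> l) x = act k (act l x)"
  shows "group_action K X (\<lambda>k. restrict (act k) X)"
proof -
  interpret K: group K by fact
  have inv: "act k (act (inv\<^bsub>K\<^esub> k) x) = x \<and> act (inv\<^bsub>K\<^esub> k) (act k x) = x"
    if "k \<in> carrier K" "x \<in> X" for k x
    using mult[of k "inv\<^bsub>K\<^esub> k" x] mult[of "inv\<^bsub>K\<^esub> k" k x] that one by simp
  have bij: "restrict (act k) X \<in> Bij X" if k: "k \<in> carrier K" for k
  proof -
    have "bij_betw (act k) X X"
      by (rule bij_betw_byWitness[where f' = "act (inv\<^bsub>K\<^esub> k)"])
        (use k inv assms(2) in auto)
    then have "bij_betw (restrict (act k) X) X X"
      by (rule iffD1[OF bij_betw_cong, rotated]) simp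
    then show ?thesis by (simp add: Bij_def)
  qed
  have "(\<lambda>k. restrict (act k) X) \<in> hom K (BijGroup X)"
  proof (rule homI)
    show "restrict (act k) X \<in> carrier (BijGroup X)" if "k \<in> carrier K" for k
      using bij[OF that] by (simp add: BijGroup_def)
    show "restrict (act (k \<otimes>\<^bsub>K\<^esub> l)) X =
        restrict (act k) X \<otimes>\<^bsub>BijGroup X\<^esub> restrict (act l) X"
      if "k \<in> carrier K" "l \<in> carrier K" for k l
      using bij that assms(2) mult
      by (auto simp: BijGroup_def compose_def fun_eq_iff)
  qed
  then show ?thesis
    by (simp add: group_action_def group_hom_def group_hom_axioms_def group_BijGroup assms(1))
qed

text \<open>The length of an orbit divides the order of the \<open>p\<close>-group; if it is also prime to \<open>p\<close>, it is 1.\<close>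

lemma p_group_fixed_point:
  assumes "group K" and K: "finite (carrier K)" "order K = p ^ n" "prime p"
    and "finite X" and "\<not> p dvd card X"
    and act: "\<And>k x. k \<in> carrier K \<Longrightarrow> x \<in> X \<Longrightarrow> act k x \<in> X"
    and one: "\<And>x. x \<in> X \<Longrightarrow> act \<one>\<^bsub>K\<^esub> x = x"
    and mult: "\<And>k l x. k \<in> carrier K \<Longrightarrow> l \<in> carrier K \<Longrightarrow> x \<in> X
      \<Longrightarrow> act (k \<otimes>\<^bsub>K\<^esub> l) x = act k (act l x)"
  obtains x where "x \<in> X" and "\<And>k. k \<in> carrier K \<Longrightarrow> act k x = x"
proof -
  interpret A: group_action K X "\<lambda>k. restrict (act k) X"
    by (rule group_actionI) (use assms in auto)
  obtain x where x: "x \<in> X" "\<not> p dvd card (orbit K (\<lambda>k. restrict (act k) X) x)"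
    using A.orbit_of_coprime_card assms(5,6) by metis
  let ?O = "orbit K (\<lambda>k. restrict (act k) X) x"
  have "card ?O dvd p ^ n"
    using A.orbit_stabilizer_theorem[OF x(1)] K(2) by (metis dvd_triv_left)
  then have "card ?O = 1"
    using x(2) prime_power_dvd_cases[OF \<open>prime p\<close>] by blast
  then obtain y where "?O = {y}" using card_1_singletonE by blast
  moreover have "restrict (act k) X x \<in> ?O" if "k \<in> carrier K" for k
    using that by (auto simp: orbit_def)
  ultimately have "restrict (act k) X x = y" if "k \<in> carrier K" for k
    using that by blast
  then have "act k x = y" if "k \<in> carrier K" for k using that x(1) by simp
  moreover have "y = x" using calculation[of "\<one>\<^bsub>K\<^esub>"] one[OF x(1)] assms(1)
    by (simp add: group.is_monoid monoid.one_closed)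
  ultimately show ?thesis using that x(1) by blast
qed

lemma (in group) card_rcosets_div:
  assumes "finite (carrier G)" "subgroup D G" "subgroup B G" "B \<subseteq> D"
  shows "card ((\<lambda>x. B #> x) ` D) = card D div card B" "card B dvd card D"
proof -
  interpret D: group "G\<lparr>carrier := D\<rparr>" by (simp add: assms(2) subgroup.subgroup_is_group)
  have B: "subgroup B (G\<lparr>carrier := D\<rparr>)" using assms by (simp add: subgroup_incl)
  have "rcosets\<^bsub>G\<lparr>carrier := D\<rparr>\<^esub> B = (\<lambda>x. B #> x) ` D"
    by (auto simp: RCOSETS_def r_coset_def)
  then have "card ((\<lambda>x. B #> x) ` D) * card B = card D"
    using D.lagrange[OF B] by (simp add: order_def)
  moreover have "card B > 0"
    using subgroup.one_closed[OF assms(3)] finite_subset[OF subgroup.subset[OF assms(3)] assms(1)]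
    by (auto simp: card_gt_0_iff)
  ultimately show "card ((\<lambda>x. B #> x) ` D) = card D div card B" "card B dvd card D"
    by (metis div_mult_self_is_m, metis dvd_triv_right)
qed

lemma (in group) rcos_eq_iff:
  assumes "subgroup B G" "x \<in> carrier G" "y \<in> carrier G"
  shows "B #> x = B #> y \<longleftrightarrow> x \<otimes> inv y \<in> B"
proof
  assume "B #> x = B #> y"
  then have "x \<in> B #> y" using rcos_self[OF assms(2,1)] by simp
  then obtain b where "b \<in> B" "x = b \<otimes> y" by (auto simp: r_coset_def)
  then show "x \<otimes> inv y \<in> B"
    using assms by (metis inv_solve_right' m_closed subgroup.mem_carrier)
next
  assume a: "x \<otimes> inv y \<in> B"
  have "x = (x \<otimes> inv y) \<otimes> y" using assms by (simp add: m_assoc)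
  then have "x \<in> B #> y" using a by (auto simp: r_coset_def)
  then show "B #> x = B #> y" using assms by (metis repr_independence)
qed

text \<open>The usual proof of Sylow's second theorem lets a \<open>p\<close>-group \<open>K\<close> act on the cosets of \<open>B\<close> in
  \<open>D\<close> by \<open>h2\<close>, and takes a fixed point. The action can be twisted by a second homomorphism
  \<open>h1\<close>, under which the coset of \<open>x\<close> goes to that of \<open>h1 k \<otimes> x \<otimes> inv (h2 k)\<close>; a fixed point
  then brings \<open>h2\<close> into \<open>B\<close> up to factors in the image of \<open>h1\<close>. Sylow's theorem is the case
  that \<open>h1\<close> is trivial.\<close>

lemma (in group) twisted_sylow:
  assumes fin: "finite (carrier G)" and "prime p"
    and DB: "subgroup D G" "subgroup B G" "B \<subseteq> D" "\<not> p dvd card D div card B"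
    and K: "group K" "finite (carrier K)" "order K = p ^ n"
    and h: "h1 \<in> hom K G" "h2 \<in> hom K G"
    and act: "\<And>k x. k \<in> carrier K \<Longrightarrow> x \<in> D \<Longrightarrow> h1 k \<otimes> x \<otimes> inv (h2 k) \<in> D"
    and nrm: "\<And>k b. k \<in> carrier K \<Longrightarrow> b \<in> B \<Longrightarrow> h1 k \<otimes> b \<otimes> inv (h1 k) \<in> B"
  obtains x where "x \<in> D"
    and "\<And>k. k \<in> carrier K \<Longrightarrow> \<exists>b\<in>B. x \<otimes> h2 k \<otimes> inv x = b \<otimes> h1 k"
proof -
  interpret K: group K by fact
  interpret h1: group_hom K G h1 using h(1) K(1) by unfold_locales
  interpret h2: group_hom K G h2 using h(2) K(1) by unfold_locales
  have Dc: "x \<in> carrier G" if "x \<in> D" for x using DB(1) that by (rule subgroup.mem_carrier)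
  have Bc: "x \<in> carrier G" if "x \<in> B" for x using DB(2) that by (rule subgroup.mem_carrier)
  let ?X = "(\<lambda>x. B #> x) ` D"
  let ?act = "\<lambda>k Y. (\<lambda>y. h1 k \<otimes> y \<otimes> inv (h2 k)) ` Y"
  have nrm': "\<exists>b'\<in>B. h1 k \<otimes> b' = b \<otimes> h1 k" if "k \<in> carrier K" "b \<in> B" for k b
  proof
    show "inv (h1 k) \<otimes> b \<otimes> h1 k \<in> B"
      using nrm[of "inv\<^bsub>K\<^esub> k" b] that by simp
    show "h1 k \<otimes> (inv (h1 k) \<otimes> b \<otimes> h1 k) = b \<otimes> h1 k"
      using that Bc by (simp add: m_assoc inv_cancel)
  qed
  have coset: "?act k (B #> x) = B #> (h1 k \<otimes> x \<otimes> inv (h2 k))"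
    if k: "k \<in> carrier K" and x: "x \<in> D" for k x
  proof -
    have "h1 k \<otimes> (b \<otimes> x) \<otimes> inv (h2 k) = (h1 k \<otimes> b \<otimes> inv (h1 k)) \<otimes> (h1 k \<otimes> x \<otimes> inv (h2 k))"
      if "b \<in> B" for b
      using k Dc[OF x] Bc[OF that] by (simp add: m_assoc inv_cancel)
    then have sub: "?act k (B #> x) \<subseteq> B #> (h1 k \<otimes> x \<otimes> inv (h2 k))"
      using nrm[OF k] by (fastforce simp: r_coset_def)
    have "b \<otimes> (h1 k \<otimes> x \<otimes> inv (h2 k)) \<in> ?act k (B #> x)" if b: "b \<in> B" for b
    proof -
      obtain b' where b': "b' \<in> B" "h1 k \<otimes> b' = b \<otimes> h1 k" using nrm'[OF k b] by blast
      have "b \<otimes> (h1 k \<otimes> x \<otimes> inv (h2 k)) = (b \<otimes> h1 k) \<otimes> x \<otimes> inv (h2 k)"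
        using k Dc[OF x] Bc[OF b] by (simp add: m_assoc)
      also have "\<dots> = h1 k \<otimes> (b' \<otimes> x) \<otimes> inv (h2 k)"
        unfolding b'(2)[symmetric] using k Dc[OF x] Bc[OF b'(1)] by (simp add: m_assoc)
      finally show ?thesis using b'(1) by (auto simp: r_coset_def)
    qed
    then show ?thesis using sub by (auto simp: r_coset_def)
  qed
  have finX: "finite ?X" using fin DB(1) by (meson finite_imageI finite_subset subgroup.subset)
  have cardX: "\<not> p dvd card ?X" using card_rcosets_div(1)[OF fin DB(1,2,3)] DB(4) by simp
  obtain Y where Y: "Y \<in> ?X" "\<And>k. k \<in> carrier K \<Longrightarrow> ?act k Y = Y"
  proof (rule p_group_fixed_point[OF K(1,2,3) \<open>prime p\<close> finX cardX, of ?act])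
    show "?act k Y \<in> ?X" if "k \<in> carrier K" "Y \<in> ?X" for k Y
      using that coset act by auto
    show "?act \<one>\<^bsub>K\<^esub> Y = Y" if "Y \<in> ?X" for Y
      using that coset[OF K.one_closed] Dc by auto
    show "?act (k \<otimes>\<^bsub>K\<^esub> l) Y = ?act k (?act l Y)"
      if kl: "k \<in> carrier K" "l \<in> carrier K" and Y: "Y \<in> ?X" for k l Y
    proof -
      obtain x where x: "x \<in> D" "Y = B #> x" using Y by auto
      show ?thesis
        unfolding x(2)
        using kl act[OF kl(2) x(1)] Dc[OF x(1)] coset[OF K.m_closed[OF kl] x(1)] coset[OF kl(2) x(1)]
          coset[OF kl(1) act[OF kl(2) x(1)]]
        by (simp add: m_assoc inv_mult_group)
    qed
  qed blast
  obtain x where x: "x \<in> D" "Y = B #> x" using Y(1) by auto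
  have "\<exists>b\<in>B. x \<otimes> h2 k \<otimes> inv x = b \<otimes> h1 k" if k: "k \<in> carrier K" for k
  proof -
    have "B #> (h1 k \<otimes> x \<otimes> inv (h2 k)) = B #> x"
      using Y(2)[OF k] coset[OF k x(1)] x(2) by simp
    then have b: "h1 k \<otimes> x \<otimes> inv (h2 k) \<otimes> inv x \<in> B"
      using rcos_eq_iff[OF DB(2)] k Dc[OF x(1)] by simp
    let ?b = "h1 k \<otimes> x \<otimes> inv (h2 k) \<otimes> inv x"
    have c: "?b \<in> carrier G" using k Dc[OF x(1)] by simp
    have "x \<otimes> h2 k \<otimes> inv x = inv ?b \<otimes> h1 k"
      using k Dc[OF x(1)] by (simp add: inv_mult_group m_assoc inv_cancel)
    moreover have "inv ?b \<in> B" using b DB(2) by (rule subgroup.m_inv_closed[rotated])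
    ultimately show ?thesis by blast
  qed
  then show ?thesis using that x(1) by blast
qed

text \<open>The number of cosets of \<open>B\<close> is prime to \<open>p\<close>, hence so is the length of some orbit of
  \<open>D\<close> on them, and the stabilizer of a point of that orbit is what is asked for.\<close>

lemma (in group) conjugate_meets_in_coprime_index:
  assumes fin: "finite (carrier G)"
    and B: "subgroup B G" "\<not> p dvd card (carrier G) div card B" and D: "subgroup D G"
  obtains g where "g \<in> carrier G"
    and "\<not> p dvd card D div card {d \<in> D. g \<otimes> d \<otimes> inv g \<in> B}"
proof -
  let ?X = "(\<lambda>x. B #> x) ` carrier G"
  let ?K = "G\<lparr>carrier := D\<rparr>"
  let ?act = "\<lambda>d Y. Y #> inv d"
  have Dc: "x \<in> carrier G" if "x \<in> D" for x using D that by (rule subgroup.mem_carrier)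
  have Bc: "B \<subseteq> carrier G" using B(1) by (rule subgroup.subset)
  have K: "group ?K" using D by (simp add: subgroup.subgroup_is_group)
  interpret A: group_action ?K ?X "\<lambda>k. restrict (?act k) ?X"
  proof (rule group_actionI[OF K])
    show "?act k Y \<in> ?X" if "k \<in> carrier ?K" "Y \<in> ?X" for k Y
      using that Dc Bc by (auto simp: coset_mult_assoc)
    show "?act \<one>\<^bsub>?K\<^esub> Y = Y" if "Y \<in> ?X" for Y
      using that Bc by (auto simp: coset_mult_assoc)
    show "?act (k \<otimes>\<^bsub>?K\<^esub> l) Y = ?act k (?act l Y)"
      if "k \<in> carrier ?K" "l \<in> carrier ?K" "Y \<in> ?X" for k l Y
      using that Dc Bc by (auto simp: coset_mult_assoc inv_mult_group m_assoc)
  qed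
  have "card ?X = card (carrier G) div card B"
    by (rule card_rcosets_div(1)[OF fin subgroup_self B(1) Bc])
  then obtain Y where Y: "Y \<in> ?X" "\<not> p dvd card (orbit ?K (\<lambda>k. restrict (?act k) ?X) Y)"
    using A.orbit_of_coprime_card[of p] B(2) fin by (metis finite_imageI)
  obtain g where g: "g \<in> carrier G" "Y = B #> g" using Y(1) by auto
  have st: "stabilizer ?K (\<lambda>k. restrict (?act k) ?X) Y = {d \<in> D. g \<otimes> d \<otimes> inv g \<in> B}"
  proof -
    have "?act d Y = Y \<longleftrightarrow> g \<otimes> d \<otimes> inv g \<in> B" if d: "d \<in> D" for d
    proof -
      have "?act d Y = B #> (g \<otimes> inv d)"
        using g Dc[OF d] Bc by (simp add: coset_mult_assoc)
      then have "?act d Y = Y \<longleftrightarrow> B #> g = B #> (g \<otimes> inv d)" using g(2) by auto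
      also have "\<dots> \<longleftrightarrow> g \<otimes> d \<otimes> inv g \<in> B"
        using g(1) Dc[OF d] by (simp add: rcos_eq_iff[OF B(1)] inv_mult_group m_assoc)
      finally show ?thesis .
    qed
    then show ?thesis using Y(1) by (auto simp: stabilizer_def)
  qed
  have "card (orbit ?K (\<lambda>k. restrict (?act k) ?X) Y) * card {d \<in> D. g \<otimes> d \<otimes> inv g \<in> B} = card D"
    using A.orbit_stabilizer_theorem[OF Y(1)] st by (simp add: order_def)
  moreover have "finite {d \<in> D. g \<otimes> d \<otimes> inv g \<in> B}"
    by (rule finite_subset[OF _ fin]) (use Dc in auto)
  moreover have "\<one> \<in> {d \<in> D. g \<otimes> d \<otimes> inv g \<in> B}"
    using g B(1) D by (simp add: subgroup.one_closed)
  ultimately have "card D div card {d \<in> D. g \<otimes> d \<otimes> inv g \<in> B} =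
      card (orbit ?K (\<lambda>k. restrict (?act k) ?X) Y)"
    using div_mult_self_is_m[of "card {d \<in> D. g \<otimes> d \<otimes> inv g \<in> B}"]
    by (metis (no_types, lifting) card_gt_0_iff empty_iff)
  then show ?thesis using that g(1) Y(2) by simp
qed

text \<open>A proper subgroup \<open>P\<close> of a \<open>p\<close>-group \<open>R\<close> acts on the cosets of \<open>P\<close> other than \<open>P\<close>
  itself. Their number is \<open>-1\<close> modulo \<open>p\<close>, so \<open>P\<close> fixes one of them.\<close>

lemma (in group) normalizer_grows:
  assumes fin: "finite (carrier G)" and "prime p" and R: "subgroup R G" "card R = p ^ n"
    and P: "subgroup P G" "P \<subset> R"
  obtains x where "x \<in> R" "x \<notin> P" "\<And>g. g \<in> P \<Longrightarrow> x \<otimes> g \<otimes> inv x \<in> P"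
proof -
  let ?X = "(\<lambda>x. P #> x) ` R - {P}"
  let ?K = "G\<lparr>carrier := P\<rparr>"
  let ?act = "\<lambda>d Y. Y #> inv d"
  have Rc: "x \<in> carrier G" if "x \<in> R" for x using R(1) that by (rule subgroup.mem_carrier)
  have Pc: "P \<subseteq> carrier G" using P(1) by (rule subgroup.subset)
  have PR: "x \<in> R" if "x \<in> P" for x using that P(2) by blast
  have finR: "finite R" using fin R(1) by (meson finite_subset subgroup.subset)
  have K: "group ?K" using P by (simp add: subgroup.subgroup_is_group)
  have PX: "P \<in> (\<lambda>x. P #> x) ` R"
    using P(1) Pc R(1) by (metis coset_mult_one image_eqI subgroup.one_closed)
  have c1: "card ((\<lambda>x. P #> x) ` R) = card R div card P" "card P dvd card R"
    using card_rcosets_div[OF fin R(1) P(1)] P(2) by auto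
  have cP: "card P < card R" using finR P(2) by (simp add: psubset_card_mono)
  have "finite P" using finR P(2) by (meson finite_subset psubset_imp_subset)
  then have "card P > 0" using subgroup.one_closed[OF P(1)] by (auto simp: card_gt_0_iff)
  then have "card R div card P > 1"
    using c1(2) cP by (metis dvd_div_eq_0_iff dvd_mult_div_cancel less_one linorder_neqE_nat mult.right_neutral nat_neq_iff not_less_zero)
  moreover have "card R div card P dvd p ^ n" using R(2) c1(2) by (metis dvd_mult_div_cancel dvd_triv_right)
  ultimately have pd: "p dvd card R div card P"
    using prime_power_dvd_cases[OF \<open>prime p\<close>] by fastforce
  have cX: "card ?X + 1 = card R div card P"
    using PX finR c1(1) by (metis Suc_eq_plus1 card.remove finite_imageI)
  have npX: "\<not> p dvd card ?X"
    using pd cX \<open>prime p\<close> by (metis dvd_add_right_iff nat_dvd_1_iff_1 not_prime_1)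
  obtain m where m: "card P = p ^ m"
    using c1(2) R(2) \<open>prime p\<close> by (metis divides_primepow_nat)
  have ordK: "order ?K = p ^ m" using m by (simp add: order_def)
  have finK: "finite (carrier ?K)" using \<open>finite P\<close> by simp
  obtain Y where Y: "Y \<in> ?X" "\<And>k. k \<in> carrier ?K \<Longrightarrow> ?act k Y = Y"
  proof (rule p_group_fixed_point[OF K finK ordK \<open>prime p\<close> _ npX, of ?act])
    show "finite ?X" using finR by simp
    show "?act k Y \<in> ?X" if k: "k \<in> carrier ?K" and Y: "Y \<in> ?X" for k Y
    proof -
      obtain x where x: "x \<in> R" "Y = P #> x" "Y \<noteq> P" using Y by auto
      have kP: "k \<in> P" using k by simp
      have "?act k Y = P #> (x \<otimes> inv k)" using x(1,2) kP Rc Pc PR by (simp add: coset_mult_assoc)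
      moreover have "x \<otimes> inv k \<in> R" using x(1) PR[OF kP] R(1)
        by (simp add: subgroup.m_closed subgroup.m_inv_closed)
      moreover have "P #> (x \<otimes> inv k) \<noteq> P"
      proof
        assume "P #> (x \<otimes> inv k) = P"
        then have "x \<otimes> inv k \<in> P" using rcos_self[OF _ P(1)] x(1) kP Rc PR by (metis inv_closed m_closed)
        then have "x \<otimes> inv k \<otimes> k \<in> P" using kP P(1) by (simp add: subgroup.m_closed)
        then have "x \<in> P" using x(1) kP Rc PR by (simp add: m_assoc)
        then show False using x P(1) Pc coset_join2 by (metis subgroup.mem_carrier)
      qed
      ultimately show ?thesis by auto
    qed
    show "?act \<one>\<^bsub>?K\<^esub> Y = Y" if "Y \<in> ?X" for Y
      using that Pc Rc by (auto simp: coset_mult_assoc)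
    show "?act (k \<otimes>\<^bsub>?K\<^esub> l) Y = ?act k (?act l Y)"
      if "k \<in> carrier ?K" "l \<in> carrier ?K" "Y \<in> ?X" for k l Y
      using that Rc PR Pc by (auto simp: coset_mult_assoc inv_mult_group m_assoc)
  qed blast
  obtain x where x: "x \<in> R" "Y = P #> x" "Y \<noteq> P" using Y(1) by auto
  have "x \<notin> P" using x P(1) Rc coset_join2 by metis
  moreover have "x \<otimes> g \<otimes> inv x \<in> P" if g: "g \<in> P" for g
  proof -
    have "P #> (x \<otimes> inv g) = P #> x"
      using Y(2)[of g] g x(1,2) Rc Pc PR by (simp add: coset_mult_assoc)
    then have "x \<otimes> inv g \<otimes> inv x \<in> P" using rcos_eq_iff[OF P(1)] x(1) g Rc PR by simp
    then have "inv (x \<otimes> inv g \<otimes> inv x) \<in> P" by (rule subgroup.m_inv_closed[OF P(1)])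
    then show ?thesis using x(1) g Rc PR by (simp add: inv_mult_group m_assoc)
  qed
  ultimately show ?thesis using that x(1) by blast
qed

section \<open>Families of injective homomorphisms\<close>

locale p_group = group S for S :: "('a, 'b) monoid_scheme" (structure) +
  fixes p :: nat
  assumes prime_p: "prime p" and finite_S: "finite (carrier S)" and order_S: "\<exists>n. order S = p ^ n"
begin

definition conj_by :: "'a \<Rightarrow> 'a \<Rightarrow> 'a" where
  "conj_by x g = x \<otimes> g \<otimes> inv x"

definition nrm :: "'a set \<Rightarrow> 'a set" where
  "nrm P = {g \<in> carrier S. conj_by g ` P = P}"

abbreviation cen :: "'a set \<Rightarrow> 'a set" where
  "cen P \<equiv> centralizer S P"

abbreviation pcen :: "'a set \<Rightarrow> 'a set" where
  "pcen P \<equiv> P <#> cen P"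

lemma conj_by_closed [simp]:
  "x \<in> carrier S \<Longrightarrow> g \<in> carrier S \<Longrightarrow> conj_by x g \<in> carrier S"
  by (simp add: conj_by_def)

lemma conj_by_one [simp]: "g \<in> carrier S \<Longrightarrow> conj_by \<one> g = g"
  by (simp add: conj_by_def)

lemma conj_by_mult:
  "x \<in> carrier S \<Longrightarrow> y \<in> carrier S \<Longrightarrow> g \<in> carrier S \<Longrightarrow> conj_by (x \<otimes> y) g = conj_by x (conj_by y g)"
  by (simp add: conj_by_def inv_mult_group m_assoc)

lemma conj_by_inv_cancel [simp]:
  assumes "x \<in> carrier S" "g \<in> carrier S"
  shows "conj_by x (conj_by (inv x) g) = g" "conj_by (inv x) (conj_by x g) = g"
  using assms by (simp_all flip: conj_by_mult)

lemma inj_conj_by: "x \<in> carrier S \<Longrightarrow> A \<subseteq> carrier S \<Longrightarrow> inj_on (conj_by x) A"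
  by (rule inj_on_inverseI[where g = "conj_by (inv x)"]) auto

lemma conj_by_hom:
  "x \<in> carrier S \<Longrightarrow> g \<in> carrier S \<Longrightarrow> h \<in> carrier S \<Longrightarrow> conj_by x (g \<otimes> h) = conj_by x g \<otimes> conj_by x h"
  by (simp add: conj_by_def m_assoc inv_cancel)

lemma subgroup_in_carrier: "subgroup P S \<Longrightarrow> x \<in> P \<Longrightarrow> x \<in> carrier S"
  by (rule subgroup.mem_carrier)

lemma finite_subgroup: "subgroup P S \<Longrightarrow> finite P"
  using finite_S by (meson finite_subset subgroup.subset)

lemma subgroup_card: assumes "subgroup P S" shows "\<exists>n. card P = p ^ n"
proof -
  have "card P dvd order S"
    using lagrange[OF assms] by (metis dvd_triv_right)
  then show ?thesis using order_S prime_p divides_primepow_nat by metis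
qed

lemma nrmI:
  assumes "subgroup P S" "g \<in> carrier S" "\<And>x. x \<in> P \<Longrightarrow> conj_by g x \<in> P"
  shows "g \<in> nrm P"
proof -
  have "conj_by g ` P = P"
    using finite_subgroup[OF assms(1)] inj_conj_by[OF assms(2) subgroup.subset[OF assms(1)]] assms(3)
    by (intro endo_inj_surj) auto
  then show ?thesis using assms(2) by (simp add: nrm_def)
qed

lemma nrmD: "g \<in> nrm P \<Longrightarrow> g \<in> carrier S" "g \<in> nrm P \<Longrightarrow> x \<in> P \<Longrightarrow> conj_by g x \<in> P"
  by (auto simp: nrm_def)

lemma nrm_subgroup: assumes P: "subgroup P S" shows "subgroup (nrm P) S"
proof (rule subgroup.intro)
  note Pc = subgroup_in_carrier[OF P]
  show "nrm P \<subseteq> carrier S" by (auto simp: nrm_def)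
  show "\<one> \<in> nrm P" using Pc by (intro nrmI P) auto
  fix x y assume x: "x \<in> nrm P"
  show "inv x \<in> nrm P"
  proof (rule nrmI[OF P])
    show "inv x \<in> carrier S" using nrmD(1)[OF x] by simp
    fix g assume g: "g \<in> P"
    then obtain g' where "g' \<in> P" "g = conj_by x g'" using x by (auto simp: nrm_def)
    then show "conj_by (inv x) g \<in> P" using nrmD(1)[OF x] Pc by simp
  qed
  assume y: "y \<in> nrm P"
  show "x \<otimes> y \<in> nrm P"
    using nrmD[OF x] nrmD[OF y] Pc by (intro nrmI P) (auto simp: conj_by_mult)
qed

lemma subgroup_le_nrm: assumes P: "subgroup P S" shows "P \<subseteq> nrm P"
  using P by (auto intro!: nrmI simp: conj_by_def subgroup.m_closed subgroup.m_inv_closed subgroup_in_carrier)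

lemma cen_iff: assumes P: "subgroup P S"
  shows "g \<in> cen P \<longleftrightarrow> g \<in> carrier S \<and> (\<forall>x\<in>P. conj_by g x = x)"
proof -
  have "g \<otimes> x = x \<otimes> g \<longleftrightarrow> conj_by g x = x" if "g \<in> carrier S" "x \<in> P" for x
    using subgroup_in_carrier[OF P that(2)] that(1)
    by (metis conj_by_def inv_solve_right m_closed)
  then show ?thesis by (auto simp: centralizer_def)
qed

lemma cen_subgroup: assumes P: "subgroup P S" shows "subgroup (cen P) S"
proof (rule subgroup.intro)
  note Pc = subgroup_in_carrier[OF P]
  show "cen P \<subseteq> carrier S" "\<one> \<in> cen P" using Pc by (auto simp: centralizer_def)
  fix x y assume x: "x \<in> cen P"
  then show "inv x \<in> cen P"
    unfolding cen_iff[OF P] using Pc by (metis conj_by_inv_cancel(2) inv_closed)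
  assume "y \<in> cen P"
  with x show "x \<otimes> y \<in> cen P" unfolding cen_iff[OF P] using Pc by (auto simp: conj_by_mult)
qed

lemma cen_le_nrm: "subgroup P S \<Longrightarrow> cen P \<subseteq> nrm P"
  by (auto simp: cen_iff intro!: nrmI)

lemma cen_antimono: "P \<subseteq> Q \<Longrightarrow> cen Q \<subseteq> cen P"
  by (auto simp: centralizer_def)

lemma nrm_conj_cen:
  assumes P: "subgroup P S" and g: "g \<in> nrm P" and c: "c \<in> cen P"
  shows "conj_by g c \<in> cen P"
  unfolding cen_iff[OF P]
proof (intro conjI ballI)
  have gc: "g \<in> carrier S" using g by (rule nrmD)
  have cc: "c \<in> carrier S" using c by (simp add: centralizer_def)
  show "conj_by g c \<in> carrier S" using gc cc by simp
  fix x assume "x \<in> P"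
  then obtain y where y: "y \<in> P" "x = conj_by g y" using g by (auto simp: nrm_def)
  have "conj_by (conj_by g c) x = conj_by g (conj_by c y)"
    using gc cc y subgroup_in_carrier[OF P y(1)] by (simp add: conj_by_def m_assoc inv_mult_group inv_cancel)
  then show "conj_by (conj_by g c) x = x" using c y by (simp add: cen_iff[OF P])
qed

lemma mult_subgroup_nrm:
  assumes P: "subgroup P S" and C: "subgroup C S" and PC: "\<And>g x. g \<in> P \<Longrightarrow> x \<in> C \<Longrightarrow> conj_by g x \<in> C"
  shows "subgroup (P <#> C) S"
proof (rule subgroup.intro)
  note Pc = subgroup_in_carrier[OF P] and Cc = subgroup_in_carrier[OF C]
  show "P <#> C \<subseteq> carrier S" using Pc Cc by (auto simp: set_mult_def)
  show "\<one> \<in> P <#> C"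
    using subgroup.one_closed[OF P] subgroup.one_closed[OF C] by (force simp: set_mult_def)
  fix x y assume "x \<in> P <#> C"
  then obtain g c where x: "x = g \<otimes> c" "g \<in> P" "c \<in> C" by (auto simp: set_mult_def)
  have "inv x = inv g \<otimes> conj_by g (inv c)"
    using x Pc Cc by (simp add: conj_by_def inv_mult_group m_assoc inv_cancel)
  moreover have "inv g \<in> P" using x P by (simp add: subgroup.m_inv_closed)
  moreover have "conj_by g (inv c) \<in> C" using x C by (simp add: subgroup.m_inv_closed PC)
  ultimately show "inv x \<in> P <#> C" by (auto simp: set_mult_def)
  assume "y \<in> P <#> C"
  then obtain h d where y: "y = h \<otimes> d" "h \<in> P" "d \<in> C" by (auto simp: set_mult_def)
  have "x \<otimes> y = (g \<otimes> h) \<otimes> (conj_by (inv h) c \<otimes> d)"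
    using x y Pc Cc by (simp add: conj_by_def m_assoc inv_cancel)
  moreover have "g \<otimes> h \<in> P" "conj_by (inv h) c \<otimes> d \<in> C"
    using x y P C by (simp_all add: subgroup.m_closed subgroup.m_inv_closed PC)
  ultimately show "x \<otimes> y \<in> P <#> C" by (auto simp: set_mult_def)
qed

lemma pcen_subgroup: assumes "subgroup P S" shows "subgroup (pcen P) S"
  using assms subgroup_le_nrm[OF assms] by (intro mult_subgroup_nrm cen_subgroup nrm_conj_cen) auto

lemma mult_superset: assumes P: "subgroup P S" and C: "subgroup C S"
  shows "P \<subseteq> P <#> C" "C \<subseteq> P <#> C"
  using subgroup.one_closed[OF P] subgroup.one_closed[OF C] subgroup_in_carrier[OF P] subgroup_in_carrier[OF C]
  by (force simp: set_mult_def)+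

lemma mult_least: assumes "subgroup N S" "P \<subseteq> N" "C \<subseteq> N" shows "P <#> C \<subseteq> N"
  using assms by (auto simp: set_mult_def intro: subgroup.m_closed)

lemma nrm_grows:
  assumes R: "subgroup R S" and P: "subgroup P S" "P \<subset> R"
  shows "P \<subset> nrm P \<inter> R"
proof -
  obtain n where n: "card R = p ^ n" using subgroup_card[OF R] by blast
  obtain x where x: "x \<in> R" "x \<notin> P" "\<And>g. g \<in> P \<Longrightarrow> x \<otimes> g \<otimes> inv x \<in> P"
    using normalizer_grows[OF finite_S prime_p R n P] by metis
  have "x \<in> nrm P" using x subgroup_in_carrier[OF R] by (intro nrmI P) (auto simp: conj_by_def)
  then show ?thesis using x P(2) subgroup_le_nrm[OF P(1)] by blast
qed

end

text \<open>A fusion system is encoded by the relation \<open>m P f\<close>, saying that \<open>f\<close> restricts to a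
  morphism from \<open>P\<close> to the whole group. The target of a morphism can be shrunk to any subgroup
  that contains its image, so this loses nothing; and since only the values of \<open>f\<close> on \<open>P\<close>
  matter, composition is composition of functions and restriction leaves \<open>f\<close> alone.\<close>

locale fus = p_group S p for S :: "('a, 'b) monoid_scheme" (structure) and p +
  fixes m :: "'a set \<Rightarrow> ('a \<Rightarrow> 'a) \<Rightarrow> bool"
  assumes mor_subgroup: "m P f \<Longrightarrow> subgroup P S"
    and mor_closed: "m P f \<Longrightarrow> x \<in> P \<Longrightarrow> f x \<in> carrier S"
    and mor_mult: "m P f \<Longrightarrow> x \<in> P \<Longrightarrow> y \<in> P \<Longrightarrow> f (x \<otimes> y) = f x \<otimes> f y"
    and mor_inj: "m P f \<Longrightarrow> inj_on f P"
    and mor_cong: "m P f \<Longrightarrow> (\<And>x. x \<in> P \<Longrightarrow> f x = g x) \<Longrightarrow> m P g"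
    and mor_restrict: "m P f \<Longrightarrow> subgroup R S \<Longrightarrow> R \<subseteq> P \<Longrightarrow> m R f"
    and mor_comp_o: "m P f \<Longrightarrow> m (f ` P) g \<Longrightarrow> m P (g \<circ> f)"
    and mor_inv: "m P f \<Longrightarrow> m (f ` P) (inv_into P f)"
    and mor_conj: "subgroup P S \<Longrightarrow> x \<in> carrier S \<Longrightarrow> m P (conj_by x)"
begin

lemma mor_image: "m P f \<Longrightarrow> subgroup (f ` P) S"
  using mor_inv mor_subgroup by blast

lemma mor_comp: "m P f \<Longrightarrow> m (f ` P) g \<Longrightarrow> m P (\<lambda>x. g (f x))"
  using mor_comp_o[of P f g] by (simp add: comp_def)

lemma mor_comp': "m P f \<Longrightarrow> m Q g \<Longrightarrow> f ` P \<subseteq> Q \<Longrightarrow> m P (\<lambda>x. g (f x))"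
  using mor_comp[of P f g] mor_restrict[of Q g "f ` P"] mor_image[of P f] by simp

lemma mor_id: "subgroup P S \<Longrightarrow> m P (\<lambda>x. x)"
  by (rule mor_cong[OF mor_conj[of P \<one>]]) (auto simp: subgroup_in_carrier)

lemma mor_group_hom: assumes "m P f" shows "group_hom (S\<lparr>carrier := P\<rparr>) S f"
proof -
  have "group (S\<lparr>carrier := P\<rparr>)" using mor_subgroup[OF assms] by (simp add: subgroup.subgroup_is_group)
  moreover have "f \<in> hom (S\<lparr>carrier := P\<rparr>) S" using mor_closed[OF assms] mor_mult[OF assms] by (auto simp: hom_def)
  ultimately show ?thesis by (simp add: group_hom_def group_hom_axioms_def is_group)
qed

lemma mor_inverse: assumes "m P f" "x \<in> P" shows "f (inv x) = inv (f x)"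
  using group_hom.hom_inv[OF mor_group_hom[OF assms(1)], of x] assms
    m_inv_consistent[OF mor_subgroup[OF assms(1)] assms(2)] by simp

lemma mor_conj_by: assumes f: "m P f" and "x \<in> P" "y \<in> P"
  shows "f (conj_by x y) = conj_by (f x) (f y)"
  using assms mor_subgroup[OF f]
  by (simp add: conj_by_def mor_mult mor_inverse subgroup.m_closed subgroup.m_inv_closed)

lemma mor_card: "m P f \<Longrightarrow> card (f ` P) = card P"
  by (simp add: mor_inj card_image)

lemma mor_image_subgroup: "m P f \<Longrightarrow> subgroup R S \<Longrightarrow> R \<subseteq> P \<Longrightarrow> subgroup (f ` R) S"
  using mor_restrict mor_image by blast

lemma mor_inv_into: "m P f \<Longrightarrow> x \<in> P \<Longrightarrow> inv_into P f (f x) = x"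
  by (simp add: mor_inj inv_into_f_f)

lemma mor_inv_image: "m P f \<Longrightarrow> R \<subseteq> P \<Longrightarrow> inv_into P f ` (f ` R) = R"
  by (simp add: mor_inj inv_into_image_cancel)

text \<open>A diagram of morphisms in which \<open>k\<close> is an isomorphism can be completed by its inverse.\<close>

lemma mor_left_factor:
  assumes h: "m P h" and k: "m Q k" and im: "\<And>x. x \<in> P \<Longrightarrow> f x \<in> Q \<and> k (f x) = h x"
  shows "m P f"
proof -
  have "h ` P \<subseteq> k ` Q" using im by (metis image_eqI image_subsetI)
  then have "m P (\<lambda>x. inv_into Q k (h x))" using mor_comp'[OF h mor_inv[OF k]] by blast
  then show ?thesis by (rule mor_cong) (metis im k mor_inv_into)
qed

lemma mor_right_factor:
  assumes h: "m P h" and f: "m P f" and eq: "\<And>x. x \<in> P \<Longrightarrow> k (f x) = h x"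
  shows "m (f ` P) k"
proof -
  have "m (f ` P) (\<lambda>y. h (inv_into P f y))"
    using mor_comp'[OF mor_inv[OF f] h] mor_inv_image[OF f subset_refl] by simp
  then show ?thesis by (rule mor_cong) (auto simp: f mor_inv_into eq)
qed

lemma mor_nrm:
  assumes f: "m R f" and P: "subgroup P S" "P \<subseteq> R" and g: "g \<in> R" "g \<in> nrm P"
  shows "f g \<in> nrm (f ` P)"
proof (rule nrmI)
  show "subgroup (f ` P) S" using mor_image_subgroup f P by blast
  show "f g \<in> carrier S" using f g mor_closed by blast
  fix y assume "y \<in> f ` P"
  then obtain x where x: "x \<in> P" "y = f x" by blast
  then have "conj_by (f g) y = f (conj_by g x)" using mor_conj_by[OF f] P g by auto
  then show "conj_by (f g) y \<in> f ` P" using x g nrmD by blast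
qed

lemma mor_cen:
  assumes f: "m R f" and "P \<subseteq> R" and g: "g \<in> R" "g \<in> cen P"
  shows "f g \<in> cen (f ` P)"
  using assms mor_closed[OF f] mor_mult[OF f, symmetric] by (auto simp: centralizer_def subset_iff)

lemma mor_cen_image: "m R f \<Longrightarrow> P \<subseteq> R \<Longrightarrow> cen P \<subseteq> R \<Longrightarrow> f ` cen P \<subseteq> cen (f ` P)"
  using mor_cen by blast

lemma mor_funpow: assumes f: "m P f" "f ` P = P" shows "m P (f ^^ n) \<and> (f ^^ n) ` P = P"
proof (induction n)
  case 0
  then show ?case using mor_id[OF mor_subgroup[OF f(1)]] by (simp add: id_def)
next
  case (Suc n)
  have "(\<lambda>x. f ((f ^^ n) x)) ` P = f ` (f ^^ n) ` P" by (simp only: image_image)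
  then show ?case using Suc mor_comp[of P "f ^^ n" f] f by (simp add: comp_def)
qed

end

context p_group
begin

definition fully_norm :: "('a set \<Rightarrow> ('a \<Rightarrow> 'a) \<Rightarrow> bool) \<Rightarrow> 'a set \<Rightarrow> bool" where
  "fully_norm m P \<longleftrightarrow> subgroup P S \<and> (\<forall>f. m P f \<longrightarrow> card (nrm (f ` P)) \<le> card (nrm P))"

definition fully_cent :: "('a set \<Rightarrow> ('a \<Rightarrow> 'a) \<Rightarrow> bool) \<Rightarrow> 'a set \<Rightarrow> bool" where
  "fully_cent m P \<longleftrightarrow> subgroup P S \<and> (\<forall>f. m P f \<longrightarrow> card (cen (f ` P)) \<le> card (cen P))"

definition cntr :: "('a set \<Rightarrow> ('a \<Rightarrow> 'a) \<Rightarrow> bool) \<Rightarrow> 'a set \<Rightarrow> bool" where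
  "cntr m P \<longleftrightarrow> subgroup P S \<and> (\<forall>f. m P f \<longrightarrow> cen (f ` P) \<subseteq> f ` P)"

definition Nphi :: "'a set \<Rightarrow> ('a \<Rightarrow> 'a) \<Rightarrow> 'a set" where
  "Nphi P f = {g \<in> nrm P. \<exists>h\<in>carrier S. \<forall>x\<in>P. f (conj_by g x) = conj_by h (f x)}"

definition auts :: "('a set \<Rightarrow> ('a \<Rightarrow> 'a) \<Rightarrow> bool) \<Rightarrow> 'a set \<Rightarrow> ('a \<Rightarrow> 'a) set" where
  "auts m P = {f \<in> extensional P. m P f \<and> f ` P = P}"

definition conj_auts :: "'a set \<Rightarrow> 'a set \<Rightarrow> ('a \<Rightarrow> 'a) set" where
  "conj_auts R P = (\<lambda>g. restrict (conj_by g) P) ` R"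

lemma fully_normD: "fully_norm m P \<Longrightarrow> m P f \<Longrightarrow> card (nrm (f ` P)) \<le> card (nrm P)"
  by (simp add: fully_norm_def)

lemma fully_centD: "fully_cent m P \<Longrightarrow> m P f \<Longrightarrow> card (cen (f ` P)) \<le> card (cen P)"
  by (simp add: fully_cent_def)

lemma cntrD: "cntr m P \<Longrightarrow> m P f \<Longrightarrow> cen (f ` P) \<subseteq> f ` P"
  by (simp add: cntr_def)

text \<open>The two saturation axioms; the order of \<open>Aut\<^sub>S(P)\<close> being a power of \<open>p\<close>, it is a Sylow
  subgroup if and only if its index is prime to \<open>p\<close>.\<close>

definition sylow_axiom :: "('a set \<Rightarrow> ('a \<Rightarrow> 'a) \<Rightarrow> bool) \<Rightarrow> bool" where
  "sylow_axiom m \<longleftrightarrow> (\<forall>P. fully_norm m P \<longrightarrow>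
     fully_cent m P \<and> \<not> p dvd card (auts m P) div card (conj_auts (nrm P) P))"

definition extension_at :: "('a set \<Rightarrow> ('a \<Rightarrow> 'a) \<Rightarrow> bool) \<Rightarrow> 'a set \<Rightarrow> bool" where
  "extension_at m P \<longleftrightarrow> (\<forall>f. m P f \<longrightarrow> fully_cent m (f ` P) \<longrightarrow>
     (\<exists>f'. m (Nphi P f) f' \<and> (\<forall>x\<in>P. f' x = f x)))"

end

context fus
begin

lemma Nphi_subgroup: assumes f: "m P f" shows "subgroup (Nphi P f) S"
proof (rule subgroup.intro)
  note P = mor_subgroup[OF f] and Pc = subgroup_in_carrier[OF mor_subgroup[OF f]]
  note N = nrm_subgroup[OF P] and fc = mor_closed[OF f]
  show "Nphi P f \<subseteq> carrier S" by (auto simp: Nphi_def nrmD)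
  show "\<one> \<in> Nphi P f" using subgroup.one_closed[OF N] Pc fc
    by (auto simp: Nphi_def intro!: bexI[of _ \<one>])
  fix x y assume "x \<in> Nphi P f"
  then obtain h where x: "x \<in> nrm P" "h \<in> carrier S" "\<And>z. z \<in> P \<Longrightarrow> f (conj_by x z) = conj_by h (f z)"
    by (auto simp: Nphi_def)
  have "f (conj_by (inv x) z) = conj_by (inv h) (f z)" if z: "z \<in> P" for z
  proof -
    have z': "conj_by (inv x) z \<in> P" using subgroup.m_inv_closed[OF N x(1)] z nrmD by blast
    then have "f z = conj_by h (f (conj_by (inv x) z))"
      using x(3)[OF z'] z Pc nrmD(1)[OF x(1)] by simp
    then show ?thesis using x(2) fc[OF z'] by simp
  qed
  then show "inv x \<in> Nphi P f"
    using x subgroup.m_inv_closed[OF N x(1)] by (auto simp: Nphi_def intro!: bexI[of _ "inv h"])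
  assume "y \<in> Nphi P f"
  then obtain k where y: "y \<in> nrm P" "k \<in> carrier S" "\<And>z. z \<in> P \<Longrightarrow> f (conj_by y z) = conj_by k (f z)"
    by (auto simp: Nphi_def)
  have "f (conj_by (x \<otimes> y) z) = conj_by (h \<otimes> k) (f z)" if z: "z \<in> P" for z
    using x y z nrmD[OF y(1)] nrmD(1)[OF x(1)] Pc fc by (simp add: conj_by_mult)
  then show "x \<otimes> y \<in> Nphi P f"
    using x y subgroup.m_closed[OF N] by (auto simp: Nphi_def intro!: bexI[of _ "h \<otimes> k"])
qed

lemma Nphi_le_nrm: "Nphi P f \<subseteq> nrm P"
  by (auto simp: Nphi_def)

lemma Nphi_superset: assumes f: "m P f" shows "P \<subseteq> Nphi P f" "cen P \<subseteq> Nphi P f"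
proof -
  note P = mor_subgroup[OF f]
  show "P \<subseteq> Nphi P f"
    using subgroup_le_nrm[OF P] mor_conj_by[OF f] mor_closed[OF f] by (auto simp: Nphi_def)
  show "cen P \<subseteq> Nphi P f"
    using cen_le_nrm[OF P] mor_closed[OF f] by (auto simp: Nphi_def cen_iff[OF P] intro!: bexI[of _ \<one>])
qed

lemma pcen_le_Nphi: "m P f \<Longrightarrow> pcen P \<subseteq> Nphi P f"
  using Nphi_superset Nphi_subgroup by (intro mult_least)

lemma exists_fully_norm:
  assumes P: "subgroup P S" obtains f where "m P f" "fully_norm m (f ` P)"
proof -
  let ?A = "(\<lambda>f. card (nrm (f ` P))) ` {f. m P f}"
  have "?A \<subseteq> {..card (carrier S)}"
    using finite_S by (auto intro!: card_mono simp: nrm_def)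
  then have fin: "finite ?A" by (rule finite_subset) simp
  have "?A \<noteq> {}" using mor_id[OF P] by blast
  then have "Max ?A \<in> ?A" by (rule Max_in[OF fin])
  then obtain f where f: "m P f" "card (nrm (f ` P)) = Max ?A" by auto
  have "card (nrm (g ` f ` P)) \<le> card (nrm (f ` P))" if "m (f ` P) g" for g
  proof -
    have "m P (\<lambda>x. g (f x))" using f(1) that mor_comp by blast
    then have "card (nrm (g ` f ` P)) \<in> ?A" by (auto simp: image_image intro!: image_eqI)
    then show ?thesis using f(2) fin by simp
  qed
  then have "fully_norm m (f ` P)" using f(1) mor_image by (auto simp: fully_norm_def)
  with f(1) show ?thesis using that by blast
qed

lemma fully_cent_image_cen:
  assumes f: "m R f" and P: "subgroup P S" "P \<subseteq> R" "cen P \<subseteq> R" and fc: "fully_cent m P"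
  shows "f ` cen P = cen (f ` P)"
proof (rule card_subset_eq)
  have fP: "subgroup (f ` P) S" using f P mor_image_subgroup by blast
  show "finite (cen (f ` P))" using finite_subgroup[OF cen_subgroup[OF fP]] .
  show sub: "f ` cen P \<subseteq> cen (f ` P)" using mor_cen_image[OF f P(2,3)] .
  have "card (cen (f ` P)) \<le> card (cen P)"
    using fc mor_restrict[OF f P(1,2)] by (auto simp: fully_cent_def)
  moreover have "card (f ` cen P) = card (cen P)"
    using mor_inj[OF f] P(3) by (meson card_image inj_on_subset)
  ultimately show "card (f ` cen P) = card (cen (f ` P))"
    using card_mono[OF \<open>finite (cen (f ` P))\<close> sub] by simp
qed

lemma mult_image: assumes f: "m R f" and "P \<subseteq> R" "C \<subseteq> R"
  shows "f ` (P <#> C) = f ` P <#> f ` C"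
proof -
  have "f (g \<otimes> c) = f g \<otimes> f c" if "g \<in> P" "c \<in> C" for g c
    using that assms(2,3) mor_mult[OF f] by blast
  then show ?thesis unfolding set_mult_def by (auto simp: image_iff; metis)
qed

lemma pcen_image:
  assumes f: "m R f" and P: "subgroup P S" and R: "pcen P \<subseteq> R" and fc: "fully_cent m P"
  shows "f ` pcen P = pcen (f ` P)"
proof -
  have PR: "P \<subseteq> R" "cen P \<subseteq> R" using mult_superset[OF P cen_subgroup[OF P]] R by auto
  show ?thesis using mult_image[OF f PR] fully_cent_image_cen[OF f P PR fc] by simp
qed

text \<open>If \<open>P\<close> is fully centralized then any isomorphism from \<open>P C\<^sub>S(P)\<close> has to send \<open>C\<^sub>S(P)\<close>
  onto the centralizer of the image of \<open>P\<close>, which therefore lies in the image.\<close>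

lemma cntr_pcen:
  assumes P: "subgroup P S" and fc: "fully_cent m P" shows "cntr m (pcen P)"
  unfolding cntr_def
proof (intro conjI allI impI)
  show "subgroup (pcen P) S" using pcen_subgroup[OF P] .
  fix f assume f: "m (pcen P) f"
  have "f ` pcen P = pcen (f ` P)" using pcen_image[OF f P subset_refl fc] .
  moreover have "f ` P \<subseteq> f ` pcen P" using mult_superset(1)[OF P cen_subgroup[OF P]] by blast
  moreover have "subgroup (f ` P) S"
    using mor_image_subgroup[OF f P] mult_superset(1)[OF P cen_subgroup[OF P]] by blast
  ultimately show "cen (f ` pcen P) \<subseteq> f ` pcen P"
    using cen_antimono[of "f ` P" "f ` pcen P"] mult_superset(2)[of "f ` P" "cen (f ` P)"] cen_subgroup by blast
qed

lemma cntr_image: assumes "cntr m P" "m P f" shows "cntr m (f ` P)"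
  unfolding cntr_def
proof (intro conjI allI impI)
  show "subgroup (f ` P) S" using assms(2) by (rule mor_image)
  fix g assume "m (f ` P) g"
  then have "m P (\<lambda>x. g (f x))" using assms(2) mor_comp by blast
  then have "cen ((\<lambda>x. g (f x)) ` P) \<subseteq> (\<lambda>x. g (f x)) ` P"
    by (rule cntrD[OF assms(1)])
  then show "cen (g ` f ` P) \<subseteq> g ` f ` P" by (simp only: image_image)
qed

lemma cntr_overgroup: assumes "cntr m P" "subgroup R S" "P \<subseteq> R" shows "cntr m R"
  unfolding cntr_def
proof (intro conjI allI impI)
  fix f assume "m R f"
  then have "m P f" using assms mor_restrict by (auto simp: cntr_def)
  then have "cen (f ` P) \<subseteq> f ` P" using assms by (auto simp: cntr_def)
  then show "cen (f ` R) \<subseteq> f ` R" using cen_antimono[of "f ` P" "f ` R"] assms(3) by blast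
qed (use assms in auto)

lemma cntr_fully_cent: assumes "cntr m P" shows "fully_cent m P"
  unfolding fully_cent_def
proof (intro conjI allI impI)
  show P: "subgroup P S" using assms by (simp add: cntr_def)
  fix f assume f: "m P f"
  then have "cen (f ` P) \<subseteq> f ` P" using assms by (auto simp: cntr_def)
  moreover note g = mor_inv[OF f]
  ultimately have "inv_into P f ` cen (f ` P) \<subseteq> cen P"
    using mor_cen_image[OF g subset_refl] mor_inv_image[OF f subset_refl] by simp
  then have "card (inv_into P f ` cen (f ` P)) \<le> card (cen P)"
    using finite_subgroup[OF cen_subgroup[OF P]] by (simp add: card_mono)
  moreover have "card (inv_into P f ` cen (f ` P)) = card (cen (f ` P))"
    using mor_inj[OF g] \<open>cen (f ` P) \<subseteq> f ` P\<close> by (meson card_image inj_on_subset)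
  ultimately show "card (cen (f ` P)) \<le> card (cen P)" by simp
qed

lemma cntr_carrier: "cntr m (carrier S)"
  unfolding cntr_def
proof (intro conjI allI impI)
  fix f assume f: "m (carrier S) f"
  have "f ` carrier S = carrier S"
    using finite_S mor_inj[OF f] mor_closed[OF f] by (intro endo_inj_surj) auto
  then show "cen (f ` carrier S) \<subseteq> f ` carrier S" by (auto simp: centralizer_def)
qed (rule subgroup_self)

lemma mor_carrier_image: "m (carrier S) f \<Longrightarrow> f ` carrier S = carrier S"
  using finite_S mor_inj mor_closed by (intro endo_inj_surj) auto

end

section \<open>Sylow's theorem in automorphism groups\<close>

lemma finite_Bij: "finite P \<Longrightarrow> finite (Bij P)"
  by (rule finite_subset[OF _ finite_PiE[of P "\<lambda>_. P"]])
    (auto simp: Bij_def bij_betw_def PiE_def)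

lemma BijGroup_mult: "f \<in> Bij P \<Longrightarrow> g \<in> Bij P \<Longrightarrow> f \<otimes>\<^bsub>BijGroup P\<^esub> g = compose P f g"
  by (simp add: BijGroup_def)

lemma subgroup_BijGroupI:
  assumes "D \<subseteq> Bij P" "(\<lambda>x\<in>P. x) \<in> D"
    and "\<And>f g. f \<in> D \<Longrightarrow> g \<in> D \<Longrightarrow> compose P f g \<in> D"
    and "\<And>f. f \<in> D \<Longrightarrow> restrict (inv_into P f) P \<in> D"
  shows "subgroup D (BijGroup P)"
proof (rule subgroup.intro)
  show "D \<subseteq> carrier (BijGroup P)" "\<one>\<^bsub>BijGroup P\<^esub> \<in> D"
    using assms(1,2) by (auto simp: BijGroup_def)
  fix f g assume f: "f \<in> D"
  then show "inv\<^bsub>BijGroup P\<^esub> f \<in> D" using inv_BijGroup[of f P] assms(1,4) by auto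
  assume "g \<in> D"
  with f show "f \<otimes>\<^bsub>BijGroup P\<^esub> g \<in> D" using BijGroup_mult[of f P g] assms(1,3) by (simp add: subset_iff)
qed

context p_group
begin

lemma conj_by_Bij: assumes "subgroup P S" "g \<in> nrm P" shows "restrict (conj_by g) P \<in> Bij P"
  using assms inj_conj_by[of g P] subgroup.subset[OF assms(1)] by (auto simp: Bij_def bij_betw_def nrm_def)

lemma conj_by_BijGroup_hom:
  assumes P: "subgroup P S" and k: "k \<in> hom (S\<lparr>carrier := R\<rparr>) S" "k ` R \<subseteq> nrm P"
  shows "(\<lambda>w. restrict (conj_by (k w)) P) \<in> hom (S\<lparr>carrier := R\<rparr>) (BijGroup P)"
proof (rule homI)
  fix w assume w: "w \<in> carrier (S\<lparr>carrier := R\<rparr>)"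
  have kw: "k w \<in> nrm P" using w k(2) by auto
  then show "restrict (conj_by (k w)) P \<in> carrier (BijGroup P)"
    using conj_by_Bij[OF P] by (simp add: BijGroup_def)
  fix v assume v: "v \<in> carrier (S\<lparr>carrier := R\<rparr>)"
  have kv: "k v \<in> nrm P" using v k(2) by auto
  have "k (w \<otimes> v) = k w \<otimes> k v" using k(1) w v by (auto simp: hom_def)
  then show "restrict (conj_by (k (w \<otimes>\<^bsub>S\<lparr>carrier := R\<rparr>\<^esub> v))) P =
      restrict (conj_by (k w)) P \<otimes>\<^bsub>BijGroup P\<^esub> restrict (conj_by (k v)) P"
    using conj_by_Bij[OF P kw] conj_by_Bij[OF P kv] nrmD[OF kw] nrmD[OF kv] subgroup_in_carrier[OF P]
    by (auto simp: BijGroup_mult compose_def conj_by_mult fun_eq_iff)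
qed

lemma conj_auts_subgroup:
  assumes P: "subgroup P S" and R: "subgroup R S" "R \<subseteq> nrm P"
  shows "subgroup (conj_auts R P) (BijGroup P)"
proof -
  have "(\<lambda>w. w) \<in> hom (S\<lparr>carrier := R\<rparr>) S" using subgroup_in_carrier[OF R(1)] by (auto simp: hom_def)
  then have "(\<lambda>w. restrict (conj_by w) P) \<in> hom (S\<lparr>carrier := R\<rparr>) (BijGroup P)"
    using conj_by_BijGroup_hom[OF P, of "\<lambda>w. w" R] R(2) by simp
  moreover have "group (S\<lparr>carrier := R\<rparr>)" using R(1) by (simp add: subgroup.subgroup_is_group)
  ultimately interpret group_hom "S\<lparr>carrier := R\<rparr>" "BijGroup P" "\<lambda>w. restrict (conj_by w) P"
    by (simp add: group_hom_def group_hom_axioms_def group_BijGroup)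
  show ?thesis using img_is_subgroup by (simp add: conj_auts_def)
qed

text \<open>The twisted form of Sylow's theorem, for a group \<open>R\<close> that acts on \<open>P\<close> in two ways: by
  conjugation in \<open>S\<close>, through \<open>k\<close>, and by transport along \<open>\<psi>\<close> of the conjugation on \<open>P0\<close>.\<close>

lemma twisted_sylow_auts:
  assumes P: "subgroup P S"
    and D: "subgroup D (BijGroup P)" and B: "subgroup B (BijGroup P)" "B \<subseteq> D" "\<not> p dvd card D div card B"
    and R: "subgroup R S" and \<psi>: "bij_betw \<psi> P0 P" and P0: "subgroup P0 S" "R \<subseteq> nrm P0"
    and k: "k \<in> hom (S\<lparr>carrier := R\<rparr>) S" "k ` R \<subseteq> nrm P"
    and act: "\<And>w d. w \<in> R \<Longrightarrow> d \<in> D \<Longrightarrow>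
      \<exists>d'\<in>D. \<forall>y\<in>P0. conj_by (k w) (d (\<psi> y)) = d' (\<psi> (conj_by w y))"
    and nrm: "\<And>w b. w \<in> R \<Longrightarrow> b \<in> B \<Longrightarrow>
      \<exists>b'\<in>B. \<forall>y\<in>P. conj_by (k w) (b y) = b' (conj_by (k w) y)"
  obtains d where "d \<in> D"
    and "\<And>w. w \<in> R \<Longrightarrow> \<exists>b\<in>B. \<forall>y\<in>P0. d (\<psi> (conj_by w y)) = b (conj_by (k w) (d (\<psi> y)))"
proof -
  interpret G: group "BijGroup P" by (rule group_BijGroup)
  let ?K = "S\<lparr>carrier := R\<rparr>"
  let ?i = "inv_into P0 \<psi>"
  let ?h1 = "\<lambda>w. restrict (conj_by (k w)) P"
  let ?h2 = "\<lambda>w. restrict (\<lambda>y. \<psi> (conj_by w (?i y))) P"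
  have inj: "inj_on \<psi> P0" and im: "\<psi> ` P0 = P" using \<psi> by (auto simp: bij_betw_def)
  have i: "?i y \<in> P0" "\<psi> (?i y) = y" if "y \<in> P" for y
    using that im by (auto intro: inv_into_into f_inv_into_f)
  have i': "?i (\<psi> y) = y" if "y \<in> P0" for y using that inj by (rule inv_into_f_f[rotated])
  have DB: "D \<subseteq> Bij P" using subgroup.subset[OF D] by (simp add: BijGroup_def)
  have K: "group ?K" using R by (simp add: subgroup.subgroup_is_group)
  obtain n where n: "order ?K = p ^ n" using subgroup_card[OF R] by (auto simp: order_def)
  have h1: "?h1 \<in> hom ?K (BijGroup P)" by (rule conj_by_BijGroup_hom[OF P k])
  then have h1B: "?h1 w \<in> Bij P" if "w \<in> R" for w using that by (auto simp: hom_def BijGroup_def)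
  have h2B: "?h2 w \<in> Bij P" if "w \<in> R" for w
  proof -
    have w: "w \<in> nrm P0" using that P0(2) by blast
    have "inj_on (conj_by w) P0"
      using nrmD(1)[OF w] subgroup.subset[OF P0(1)] by (intro inj_conj_by)
    then have "bij_betw (conj_by w) P0 P0" using w by (auto simp: bij_betw_def nrm_def)
    then have "bij_betw (\<psi> \<circ> (conj_by w \<circ> ?i)) P P"
      using \<psi> bij_betw_inv_into[OF \<psi>] by (intro bij_betw_trans)
    then show ?thesis by (simp add: Bij_def bij_betw_def comp_def inj_on_def)
  qed
  have h2: "?h2 \<in> hom ?K (BijGroup P)"
  proof (rule homI)
    fix w v assume w: "w \<in> carrier ?K"
    then show "?h2 w \<in> carrier (BijGroup P)" using h2B by (simp add: BijGroup_def)
    assume v: "v \<in> carrier ?K"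
    have wv: "w \<in> nrm P0" "v \<in> nrm P0" using w v P0(2) by auto
    have "\<psi> (conj_by (w \<otimes> v) (?i y)) = \<psi> (conj_by w (?i (\<psi> (conj_by v (?i y)))))" if "y \<in> P" for y
      using i(1)[OF that] nrmD[OF wv(1)] nrmD[OF wv(2)] subgroup_in_carrier[OF P0(1)]
      by (simp add: i' conj_by_mult)
    moreover have "\<psi> (conj_by v (?i y)) \<in> P" if "y \<in> P" for y
      using i(1)[OF that] nrmD(2)[OF wv(2)] im by blast
    ultimately show "?h2 (w \<otimes>\<^bsub>?K\<^esub> v) = ?h2 w \<otimes>\<^bsub>BijGroup P\<^esub> ?h2 v"
      using w v h2B by (auto simp: BijGroup_mult compose_def fun_eq_iff)
  qed
  have fin: "finite (carrier (BijGroup P))" using finite_Bij[OF finite_subgroup[OF P]] by (simp add: BijGroup_def)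
  obtain d where d: "d \<in> D" "\<And>w. w \<in> carrier ?K \<Longrightarrow> \<exists>b\<in>B. d \<otimes>\<^bsub>BijGroup P\<^esub> ?h2 w
      \<otimes>\<^bsub>BijGroup P\<^esub> inv\<^bsub>BijGroup P\<^esub> d = b \<otimes>\<^bsub>BijGroup P\<^esub> ?h1 w"
  proof (rule G.twisted_sylow[OF fin prime_p D B(1) B(2,3) K _ n h1 h2])
    show "finite (carrier ?K)" using finite_subgroup[OF R] by simp
    show "?h1 w \<otimes>\<^bsub>BijGroup P\<^esub> d \<otimes>\<^bsub>BijGroup P\<^esub> inv\<^bsub>BijGroup P\<^esub> ?h2 w \<in> D"
      if w: "w \<in> carrier ?K" and d: "d \<in> D" for w d
    proof -
      have w: "w \<in> R" using w by simp
      obtain d' where d': "d' \<in> D" "\<And>y. y \<in> P0 \<Longrightarrow> conj_by (k w) (d (\<psi> y)) = d' (\<psi> (conj_by w y))"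
        using act[OF w d] by blast
      have Bij: "d \<in> Bij P" "d' \<in> Bij P" using d d'(1) DB by auto
      have "conj_by (k w) (d y) = d' (\<psi> (conj_by w (?i y)))" if "y \<in> P" for y
        using d'(2)[OF i(1)[OF that]] i(2)[OF that] by simp
      moreover have "d y \<in> P" if "y \<in> P" for y using Bij(1) that by (auto simp: Bij_def bij_betw_def)
      ultimately have "?h1 w \<otimes>\<^bsub>BijGroup P\<^esub> d = d' \<otimes>\<^bsub>BijGroup P\<^esub> ?h2 w"
        using Bij h1B[OF w] h2B[OF w] by (auto simp: BijGroup_mult compose_def fun_eq_iff)
      moreover have c: "d' \<in> carrier (BijGroup P)" "?h2 w \<in> carrier (BijGroup P)"
        using Bij h2B[OF w] by (simp_all add: BijGroup_def)
      ultimately show ?thesis using d'(1) by (simp add: G.m_assoc)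
    qed
    show "?h1 w \<otimes>\<^bsub>BijGroup P\<^esub> b \<otimes>\<^bsub>BijGroup P\<^esub> inv\<^bsub>BijGroup P\<^esub> ?h1 w \<in> B"
      if w: "w \<in> carrier ?K" and b: "b \<in> B" for w b
    proof -
      have w: "w \<in> R" using w by simp
      obtain b' where b': "b' \<in> B" "\<And>y. y \<in> P \<Longrightarrow> conj_by (k w) (b y) = b' (conj_by (k w) y)"
        using nrm[OF w b] by blast
      have Bij: "b \<in> Bij P" "b' \<in> Bij P" using b b'(1) B(2) DB by auto
      have "b y \<in> P" if "y \<in> P" for y using Bij(1) that by (auto simp: Bij_def bij_betw_def)
      then have "?h1 w \<otimes>\<^bsub>BijGroup P\<^esub> b = b' \<otimes>\<^bsub>BijGroup P\<^esub> ?h1 w"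
        using Bij h1B[OF w] b'(2) by (auto simp: BijGroup_mult compose_def fun_eq_iff)
      moreover have c: "b' \<in> carrier (BijGroup P)" "?h1 w \<in> carrier (BijGroup P)"
        using Bij h1B[OF w] by (simp_all add: BijGroup_def)
      ultimately show ?thesis using b'(1) by (simp add: G.m_assoc)
    qed
  qed blast
  have dB: "d \<in> Bij P" using d(1) DB by blast
  have "\<exists>b\<in>B. \<forall>y\<in>P0. d (\<psi> (conj_by w y)) = b (conj_by (k w) (d (\<psi> y)))" if w: "w \<in> R" for w
  proof -
    obtain b where b: "b \<in> B" "d \<otimes>\<^bsub>BijGroup P\<^esub> ?h2 w \<otimes>\<^bsub>BijGroup P\<^esub> inv\<^bsub>BijGroup P\<^esub> d = b \<otimes>\<^bsub>BijGroup P\<^esub> ?h1 w"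
      using d(2)[of w] w by auto
    have bB: "b \<in> Bij P" using b(1) B(2) DB by blast
    have c: "d \<in> carrier (BijGroup P)" "b \<in> carrier (BijGroup P)" "?h1 w \<in> carrier (BijGroup P)" "?h2 w \<in> carrier (BijGroup P)"
      using dB bB h1B[OF w] h2B[OF w] by (simp_all add: BijGroup_def)
    have "d \<otimes>\<^bsub>BijGroup P\<^esub> ?h2 w = b \<otimes>\<^bsub>BijGroup P\<^esub> ?h1 w \<otimes>\<^bsub>BijGroup P\<^esub> d"
      unfolding b(2)[symmetric] using c by (simp add: G.m_assoc)
    also have "\<dots> = compose P (compose P b (?h1 w)) d"
      using dB bB h1B[OF w] by (simp add: BijGroup_mult compose_Bij)
    finally have eq: "compose P d (?h2 w) = compose P (compose P b (?h1 w)) d"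
      using dB h2B[OF w] by (simp add: BijGroup_mult)
    have "d (\<psi> (conj_by w y)) = b (conj_by (k w) (d (\<psi> y)))" if y: "y \<in> P0" for y
    proof -
      have y': "\<psi> y \<in> P" "d (\<psi> y) \<in> P" using y im dB by (auto simp: Bij_def bij_betw_def)
      show ?thesis using fun_cong[OF eq, of "\<psi> y"] y' i'[OF y] by (simp add: compose_def)
    qed
    then show ?thesis using b(1) by blast
  qed
  then show ?thesis using that d(1) by blast
qed

text \<open>For a system \<open>M\<close> inside \<open>m\<close> this says that \<open>M\<close> contains \<open>O\<^sup>p\<^sup>'(Aut(Q))\<close>, because that group is
  generated by the elements of \<open>p\<close>-power order.\<close>

definition p_auts_in :: "('a set \<Rightarrow> ('a \<Rightarrow> 'a) \<Rightarrow> bool) \<Rightarrow> ('a set \<Rightarrow> ('a \<Rightarrow> 'a) \<Rightarrow> bool) \<Rightarrow> 'a set \<Rightarrow> bool" where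
  "p_auts_in m M Q \<longleftrightarrow> (\<forall>f k. m Q f \<longrightarrow> f ` Q = Q \<longrightarrow> (\<forall>x\<in>Q. (f ^^ (p ^ k)) x = x) \<longrightarrow> M Q f)"

lemma p_auts_inD:
  "p_auts_in m M Q \<Longrightarrow> m Q f \<Longrightarrow> f ` Q = Q \<Longrightarrow> \<exists>k. \<forall>x\<in>Q. (f ^^ (p ^ k)) x = x \<Longrightarrow> M Q f"
  unfolding p_auts_in_def by blast

lemma auts_mem: "f \<in> auts m P \<Longrightarrow> x \<in> P \<Longrightarrow> f x \<in> P"
  by (auto simp: auts_def)

lemma card_conj_auts_coprime_mono:
  assumes P: "subgroup P S" and B: "subgroup B (BijGroup P)" and D: "subgroup D (BijGroup P)" and A: "subgroup A (BijGroup P)"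
    and "B \<subseteq> D" "D \<subseteq> A" and "\<not> p dvd card A div card B"
  shows "\<not> p dvd card D div card B"
proof -
  interpret G: group "BijGroup P" by (rule group_BijGroup)
  have fin: "finite (carrier (BijGroup P))" using finite_Bij[OF finite_subgroup[OF P]] by (simp add: BijGroup_def)
  have "card B dvd card D" "card D dvd card A" "card B dvd card A"
    using G.card_rcosets_div(2)[OF fin D B] G.card_rcosets_div(2)[OF fin A D] assms(5,6) by auto
  then have "card D div card B dvd card A div card B"
    by (metis div_dvd_div)
  then show ?thesis using assms(7) dvd_trans by blast
qed

end

context fus
begin

lemma auts_Bij: "auts m P \<subseteq> Bij P"
  by (auto simp: auts_def Bij_def bij_betw_def mor_inj)

lemma auts_compose: "f \<in> auts m P \<Longrightarrow> g \<in> auts m P \<Longrightarrow> compose P f g \<in> auts m P"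
  unfolding auts_def
proof (intro CollectI conjI; elim CollectE conjE)
  assume fg: "m P f" "f ` P = P" "m P g" "g ` P = P"
  show "m P (compose P f g)"
    by (rule mor_cong[OF mor_comp'[OF fg(3) fg(1)]]) (use fg in \<open>auto simp: compose_def\<close>)
  show "compose P f g ` P = P" using fg by (simp add: compose_def) (simp flip: image_image)
qed simp

lemma auts_inv: "f \<in> auts m P \<Longrightarrow> restrict (inv_into P f) P \<in> auts m P"
  unfolding auts_def
proof (intro CollectI conjI; elim CollectE conjE)
  assume f: "m P f" "f ` P = P"
  have "m P (inv_into P f)" using mor_inv[OF f(1)] f(2) by simp
  then show "m P (restrict (inv_into P f) P)" by (rule mor_cong) simp
  show "restrict (inv_into P f) P ` P = P"
    using mor_inv_image[OF f(1) subset_refl] f(2) by simp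
qed simp

lemma auts_id: "subgroup P S \<Longrightarrow> (\<lambda>x\<in>P. x) \<in> auts m P"
  using mor_cong[OF mor_id[of P], of "\<lambda>x\<in>P. x"] by (auto simp: auts_def)

lemma auts_subgroup: "subgroup P S \<Longrightarrow> subgroup (auts m P) (BijGroup P)"
  using auts_Bij auts_id auts_compose auts_inv by (intro subgroup_BijGroupI) auto

lemma conj_auts_le_auts:
  assumes P: "subgroup P S" and R: "R \<subseteq> nrm P" shows "conj_auts R P \<subseteq> auts m P"
proof
  fix f assume "f \<in> conj_auts R P"
  then obtain g where g: "g \<in> nrm P" "f = restrict (conj_by g) P" using R by (auto simp: conj_auts_def)
  then have "m P f" using mor_cong[OF mor_conj[OF P nrmD(1)[OF g(1)]], of f] by simp
  then show "f \<in> auts m P" using g by (auto simp: auts_def nrm_def)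
qed

lemma restrict_auts: "m P f \<Longrightarrow> f ` P = P \<Longrightarrow> restrict f P \<in> auts m P"
  using mor_cong[of P f "restrict f P"] by (simp add: auts_def)

text \<open>The powers of the transported map are the transports of the conjugations by the powers of \<open>w\<close>,
  and the order of \<open>w\<close> divides that of \<open>S\<close>.\<close>

lemma conj_transport:
  assumes f: "m P f" and w: "w \<in> nrm P"
  defines "t \<equiv> \<lambda>y. f (conj_by w (inv_into P f y))"
  shows "m (f ` P) t" "t ` f ` P = f ` P" "\<exists>k. \<forall>x\<in>f ` P. (t ^^ (p ^ k)) x = x"
proof -
  note P = mor_subgroup[OF f]
  have wc: "w \<in> carrier S" using nrmD[OF w] by simp
  have c: "m P (conj_by w)" using mor_conj[OF P wc] .
  have cP: "conj_by w ` P = P" using w by (simp add: nrm_def)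
  have t: "t (f x) = f (conj_by w x)" if "x \<in> P" for x using that by (simp add: t_def mor_inv_into[OF f])
  have fc: "m P (\<lambda>x. f (conj_by w x))" by (rule mor_comp'[OF c f]) (simp add: cP)
  show "m (f ` P) t" by (rule mor_right_factor[OF fc f]) (rule t)
  have "t ` f ` P = f ` conj_by w ` P" using t by (auto simp: image_image)
  then show "t ` f ` P = f ` P" using cP by simp
  have pw: "(t ^^ n) (f x) = f (conj_by (w [^] n) x)" if x: "x \<in> P" for n x
  proof (induction n)
    case 0
    then show ?case using x subgroup_in_carrier[OF P] by simp
  next
    case (Suc n)
    have "w [^] n \<in> nrm P"
      using nrm_subgroup[OF P] w by (induction n) (auto simp: subgroup.one_closed subgroup.m_closed)
    then have "conj_by (w [^] n) x \<in> P" using x by (rule nrmD)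
    then have "(t ^^ Suc n) (f x) = f (conj_by (w \<otimes> w [^] n) x)"
      using Suc t wc x subgroup_in_carrier[OF P] by (simp add: conj_by_mult)
    also have "w \<otimes> w [^] n = w [^] Suc n" using wc by (metis nat_pow_Suc2)
    finally show ?case .
  qed
  obtain k where "order S = p ^ k" using order_S by blast
  then have "w [^] (p ^ k) = \<one>" using pow_order_eq_1[OF wc] by simp
  then have "\<forall>x\<in>f ` P. (t ^^ (p ^ k)) x = x" using pw subgroup_in_carrier[OF P] by auto
  then show "\<exists>k. \<forall>x\<in>f ` P. (t ^^ (p ^ k)) x = x" by blast
qed

end

locale sat = fus +
  assumes sylow: "sylow_axiom m" and extension: "extension_at m P"
begin

text \<open>Sylow's theorem is applied in \<open>Aut\<^sub>M(Q)\<close>, which contains all \<open>p\<close>-elements of \<open>Aut\<^sub>F(Q)\<close>,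
  so that the correcting automorphism can be taken in \<open>M\<close>.\<close>

lemma extend_to_normalizer:
  assumes M: "fus S p M" "\<And>f. M (\<psi> ` P) f \<Longrightarrow> m (\<psi> ` P) f" "p_auts_in m M (\<psi> ` P)"
    and \<psi>: "m P \<psi>" and Q: "fully_norm m (\<psi> ` P)"
  obtains d \<chi> where "M (\<psi> ` P) d" "d ` \<psi> ` P = \<psi> ` P" "m (nrm P) \<chi>" "\<And>x. x \<in> P \<Longrightarrow> \<chi> x = d (\<psi> x)"
proof -
  interpret M: fus S p M by fact
  let ?Q = "\<psi> ` P"
  note P = mor_subgroup[OF \<psi>] and Qs = mor_image[OF \<psi>]
  have fc: "fully_cent m ?Q" and ind: "\<not> p dvd card (auts m ?Q) div card (conj_auts (nrm ?Q) ?Q)"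
    using sylow Q by (auto simp: sylow_axiom_def)
  let ?B = "conj_auts (nrm ?Q) ?Q"
  have B: "subgroup ?B (BijGroup ?Q)" by (rule conj_auts_subgroup[OF Qs nrm_subgroup[OF Qs] subset_refl])
  have BD: "?B \<subseteq> auts M ?Q" by (rule M.conj_auts_le_auts[OF Qs subset_refl])
  have Dm: "auts M ?Q \<subseteq> auts m ?Q" using M(2) by (auto simp: auts_def)
  have npD: "\<not> p dvd card (auts M ?Q) div card ?B"
    by (rule card_conj_auts_coprime_mono[OF Qs B M.auts_subgroup[OF Qs] auts_subgroup[OF Qs] BD Dm ind])
  have one: "\<one> \<in> nrm ?Q" using nrm_subgroup[OF Qs] by (rule subgroup.one_closed)
  obtain d where d: "d \<in> auts M ?Q"
    "\<And>w. w \<in> nrm P \<Longrightarrow> \<exists>b\<in>?B. \<forall>y\<in>P. d (\<psi> (conj_by w y)) = b (conj_by \<one> (d (\<psi> y)))"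
  proof (rule twisted_sylow_auts[OF Qs M.auts_subgroup[OF Qs] B BD npD nrm_subgroup[OF P] _ P subset_refl,
      of \<psi> "\<lambda>_. \<one>"])
    show "bij_betw \<psi> P ?Q" using mor_inj[OF \<psi>] by (simp add: bij_betw_def)
    show "(\<lambda>_. \<one>) \<in> hom (S\<lparr>carrier := nrm P\<rparr>) S" by (auto simp: hom_def)
    show "(\<lambda>_. \<one>) ` nrm P \<subseteq> nrm ?Q" using one by auto
    show "\<exists>b'\<in>?B. \<forall>y\<in>?Q. conj_by \<one> (b y) = b' (conj_by \<one> y)" if "b \<in> ?B" for b
    proof (intro bexI ballI)
      fix y assume y: "y \<in> ?Q"
      then have "b y \<in> ?Q" using that BD auts_mem by blast
      then show "conj_by \<one> (b y) = b (conj_by \<one> y)" using y subgroup_in_carrier[OF Qs] by simp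
    qed (rule that)
    \<comment> \<open>The transported conjugations have \<open>p\<close>-power order, so they act on the group of automorphisms in \<open>M\<close>.\<close>
    show "\<exists>d'\<in>auts M ?Q. \<forall>y\<in>P. conj_by \<one> (d (\<psi> y)) = d' (\<psi> (conj_by w y))"
      if w: "w \<in> nrm P" and d: "d \<in> auts M ?Q" for w d
    proof -
      have w': "inv w \<in> nrm P" using w nrm_subgroup[OF P] by (simp add: subgroup.m_inv_closed)
      define t where "t = (\<lambda>y. \<psi> (conj_by (inv w) (inv_into P \<psi> y)))"
      have t: "m ?Q t" "t ` ?Q = ?Q" "\<exists>k. \<forall>x\<in>?Q. (t ^^ (p ^ k)) x = x"
        unfolding t_def by (rule conj_transport[OF \<psi> w'])+
      then have "M ?Q t" by (rule p_auts_inD[OF M(3)])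
      then have tA: "restrict t ?Q \<in> auts M ?Q" using t(2) by (rule M.restrict_auts)
      have "conj_by \<one> (d (\<psi> y)) = compose ?Q d (restrict t ?Q) (\<psi> (conj_by w y))" if y: "y \<in> P" for y
      proof -
        have "d (\<psi> y) \<in> ?Q" using auts_mem[OF d imageI[OF y]] .
        moreover have "conj_by w y \<in> P" using nrmD(2)[OF w y] .
        moreover have "t (\<psi> (conj_by w y)) = \<psi> y"
          unfolding t_def using y nrmD(1)[OF w] nrmD(2)[OF w y] subgroup_in_carrier[OF P] by (simp add: mor_inv_into[OF \<psi>])
        ultimately show ?thesis using subgroup_in_carrier[OF Qs] by (simp add: compose_def)
      qed
      then show ?thesis using M.auts_compose[OF d tA] by blast
    qed
  qed blast
  have dM: "M ?Q d" "d ` ?Q = ?Q" using d(1) by (auto simp: auts_def)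
  have d\<psi>: "m P (\<lambda>x. d (\<psi> x))" using mor_comp[OF \<psi>] M(2)[OF dM(1)] by blast
  have im: "(\<lambda>x. d (\<psi> x)) ` P = ?Q" using dM(2) by (simp flip: image_image)
  have "nrm P \<subseteq> Nphi P (\<lambda>x. d (\<psi> x))"
  proof
    fix w assume w: "w \<in> nrm P"
    obtain h where h: "h \<in> nrm ?Q" "\<And>y. y \<in> P \<Longrightarrow> d (\<psi> (conj_by w y)) = restrict (conj_by h) ?Q (conj_by \<one> (d (\<psi> y)))"
      using d(2)[OF w] by (auto simp: conj_auts_def)
    have "d (\<psi> (conj_by w y)) = conj_by h (d (\<psi> y))" if "y \<in> P" for y
    proof -
      have "d (\<psi> y) \<in> ?Q" using that im by blast
      then show ?thesis using h(2)[OF that] subgroup_in_carrier[OF Qs] by simp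
    qed
    then show "w \<in> Nphi P (\<lambda>x. d (\<psi> x))" using w nrmD(1)[OF h(1)] by (auto simp: Nphi_def)
  qed
  moreover obtain \<chi> where \<chi>: "m (Nphi P (\<lambda>x. d (\<psi> x))) \<chi>" "\<And>x. x \<in> P \<Longrightarrow> \<chi> x = d (\<psi> x)"
    using extension[of P] d\<psi> fc im by (auto simp: extension_at_def)
  ultimately have "m (nrm P) \<chi>" using nrm_subgroup[OF P] by (auto intro: mor_restrict)
  then show ?thesis using that dM \<chi>(2) by blast
qed

end

section \<open>Generation by automorphisms of \<open>p\<close>-power order\<close>

lemma funpow_transport:
  assumes "\<And>x. x \<in> P \<Longrightarrow> t (h x) = h (f x)" and "f ` P \<subseteq> P" and "x \<in> P"
  shows "(t ^^ n) (h x) = h ((f ^^ n) x) \<and> (f ^^ n) x \<in> P"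
proof (induction n)
  case (Suc n)
  then show ?case using assms by (auto simp: image_subset_iff)
qed (simp add: assms(3))

lemma BijGroup_pow:
  assumes "f ` P = P" "inj_on f P"
  shows "restrict f P [^]\<^bsub>BijGroup P\<^esub> n = restrict (f ^^ n) P" "restrict (f ^^ n) P \<in> Bij P"
proof -
  have f: "restrict f P \<in> Bij P" using assms by (auto simp: Bij_def bij_betw_def)
  have fP: "f x \<in> P" if "x \<in> P" for x using assms(1) that by blast
  have "restrict f P [^]\<^bsub>BijGroup P\<^esub> n = restrict (f ^^ n) P \<and> restrict (f ^^ n) P \<in> Bij P"
  proof (induction n)
    case 0
    have "restrict (f ^^ 0) P = (\<lambda>x\<in>P. x)" by (simp add: fun_eq_iff)
    then show ?case using id_Bij[of P] by (metis BijGroup_def monoid.select_convs(2) nat_pow_0)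
  next
    case (Suc n)
    have "restrict f P [^]\<^bsub>BijGroup P\<^esub> Suc n = compose P (restrict (f ^^ n) P) (restrict f P)"
      using BijGroup_mult[OF conjunct2[OF Suc] f] conjunct1[OF Suc] by (metis nat_pow_Suc)
    also have "\<dots> = restrict (f ^^ Suc n) P"
      using fP by (auto simp: compose_def fun_eq_iff funpow_swap1)
    finally have pw: "restrict f P [^]\<^bsub>BijGroup P\<^esub> Suc n = restrict (f ^^ Suc n) P" .
    have "restrict (f ^^ Suc n) P = compose P (restrict (f ^^ n) P) (restrict f P)"
      using fP by (auto simp: compose_def fun_eq_iff funpow_swap1)
    then show ?case using compose_Bij[OF conjunct2[OF Suc] f] pw by metis
  qed
  then show "restrict f P [^]\<^bsub>BijGroup P\<^esub> n = restrict (f ^^ n) P" "restrict (f ^^ n) P \<in> Bij P" by auto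
qed

lemma funpow_finite_order:
  assumes "finite P" "f ` P = P"
  obtains r where "r > 0" "\<And>x. x \<in> P \<Longrightarrow> (f ^^ r) x = x"
proof -
  interpret G: group "BijGroup P" by (rule group_BijGroup)
  have inj: "inj_on f P" using assms by (simp add: finite_surj_inj)
  have f: "restrict f P \<in> carrier (BijGroup P)"
    using assms inj by (auto simp: BijGroup_def Bij_def bij_betw_def)
  have "finite (carrier (BijGroup P))" using finite_Bij[OF assms(1)] by (simp add: BijGroup_def)
  then have "order (BijGroup P) > 0" by (simp add: G.order_gt_0_iff_finite)
  moreover have "restrict (f ^^ order (BijGroup P)) P = (\<lambda>x\<in>P. x)"
    using G.pow_order_eq_1[OF f] BijGroup_pow(1)[OF assms(2) inj] by (simp add: BijGroup_def)
  ultimately show ?thesis using that by (metis restrict_apply')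
qed

context p_group
begin

definition fus_gen :: "('a set \<Rightarrow> ('a \<Rightarrow> 'a) \<Rightarrow> bool) \<Rightarrow> 'a set \<Rightarrow> ('a \<Rightarrow> 'a) \<Rightarrow> bool" where
  "fus_gen X P f \<longleftrightarrow> (\<forall>M. fus S p M \<longrightarrow> (\<forall>Q g. X Q g \<longrightarrow> M Q g) \<longrightarrow> M P f)"

lemma fus_gen_least: "fus_gen X P f \<Longrightarrow> fus S p M \<Longrightarrow> (\<And>Q g. X Q g \<Longrightarrow> M Q g) \<Longrightarrow> M P f"
  by (auto simp: fus_gen_def)

lemma fus_genI: "(\<And>M. fus S p M \<Longrightarrow> \<forall>Q g. X Q g \<longrightarrow> M Q g \<Longrightarrow> M P f) \<Longrightarrow> fus_gen X P f"
  by (auto simp: fus_gen_def)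

lemma fus_genD: "fus_gen X P f \<Longrightarrow> fus S p M \<Longrightarrow> \<forall>Q g. X Q g \<longrightarrow> M Q g \<Longrightarrow> M P f"
  by (auto simp: fus_gen_def)

lemma fus_gen_incl: "X P f \<Longrightarrow> fus_gen X P f"
  by (auto simp: fus_gen_def)

lemma fus_gen_fus:
  assumes m: "fus S p m" and X: "\<And>P f. X P f \<Longrightarrow> m P f"
  shows "fus S p (fus_gen X)"
proof -
  interpret fus S p m by fact
  have le: "m P f" if "fus_gen X P f" for P f using fus_gen_least[OF that m] X by blast
  show ?thesis
  proof (rule fus.intro[OF p_group_axioms], rule fus_axioms.intro)
    fix P f g R x y
    show "fus_gen X R (conj_by x)" if "subgroup R S" "x \<in> carrier S"
    proof (rule fus_genI)
      fix M assume M: "fus S p M"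
      show "M R (conj_by x)" using fus.mor_conj[OF M, OF that] .
    qed
    assume f: "fus_gen X P f"
    show "subgroup P S" using mor_subgroup[OF le[OF f]] .
    show "inj_on f P" using mor_inj[OF le[OF f]] .
    show "x \<in> P \<Longrightarrow> f x \<in> carrier S" using mor_closed[OF le[OF f]] .
    show "x \<in> P \<Longrightarrow> y \<in> P \<Longrightarrow> f (x \<otimes> y) = f x \<otimes> f y" using mor_mult[OF le[OF f]] .
    show "fus_gen X P g" if "\<And>x. x \<in> P \<Longrightarrow> f x = g x"
    proof (rule fus_genI)
      fix M assume M: "fus S p M" "\<forall>Q g. X Q g \<longrightarrow> M Q g"
      show "M P g" using fus.mor_cong[OF M(1), OF fus_genD[OF f M] that] .
    qed
    show "fus_gen X R f" if "subgroup R S" "R \<subseteq> P"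
    proof (rule fus_genI)
      fix M assume M: "fus S p M" "\<forall>Q g. X Q g \<longrightarrow> M Q g"
      show "M R f" using fus.mor_restrict[OF M(1), OF fus_genD[OF f M] that] .
    qed
    show "fus_gen X P (g \<circ> f)" if g: "fus_gen X (f ` P) g"
    proof (rule fus_genI)
      fix M assume M: "fus S p M" "\<forall>Q g. X Q g \<longrightarrow> M Q g"
      show "M P (g \<circ> f)" using fus.mor_comp_o[OF M(1), OF fus_genD[OF f M] fus_genD[OF g M]] .
    qed
    show "fus_gen X (f ` P) (inv_into P f)"
    proof (rule fus_genI)
      fix M assume M: "fus S p M" "\<forall>Q g. X Q g \<longrightarrow> M Q g"
      show "M (f ` P) (inv_into P f)" using fus.mor_inv[OF M(1), OF fus_genD[OF f M]] .
    qed
  qed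
qed

definition twist :: "('a \<Rightarrow> 'a) \<Rightarrow> ('a \<Rightarrow> 'a) \<Rightarrow> 'a \<Rightarrow> 'a" where
  "twist \<alpha> f = (\<lambda>x. \<alpha> (f (inv_into (carrier S) \<alpha> x)))"

definition invariant :: "('a \<Rightarrow> 'a) set \<Rightarrow> ('a set \<Rightarrow> ('a \<Rightarrow> 'a) \<Rightarrow> bool) \<Rightarrow> bool" where
  "invariant A M \<longleftrightarrow> (\<forall>\<alpha>\<in>A. \<forall>P f. M P f \<longrightarrow> M (\<alpha> ` P) (twist \<alpha> f))"

text \<open>Subsets of \<open>Aut\<^sub>F(S)\<close> that are subgroups, up to values outside the carrier.\<close>

definition aut_group :: "('a set \<Rightarrow> ('a \<Rightarrow> 'a) \<Rightarrow> bool) \<Rightarrow> ('a \<Rightarrow> 'a) set \<Rightarrow> bool" where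
  "aut_group m A \<longleftrightarrow> A \<subseteq> Collect (m (carrier S)) \<and> (\<lambda>x. x) \<in> A \<and>
     (\<forall>\<alpha>\<in>A. inv_into (carrier S) \<alpha> \<in> A) \<and> (\<forall>\<alpha>\<in>A. \<forall>\<beta>\<in>A. (\<lambda>x. \<beta> (\<alpha> x)) \<in> A)"

text \<open>With \<open>A\<close> the preimage of \<open>H\<close> in \<open>Aut\<^sub>F(S)\<close> and \<open>M\<close> the system \<open>O\<^sup>p\<^sup>'\<^sub>*(F)\<close>, this will be the system \<open>F\<^sub>H\<close>. It
  describes the morphisms between all subgroups, although \<open>F\<^sub>H\<close> is generated by those between
  centric ones.\<close>

definition gen_by :: "('a set \<Rightarrow> ('a \<Rightarrow> 'a) \<Rightarrow> bool) \<Rightarrow> ('a \<Rightarrow> 'a) set \<Rightarrow> 'a set \<Rightarrow> ('a \<Rightarrow> 'a) \<Rightarrow> bool" where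
  "gen_by M A P f \<longleftrightarrow> subgroup P S \<and> (\<exists>\<alpha>\<in>A. \<exists>\<mu>. M (\<alpha> ` P) \<mu> \<and> (\<forall>x\<in>P. f x = \<mu> (\<alpha> x)))"

lemma gen_byI:
  "subgroup P S \<Longrightarrow> \<alpha> \<in> A \<Longrightarrow> M (\<alpha> ` P) \<mu> \<Longrightarrow> (\<And>x. x \<in> P \<Longrightarrow> f x = \<mu> (\<alpha> x)) \<Longrightarrow> gen_by M A P f"
  unfolding gen_by_def by blast

end

context fus
begin

lemma aut_inv:
  assumes \<alpha>: "m (carrier S) \<alpha>" and x: "x \<in> carrier S"
  shows "inv_into (carrier S) \<alpha> (\<alpha> x) = x" "\<alpha> (inv_into (carrier S) \<alpha> x) = x"
    "inv_into (carrier S) \<alpha> x \<in> carrier S"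
    "inv_into (carrier S) (inv_into (carrier S) \<alpha>) x = \<alpha> x"
proof -
  let ?i = "inv_into (carrier S) \<alpha>"
  note im = mor_carrier_image[OF \<alpha>]
  show "?i (\<alpha> x) = x" using mor_inv_into[OF \<alpha> x] .
  show r: "\<alpha> (?i x) = x" using x im by (simp add: f_inv_into_f)
  show c: "?i x \<in> carrier S" using x im by (metis inv_into_into)
  have i: "m (carrier S) ?i" using mor_inv[OF \<alpha>] im by simp
  have "inv_into (carrier S) ?i (?i (\<alpha> x)) = \<alpha> x"
    using mor_inv_into[OF i] mor_closed[OF \<alpha> x] by blast
  then show "inv_into (carrier S) ?i x = \<alpha> x" using mor_inv_into[OF \<alpha> x] by simp
qed

lemma aut_inv_mor: "m (carrier S) \<alpha> \<Longrightarrow> m (carrier S) (inv_into (carrier S) \<alpha>)"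
  using mor_inv[of "carrier S" \<alpha>] mor_carrier_image[of \<alpha>] by simp

lemma aut_inv_image:
  assumes "m (carrier S) \<alpha>" "P \<subseteq> carrier S"
  shows "inv_into (carrier S) \<alpha> ` \<alpha> ` P = P" "\<alpha> ` inv_into (carrier S) \<alpha> ` P = P"
  using aut_inv[OF assms(1)] assms(2) by (auto simp: image_image subset_iff image_iff)

lemma aut_restrict: "m (carrier S) \<alpha> \<Longrightarrow> subgroup P S \<Longrightarrow> m P \<alpha>"
  using mor_restrict subgroup.subset by blast

lemma twist_apply: "m (carrier S) \<alpha> \<Longrightarrow> x \<in> carrier S \<Longrightarrow> twist \<alpha> f (\<alpha> x) = \<alpha> (f x)"
  by (simp add: twist_def aut_inv)

lemma aut_group_full: "aut_group m (Collect (m (carrier S)))"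
  unfolding aut_group_def
  using mor_id[OF subgroup_self] aut_inv_mor mor_comp' mor_carrier_image by auto

lemma mor_twist:
  assumes \<alpha>: "m (carrier S) \<alpha>" and f: "m P f" shows "m (\<alpha> ` P) (twist \<alpha> f)"
proof (rule mor_right_factor[of P "\<lambda>x. \<alpha> (f x)" \<alpha>])
  show "m P \<alpha>" using aut_restrict[OF \<alpha> mor_subgroup[OF f]] .
  show "m P (\<lambda>x. \<alpha> (f x))" by (rule mor_comp'[OF f \<alpha>]) (use mor_closed[OF f] in auto)
  show "twist \<alpha> f (\<alpha> x) = \<alpha> (f x)" if "x \<in> P" for x
    using twist_apply[OF \<alpha>] subgroup_in_carrier[OF mor_subgroup[OF f] that] .
qed

text \<open>The twisted map determines \<open>f\<close> only where \<open>f\<close> takes values in the carrier, since \<open>\<alpha>\<close> is arbitrary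
  outside; hence the separate condition on the image.\<close>

lemma pullback_fus:
  assumes \<alpha>: "m (carrier S) \<alpha>" and M: "fus S p M"
  shows "fus S p (\<lambda>P f. subgroup P S \<and> f ` P \<subseteq> carrier S \<and> M (\<alpha> ` P) (twist \<alpha> f))" (is "fus S p ?M'")
proof -
  interpret M: fus S p M by fact
  note ac = mor_closed[OF \<alpha>] and ai = inj_onD[OF mor_inj[OF \<alpha>]] and am = mor_mult[OF \<alpha>]
  have app: "twist \<alpha> f (\<alpha> x) = \<alpha> (f x)" if "x \<in> carrier S" for f x using twist_apply[OF \<alpha> that] .
  have im: "twist \<alpha> f ` \<alpha> ` P = \<alpha> ` f ` P" if "subgroup P S" for f P
    using app subgroup_in_carrier[OF that] by (auto simp: image_image)
  have sub: "subgroup (\<alpha> ` P) S" if "subgroup P S" for P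
    using mor_image_subgroup[OF \<alpha> that] subgroup.subset[OF that] by simp
  show ?thesis
  proof (rule fus.intro[OF p_group_axioms], rule fus_axioms.intro)
    fix P f g R x y
    show "?M' R (conj_by x)" if R: "subgroup R S" and x: "x \<in> carrier S"
    proof (intro conjI)
      show "subgroup R S" by fact
      show "conj_by x ` R \<subseteq> carrier S" using x subgroup_in_carrier[OF R] by auto
      have "twist \<alpha> (conj_by x) (\<alpha> z) = conj_by (\<alpha> x) (\<alpha> z)" if "z \<in> R" for z
        using app subgroup_in_carrier[OF R that] x mor_conj_by[OF \<alpha>] by simp
      then show "M (\<alpha> ` R) (twist \<alpha> (conj_by x))"
        by (intro M.mor_cong[OF M.mor_conj[OF sub[OF R] ac[OF x]]]) auto
    qed
    assume f: "?M' P f"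
    then have P: "subgroup P S" and fP: "\<And>x. x \<in> P \<Longrightarrow> f x \<in> carrier S" and Mf: "M (\<alpha> ` P) (twist \<alpha> f)" by auto
    note Pc = subgroup_in_carrier[OF P]
    show "subgroup P S" using P .
    show "x \<in> P \<Longrightarrow> f x \<in> carrier S" using fP .
    show "f (x \<otimes> y) = f x \<otimes> f y" if "x \<in> P" "y \<in> P"
    proof (rule ai)
      have "\<alpha> (f (x \<otimes> y)) = twist \<alpha> f (\<alpha> x \<otimes> \<alpha> y)" using app am Pc that by (metis m_closed)
      also have "\<dots> = \<alpha> (f x) \<otimes> \<alpha> (f y)" using M.mor_mult[OF Mf] app Pc that by simp
      finally show "\<alpha> (f (x \<otimes> y)) = \<alpha> (f x \<otimes> f y)" using am fP that by simp
    qed (use that fP P in \<open>auto simp: subgroup.m_closed\<close>)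
    show "inj_on f P"
    proof (rule inj_onI)
      fix x y assume xy: "x \<in> P" "y \<in> P" "f x = f y"
      then have "twist \<alpha> f (\<alpha> x) = twist \<alpha> f (\<alpha> y)" using app Pc by simp
      then have "\<alpha> x = \<alpha> y" using inj_onD[OF M.mor_inj[OF Mf]] xy by blast
      then show "x = y" using ai Pc xy by blast
    qed
    show "?M' P g" if eq: "\<And>x. x \<in> P \<Longrightarrow> f x = g x"
    proof -
      have "twist \<alpha> f (\<alpha> x) = twist \<alpha> g (\<alpha> x)" if "x \<in> P" for x using app Pc that eq by simp
      then have "M (\<alpha> ` P) (twist \<alpha> g)" by (intro M.mor_cong[OF Mf]) auto
      then show ?thesis using P fP eq by auto
    qed
    show "?M' R f" if "subgroup R S" "R \<subseteq> P"
      using that f M.mor_restrict[OF Mf sub[OF that(1)]] by blast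
    show "?M' P (g \<circ> f)" if g: "?M' (f ` P) g"
    proof -
      have "M (\<alpha> ` P) (\<lambda>x. twist \<alpha> g (twist \<alpha> f x))"
        using M.mor_comp[OF Mf] im[OF P] g by simp
      then have "M (\<alpha> ` P) (twist \<alpha> (g \<circ> f))"
        by (rule M.mor_cong) (use app Pc fP in auto)
      then show ?thesis using P g by auto
    qed
    show "?M' (f ` P) (inv_into P f)"
    proof (intro conjI)
      have inj: "inj_on f P" by fact
      have "M (twist \<alpha> f ` \<alpha> ` P) (inv_into (\<alpha> ` P) (twist \<alpha> f))" using M.mor_inv[OF Mf] .
      then have Mi: "M (\<alpha> ` f ` P) (inv_into (\<alpha> ` P) (twist \<alpha> f))" using im[OF P] by simp
      have eq: "inv_into (\<alpha> ` P) (twist \<alpha> f) (\<alpha> (f x)) = twist \<alpha> (inv_into P f) (\<alpha> (f x))" if "x \<in> P" for x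
      proof -
        have "inv_into (\<alpha> ` P) (twist \<alpha> f) (\<alpha> (f x)) = \<alpha> x"
          using M.mor_inv_into[OF Mf, of "\<alpha> x"] app Pc that by simp
        moreover have "twist \<alpha> (inv_into P f) (\<alpha> (f x)) = \<alpha> x"
          using app[OF fP[OF that]] inv_into_f_f[OF inj that] by simp
        ultimately show ?thesis by simp
      qed
      show "M (\<alpha> ` f ` P) (twist \<alpha> (inv_into P f))"
        by (rule M.mor_cong[OF Mi]) (use eq in auto)
      show "inv_into P f ` f ` P \<subseteq> carrier S" using inv_into_image_cancel[OF inj subset_refl] Pc by auto
      have "subgroup (\<alpha> ` f ` P) S" using M.mor_image[OF Mf] im[OF P] by simp
      then have "subgroup (inv_into (carrier S) \<alpha> ` \<alpha> ` f ` P) S"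
        using mor_image_subgroup[OF aut_inv_mor[OF \<alpha>]] subgroup.subset by blast
      moreover have "f ` P \<subseteq> carrier S" using fP by blast
      ultimately show "subgroup (f ` P) S" using aut_inv_image(1)[OF \<alpha>, of "f ` P"] by simp
    qed
  qed
qed

text \<open>The pullback of any system containing \<open>X\<close> again contains \<open>X\<close>, if \<open>X\<close> is invariant.\<close>

lemma fus_gen_invariant:
  assumes A: "A \<subseteq> Collect (m (carrier S))" and X: "\<And>P f. X P f \<Longrightarrow> m P f"
    and inv: "invariant A X"
  shows "invariant A (fus_gen X)"
  unfolding invariant_def
proof (intro ballI allI impI)
  fix \<alpha> P f assume a: "\<alpha> \<in> A" and f: "fus_gen X P f"
  then have \<alpha>: "m (carrier S) \<alpha>" using A by auto
  show "fus_gen X (\<alpha> ` P) (twist \<alpha> f)"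
    unfolding fus_gen_def
  proof (intro allI impI)
    fix M assume M: "fus S p M" and XM: "\<forall>Q g. X Q g \<longrightarrow> M Q g"
    have "subgroup P S \<and> f ` P \<subseteq> carrier S \<and> M (\<alpha> ` P) (twist \<alpha> f)"
    proof (rule fus_gen_least[OF f pullback_fus[OF \<alpha> M]])
      fix Q g assume g: "X Q g"
      then show "subgroup Q S \<and> g ` Q \<subseteq> carrier S \<and> M (\<alpha> ` Q) (twist \<alpha> g)"
        using mor_subgroup[OF X[OF g]] mor_closed[OF X[OF g]] inv a XM by (auto simp: invariant_def)
    qed
    then show "M (\<alpha> ` P) (twist \<alpha> f)" by blast
  qed
qed

text \<open>The factors \<open>\<alpha>\<close> can be moved to the right past the morphisms of an invariant system, so the
  composites \<open>\<mu> \<circ> \<alpha>\<close> are closed under composition and inverses.\<close>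

lemma gen_by_fus:
  assumes M: "fus S p M" and Mm: "\<And>P f. M P f \<Longrightarrow> m P f" and A: "aut_group m A" and inv: "invariant A M"
  shows "fus S p (gen_by M A)"
proof -
  interpret M: fus S p M by fact
  let ?i = "\<lambda>\<alpha>. inv_into (carrier S) \<alpha>"
  have Am: "m (carrier S) \<alpha>" if "\<alpha> \<in> A" for \<alpha> using A that by (auto simp: aut_group_def)
  have sub: "subgroup (\<alpha> ` P) S" if "\<alpha> \<in> A" "subgroup P S" for \<alpha> P
    using mor_image_subgroup[OF Am[OF that(1)] that(2)] subgroup.subset[OF that(2)] by simp
  show ?thesis
  proof (rule fus.intro[OF p_group_axioms], rule fus_axioms.intro)
    fix P f g R x y
    show "gen_by M A R (conj_by x)" if "subgroup R S" "x \<in> carrier S"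
      using that M.mor_conj[OF that] A by (intro gen_byI[of _ "\<lambda>x. x" _ _ "conj_by x"]) (auto simp: aut_group_def)
    assume f: "gen_by M A P f"
    show P: "subgroup P S" using f by (simp add: gen_by_def)
    obtain \<alpha> \<mu> where a: "\<alpha> \<in> A" and mu: "M (\<alpha> ` P) \<mu>" and fx: "\<forall>x\<in>P. f x = \<mu> (\<alpha> x)"
      using f unfolding gen_by_def by blast
    have \<alpha>: "m P \<alpha>" using aut_restrict[OF Am[OF a] P] .
    have mf: "m P f" by (rule mor_cong[OF mor_comp[OF \<alpha> Mm[OF mu]]]) (simp add: fx)
    show "x \<in> P \<Longrightarrow> f x \<in> carrier S" using mor_closed[OF mf] .
    show "x \<in> P \<Longrightarrow> y \<in> P \<Longrightarrow> f (x \<otimes> y) = f x \<otimes> f y" using mor_mult[OF mf] .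
    show "inj_on f P" using mor_inj[OF mf] .
    show "gen_by M A P g" if "\<And>x. x \<in> P \<Longrightarrow> f x = g x"
      using gen_byI[OF P a] mu fx that by metis
    show "gen_by M A R f" if R: "subgroup R S" "R \<subseteq> P"
      using gen_byI[OF R(1) a] M.mor_restrict[OF mu sub[OF a R(1)]] R(2) fx by (metis image_mono subsetD)
    have fP: "f ` P = \<mu> ` \<alpha> ` P" using fx by (auto simp: image_image)
    show "gen_by M A P (g \<circ> f)" if g: "gen_by M A (f ` P) g"
    proof -
      obtain \<beta> \<nu> where b: "\<beta> \<in> A" and nu: "M (\<beta> ` f ` P) \<nu>" and gx: "\<forall>x\<in>f ` P. g x = \<nu> (\<beta> x)"
        using g unfolding gen_by_def by blast
      note \<beta> = Am[OF b]
      have c: "M (\<beta> ` \<alpha> ` P) (twist \<beta> \<mu>)" using inv b mu by (auto simp: invariant_def)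
      have app: "twist \<beta> \<mu> (\<beta> (\<alpha> x)) = \<beta> (\<mu> (\<alpha> x))" if "x \<in> P" for x
        using twist_apply[OF \<beta>] mor_closed[OF \<alpha> that] by simp
      have "twist \<beta> \<mu> ` \<beta> ` \<alpha> ` P = \<beta> ` f ` P" unfolding fP using app by (auto simp: image_image)
      then have d: "M (\<beta> ` \<alpha> ` P) (\<lambda>x. \<nu> (twist \<beta> \<mu> x))" using M.mor_comp[OF c] nu by simp
      show ?thesis
      proof (rule gen_byI[OF P])
        show "(\<lambda>x. \<beta> (\<alpha> x)) \<in> A" using A a b by (auto simp: aut_group_def)
        show "M ((\<lambda>x. \<beta> (\<alpha> x)) ` P) (\<lambda>x. \<nu> (twist \<beta> \<mu> x))" using d by (simp add: image_image)
        show "(g \<circ> f) x = \<nu> (twist \<beta> \<mu> (\<beta> (\<alpha> x)))" if "x \<in> P" for x using that gx app fx by simp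
      qed
    qed
    show "gen_by M A (f ` P) (inv_into P f)"
    proof (rule gen_byI)
      let ?a = "?i \<alpha>"
      have ai: "?a \<in> A" using A a by (auto simp: aut_group_def)
      show "?a \<in> A" by fact
      show "subgroup (f ` P) S" using mor_image[OF mf] .
      have "M (\<mu> ` \<alpha> ` P) (inv_into (\<alpha> ` P) \<mu>)" using M.mor_inv[OF mu] .
      then show "M (?a ` f ` P) (twist ?a (inv_into (\<alpha> ` P) \<mu>))" using inv ai fP by (auto simp: invariant_def)
      fix y assume "y \<in> f ` P"
      then obtain x where x: "x \<in> P" "y = f x" by blast
      have "twist ?a (inv_into (\<alpha> ` P) \<mu>) (?a y) = ?a (inv_into (\<alpha> ` P) \<mu> y)"
        using twist_apply[OF Am[OF ai]] mor_closed[OF mf x(1)] x(2) by simp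
      also have "\<dots> = ?a (\<alpha> x)" using x fx M.mor_inv_into[OF mu] by simp
      also have "\<dots> = x" using aut_inv(1)[OF Am[OF a]] subgroup_in_carrier[OF P x(1)] by simp
      finally show "inv_into P f y = twist ?a (inv_into (\<alpha> ` P) \<mu>) (?a y)"
        using x mor_inv_into[OF mf] by simp
    qed
  qed
qed

definition p_aut :: "'a set \<Rightarrow> ('a \<Rightarrow> 'a) \<Rightarrow> bool" where
  "p_aut P f \<longleftrightarrow> m P f \<and> f ` P = P \<and> (\<exists>k. \<forall>x\<in>P. (f ^^ (p ^ k)) x = x)"

text \<open>\<open>O_rel\<close> is \<open>O\<^sup>p\<^sup>'\<^sub>*(F)\<close>, and \<open>Oc_rel\<close> is generated by its morphisms from centric subgroups.\<close>

definition O_rel :: "'a set \<Rightarrow> ('a \<Rightarrow> 'a) \<Rightarrow> bool" where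
  "O_rel = fus_gen p_aut"

definition Oc_rel :: "'a set \<Rightarrow> ('a \<Rightarrow> 'a) \<Rightarrow> bool" where
  "Oc_rel = fus_gen (\<lambda>P f. O_rel P f \<and> cntr m P)"

lemma O_rel_fus: "fus S p O_rel"
  unfolding O_rel_def by (rule fus_gen_fus[OF fus_axioms]) (simp add: p_aut_def)

lemma O_rel_le: "O_rel P f \<Longrightarrow> m P f"
  unfolding O_rel_def by (erule fus_gen_least[OF _ fus_axioms]) (simp add: p_aut_def)

lemma p_aut_O_rel: "p_aut P f \<Longrightarrow> O_rel P f"
  unfolding O_rel_def by (rule fus_gen_incl)

lemma Oc_rel_fus: "fus S p Oc_rel"
  unfolding Oc_rel_def by (rule fus_gen_fus[OF O_rel_fus]) simp

lemma Oc_rel_le: "Oc_rel P f \<Longrightarrow> O_rel P f"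
  unfolding Oc_rel_def by (erule fus_gen_least[OF _ O_rel_fus]) simp

lemma O_rel_invariant: "invariant (Collect (m (carrier S))) O_rel"
  unfolding O_rel_def
proof (rule fus_gen_invariant[OF subset_refl])
  show "m P f" if "p_aut P f" for P f using that by (simp add: p_aut_def)
  show "invariant (Collect (m (carrier S))) p_aut"
    unfolding invariant_def
  proof (intro ballI allI impI)
    fix \<alpha> P f assume "\<alpha> \<in> Collect (m (carrier S))" "p_aut P f"
    then obtain k where \<alpha>: "m (carrier S) \<alpha>" and f: "m P f" "f ` P = P" and k: "\<And>x. x \<in> P \<Longrightarrow> (f ^^ (p ^ k)) x = x"
      by (auto simp: p_aut_def)
    have app: "twist \<alpha> f (\<alpha> x) = \<alpha> (f x)" if "x \<in> P" for x
      using twist_apply[OF \<alpha> subgroup_in_carrier[OF mor_subgroup[OF f(1)] that]] .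
    have "twist \<alpha> f ` \<alpha> ` P = \<alpha> ` f ` P" using app by (auto simp: image_image)
    moreover have "(twist \<alpha> f ^^ (p ^ k)) (\<alpha> x) = \<alpha> x" if "x \<in> P" for x
      using funpow_transport[of P "twist \<alpha> f" \<alpha> f x "p ^ k", OF app] f(2) that k by simp
    ultimately show "p_aut (\<alpha> ` P) (twist \<alpha> f)"
      using mor_twist[OF \<alpha> f(1)] f(2) by (auto simp: p_aut_def)
  qed
qed

lemma Oc_rel_invariant: "invariant (Collect (m (carrier S))) Oc_rel"
  unfolding Oc_rel_def
proof (rule fus_gen_invariant[OF subset_refl])
  show "m P f" if "O_rel P f \<and> cntr m P" for P f using that O_rel_le by blast
  show "invariant (Collect (m (carrier S))) (\<lambda>P f. O_rel P f \<and> cntr m P)"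
    using O_rel_invariant cntr_image aut_restrict unfolding invariant_def
    by (metis cntr_def mem_Collect_eq)
qed

end

context sat
begin

text \<open>Induction on the index of \<open>P\<close>. An isomorphism onto a fully normalized subgroup becomes,
  after correction by an element of \<open>M\<close>, the restriction of a morphism defined on the larger
  group \<open>N\<^sub>S(P)\<close>; and any morphism from \<open>P\<close> is a quotient of two such isomorphisms.\<close>

theorem generation:
  assumes M: "fus S p M" and Mm: "\<And>P f. M P f \<Longrightarrow> m P f"
    and pM: "\<And>Q. fully_norm m Q \<Longrightarrow> p_auts_in m M Q"
    and inv: "invariant (Collect (m (carrier S))) M"
    and f: "m P f"
  shows "gen_by M (Collect (m (carrier S))) P f"
proof -
  let ?A = "Collect (m (carrier S))"
  interpret M: fus S p M by fact
  interpret E: fus S p "gen_by M ?A" by (rule gen_by_fus[OF M Mm aut_group_full inv])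
  have ME: "gen_by M ?A P f" if "M P f" for P f
    using that aut_group_full M.mor_subgroup[OF that]
    by (intro gen_byI[of _ "\<lambda>x. x" _ _ f]) (auto simp: aut_group_def)
  show ?thesis using f
  proof (induction "card (carrier S) - card P" arbitrary: P f rule: less_induct)
    case less
    show ?case
    proof (cases "P = carrier S")
      case True
      have "f ` carrier S = carrier S" using mor_carrier_image less.prems True by blast
      then show ?thesis
        using less.prems True M.mor_id[OF subgroup_self] subgroup_self
        by (intro gen_byI[of _ f _ _ "\<lambda>x. x"]) auto
    next
      case False
      have onto_fully_norm: "gen_by M ?A R \<psi>"
        if R: "card R = card P" and \<psi>: "m R \<psi>" and Q: "fully_norm m (\<psi> ` R)" for R \<psi>
      proof -
        note Rs = mor_subgroup[OF \<psi>]
        have "P \<subset> carrier S" using False subgroup.subset[OF mor_subgroup[OF less.prems]] by blast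
        then have "card R < card (carrier S)" using R finite_S by (simp add: psubset_card_mono)
        then have "R \<subset> carrier S" using subgroup.subset[OF Rs] by auto
        then have "R \<subset> nrm R" using nrm_grows[OF subgroup_self Rs] by blast
        moreover have N: "finite (nrm R)" "nrm R \<subseteq> carrier S"
          using finite_subgroup[OF nrm_subgroup[OF Rs]] by (auto simp: nrm_def)
        ultimately have lt: "card R < card (nrm R)" "card (nrm R) \<le> card (carrier S)"
          using finite_S by (auto simp: psubset_card_mono card_mono)
        obtain d \<chi> where d: "M (\<psi> ` R) d" "d ` \<psi> ` R = \<psi> ` R"
          and \<chi>: "m (nrm R) \<chi>" "\<And>x. x \<in> R \<Longrightarrow> \<chi> x = d (\<psi> x)"
          using extend_to_normalizer[OF M Mm pM[OF Q] \<psi> Q] by blast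
        have "gen_by M ?A (nrm R) \<chi>" using less.hyps[OF _ \<chi>(1)] lt R by simp
        then have "gen_by M ?A R \<chi>" using E.mor_restrict Rs subgroup_le_nrm by blast
        then show ?thesis by (rule E.mor_left_factor[OF _ ME[OF d(1)]]) (simp add: \<chi>(2))
      qed
      note fP = mor_image[OF less.prems]
      obtain \<psi> where \<psi>: "m (f ` P) \<psi>" "fully_norm m (\<psi> ` f ` P)"
        using exists_fully_norm[OF fP] by blast
      have k: "gen_by M ?A (f ` P) \<psi>"
        using onto_fully_norm[OF mor_card[OF less.prems] \<psi>] .
      have h: "gen_by M ?A P (\<lambda>x. \<psi> (f x))"
        using onto_fully_norm[OF refl mor_comp[OF less.prems \<psi>(1)]] \<psi>(2) by (simp add: image_image)
      show ?thesis by (rule E.mor_left_factor[OF h k]) simp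
    qed
  qed
qed

text \<open>An isomorphism from \<open>P\<close> to a fully normalized subgroup is \<open>\<mu> \<circ> \<alpha>\<close>. It transports automorphisms
  of \<open>P\<close>, and both \<open>\<mu>\<close>, as a morphism of \<open>M\<close>, and \<open>\<alpha>\<close>, by invariance, allow membership in \<open>M\<close> to be
  carried back.\<close>

lemma p_auts_everywhere:
  assumes M: "fus S p M" and Mm: "\<And>P f. M P f \<Longrightarrow> m P f"
    and pM: "\<And>Q. fully_norm m Q \<Longrightarrow> p_auts_in m M Q"
    and inv: "invariant (Collect (m (carrier S))) M"
  shows "p_auts_in m M P"
  unfolding p_auts_in_def
proof (intro allI impI)
  interpret M: fus S p M by fact
  fix f k assume f: "m P f" "f ` P = P" and k: "\<forall>x\<in>P. (f ^^ (p ^ k)) x = x"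
  note P = mor_subgroup[OF f(1)]
  obtain \<psi> where \<psi>: "m P \<psi>" "fully_norm m (\<psi> ` P)" using exists_fully_norm[OF P] by blast
  obtain \<alpha> \<mu> where \<alpha>: "m (carrier S) \<alpha>" and mu: "M (\<alpha> ` P) \<mu>" and eq: "\<forall>x\<in>P. \<psi> x = \<mu> (\<alpha> x)"
    using generation[OF M Mm pM inv \<psi>(1)] unfolding gen_by_def by blast
  define t where "t = (\<lambda>y. \<psi> (f (inv_into P \<psi> y)))"
  have t: "t (\<psi> x) = \<psi> (f x)" if "x \<in> P" for x using that by (simp add: t_def mor_inv_into[OF \<psi>(1)])
  have "M (\<psi> ` P) t"
  proof (rule p_auts_inD[OF pM[OF \<psi>(2)]])
    show "m (\<psi> ` P) t"
      by (rule mor_right_factor[OF mor_comp'[OF f(1) \<psi>(1)] \<psi>(1)]) (use f(2) t in auto)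
    have "t ` \<psi> ` P = \<psi> ` f ` P" using t by (auto simp: image_image)
    then show "t ` \<psi> ` P = \<psi> ` P" using f(2) by simp
    have "(t ^^ (p ^ k)) (\<psi> x) = \<psi> x" if "x \<in> P" for x
      using funpow_transport[of P t \<psi> f x "p ^ k", OF t] f(2) that k by simp
    then show "\<exists>k. \<forall>y\<in>\<psi> ` P. (t ^^ (p ^ k)) y = y" by blast
  qed
  moreover have "\<psi> ` P = \<mu> ` \<alpha> ` P" using eq by (auto simp: image_image)
  ultimately have tm: "M (\<alpha> ` P) (\<lambda>x. t (\<mu> x))" using M.mor_comp[OF mu] by simp
  have app: "twist \<alpha> f (\<alpha> x) = \<alpha> (f x)" if "x \<in> P" for x
    using twist_apply[OF \<alpha>] subgroup_in_carrier[OF P that] by simp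
  have fP: "f x \<in> P" if "x \<in> P" for x using f(2) that by blast
  have "M (\<alpha> ` P) (twist \<alpha> f)"
    by (rule M.mor_left_factor[OF tm mu]) (use app fP eq t in auto)
  then have "M (inv_into (carrier S) \<alpha> ` \<alpha> ` P) (twist (inv_into (carrier S) \<alpha>) (twist \<alpha> f))"
    using inv aut_inv_mor[OF \<alpha>] by (auto simp: invariant_def)
  then have "M P (twist (inv_into (carrier S) \<alpha>) (twist \<alpha> f))"
    using aut_inv_image(1)[OF \<alpha> subgroup.subset[OF P]] by simp
  then show "M P f"
  proof (rule M.mor_cong)
    fix x assume x: "x \<in> P"
    note c = subgroup_in_carrier[OF P]
    have "twist (inv_into (carrier S) \<alpha>) (twist \<alpha> f) x = inv_into (carrier S) \<alpha> (twist \<alpha> f (\<alpha> x))"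
      using aut_inv(4)[OF \<alpha> c[OF x]] by (simp add: twist_def)
    also have "\<dots> = f x" using app[OF x] aut_inv(1)[OF \<alpha> c[OF fP[OF x]]] by simp
    finally show "twist (inv_into (carrier S) \<alpha>) (twist \<alpha> f) x = f x" .
  qed
qed

lemma p_auts_O_rel: "p_auts_in m O_rel P"
  unfolding p_auts_in_def using p_aut_O_rel by (auto simp: p_aut_def)

lemma Oc_rel_incl: "O_rel P f \<Longrightarrow> cntr m P \<Longrightarrow> Oc_rel P f"
  by (simp add: Oc_rel_def fus_gen_def)

text \<open>An automorphism of \<open>p\<close>-power order of a fully centralized \<open>Q\<close> extends to the centric
  subgroup \<open>Q C\<^sub>S(Q)\<close>. A suitable power of the extension has \<open>p\<close>-power order and still restricts
  to the given automorphism. This puts the automorphism into \<open>Oc_rel\<close>, and for subgroups that are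
  not fully normalized the preceding lemma applies.\<close>

lemma O_rel_centric_generated: "O_rel P f \<Longrightarrow> Oc_rel P f"
proof -
  interpret Oc: fus S p Oc_rel by (rule Oc_rel_fus)
  have fn: "p_auts_in m Oc_rel Q" if Q: "fully_norm m Q" for Q
    unfolding p_auts_in_def
  proof (intro allI impI)
    fix f k assume f: "m Q f" "f ` Q = Q" and k: "\<forall>x\<in>Q. (f ^^ (p ^ k)) x = x"
    note Qs = mor_subgroup[OF f(1)]
    let ?D = "pcen Q"
    have QD: "Q \<subseteq> ?D" using mult_superset(1)[OF Qs cen_subgroup[OF Qs]] .
    have fc: "fully_cent m Q" using sylow Q by (auto simp: sylow_axiom_def)
    then obtain g where g: "m (Nphi Q f) g" "\<And>x. x \<in> Q \<Longrightarrow> g x = f x"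
      using extension[of Q] f by (auto simp: extension_at_def)
    have gD: "m ?D g" using mor_restrict[OF g(1) pcen_subgroup[OF Qs] pcen_le_Nphi[OF f(1)]] .
    have gQ: "g ` Q = Q" using g(2) f(2) by (metis image_cong)
    have gim: "g ` ?D = ?D" using pcen_image[OF gD Qs subset_refl fc] gQ by simp
    obtain r where r: "r > 0" "\<And>x. x \<in> ?D \<Longrightarrow> (g ^^ r) x = x"
      using funpow_finite_order[OF finite_subgroup[OF pcen_subgroup[OF Qs]] gim] by blast
    have p1: "\<not> is_unit p" using prime_p by (metis nat_dvd_1_iff_1 not_prime_1)
    obtain s where s: "r = p ^ multiplicity p r * s" "\<not> p dvd s"
      using multiplicity_decompose'[of r p] r(1) p1 by (metis gr_implies_not0)
    have cop: "coprime s (p ^ k)" using s(2) prime_p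
      by (metis coprime_commute coprime_power_right_iff prime_imp_coprime)
    have "s \<noteq> 0" using s(1) r(1) by (cases s) auto
    then obtain x y where xy: "s * x = p ^ k * y + 1"
      using bezout_nat[of s "p ^ k"] cop by auto
    \<comment> \<open>\<open>N\<close> is 1 modulo \<open>p ^ k\<close>, so that the power \<open>N\<close> does not change \<open>f\<close>, and 0 modulo the part of
      the order of \<open>g\<close> that is prime to \<open>p\<close>.\<close>
    define N where "N = s * x"
    have pw: "m ?D (g ^^ N)" "(g ^^ N) ` ?D = ?D" using mor_funpow[OF gD gim] by auto
    have "((g ^^ N) ^^ (p ^ multiplicity p r)) z = z" if z: "z \<in> ?D" for z
    proof -
      have e: "N * p ^ multiplicity p r = r * x" unfolding N_def by (subst (2) s(1)) simp
      have "((g ^^ r) ^^ x) z = z" using r(2)[OF z] by (induction x) auto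
      then show ?thesis by (simp add: funpow_mult e mult.commute)
    qed
    then have "p_aut ?D (g ^^ N)" using pw by (auto simp: p_aut_def)
    then have "Oc_rel ?D (g ^^ N)" by (rule Oc_rel_incl[OF p_aut_O_rel cntr_pcen[OF Qs fc]])
    then have "Oc_rel Q (g ^^ N)" using Oc.mor_restrict Qs QD by blast
    then show "Oc_rel Q f"
    proof (rule Oc.mor_cong)
      fix z assume z: "z \<in> Q"
      have gf: "(g ^^ n) z = (f ^^ n) z \<and> (f ^^ n) z \<in> Q" for n
        using funpow_transport[of Q g "\<lambda>x. x" f z n] g(2) f(2) z by auto
      have fN: "(f ^^ (p ^ k)) z = z" using k z by blast
      have "(f ^^ (p ^ k * y)) z = z"
      proof (induction y)
        case (Suc y)
        then show ?case using fN by (simp add: funpow_add)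
      qed simp
      then have "(f ^^ N) z = f z" unfolding N_def xy by simp
      then show "(g ^^ N) z = f z" using gf by simp
    qed
  qed
  have all: "p_auts_in m Oc_rel P" for P
  proof (rule p_auts_everywhere[OF Oc_rel_fus])
    show "m P f" if "Oc_rel P f" for P f using O_rel_le[OF Oc_rel_le[OF that]] .
    show "p_auts_in m Oc_rel Q" if "fully_norm m Q" for Q using fn[OF that] .
    show "invariant (Collect (m (carrier S))) Oc_rel" by (rule Oc_rel_invariant)
  qed
  show "O_rel P f \<Longrightarrow> Oc_rel P f"
    unfolding O_rel_def
    by (erule fus_gen_least[OF _ Oc_rel_fus]) (use all in \<open>auto simp: p_auts_in_def p_aut_def\<close>)
qed

end

section \<open>Extending morphisms over centralizers\<close>

context p_group
begin

lemma pcen_le_nrm: "subgroup P S \<Longrightarrow> pcen P \<subseteq> nrm P"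
  by (intro mult_least nrm_subgroup subgroup_le_nrm cen_le_nrm)

definition fixers :: "('a set \<Rightarrow> ('a \<Rightarrow> 'a) \<Rightarrow> bool) \<Rightarrow> 'a set \<Rightarrow> 'a set \<Rightarrow> ('a \<Rightarrow> 'a) set" where
  "fixers m P Q = {f \<in> auts m P. \<forall>x\<in>Q. f x = x}"

end

context fus
begin

lemma fixers_subgroup: assumes P: "subgroup P S" and Q: "Q \<subseteq> P" shows "subgroup (fixers m P Q) (BijGroup P)"
proof (rule subgroup_BijGroupI)
  show "fixers m P Q \<subseteq> Bij P" using auts_Bij by (auto simp: fixers_def)
  show "(\<lambda>x\<in>P. x) \<in> fixers m P Q" using auts_id[OF P] Q by (auto simp: fixers_def)
  fix f assume f: "f \<in> fixers m P Q"
  show "restrict (inv_into P f) P \<in> fixers m P Q"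
    unfolding fixers_def
  proof (intro CollectI conjI ballI)
    show "restrict (inv_into P f) P \<in> auts m P" using f auts_inv by (auto simp: fixers_def)
    fix x assume x: "x \<in> Q"
    then have "inv_into P f (f x) = x" using f Q mor_inv_into[of P f x] by (auto simp: fixers_def auts_def)
    then show "restrict (inv_into P f) P x = x" using x f Q by (auto simp: fixers_def)
  qed
  fix g assume "g \<in> fixers m P Q"
  with f show "compose P f g \<in> fixers m P Q" using auts_compose Q by (auto simp: fixers_def compose_def)
qed

lemma conj_auts_fixers:
  assumes P: "subgroup P S" and Q: "subgroup Q S" "Q \<subseteq> P"
  shows "conj_auts (nrm P \<inter> cen Q) P = conj_auts (nrm P) P \<inter> fixers m P Q"
proof (intro subset_antisym subsetI)
  fix f assume "f \<in> conj_auts (nrm P \<inter> cen Q) P"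
  then obtain g where g: "g \<in> nrm P" "g \<in> cen Q" "f = restrict (conj_by g) P" by (auto simp: conj_auts_def)
  then have "f \<in> conj_auts (nrm P) P" by (auto simp: conj_auts_def)
  moreover have "\<forall>x\<in>Q. f x = x" using g Q by (auto simp: cen_iff)
  ultimately show "f \<in> conj_auts (nrm P) P \<inter> fixers m P Q"
    using conj_auts_le_auts[OF P subset_refl] by (auto simp: fixers_def)
next
  fix f assume "f \<in> conj_auts (nrm P) P \<inter> fixers m P Q"
  then obtain g where g: "g \<in> nrm P" "f = restrict (conj_by g) P" "\<forall>x\<in>Q. f x = x"
    by (auto simp: conj_auts_def fixers_def)
  have "\<forall>x\<in>Q. conj_by g x = x" using g(2,3) Q(2) by (metis restrict_apply' subsetD)
  then have "g \<in> cen Q" using cen_iff[OF Q(1)] nrmD(1)[OF g(1)] by simp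
  then show "f \<in> conj_auts (nrm P \<inter> cen Q) P" using g by (auto simp: conj_auts_def)
qed

text \<open>An isomorphism from \<open>R\<close> to a fully normalized \<open>T\<close> is composed with an automorphism of \<open>T\<close>, chosen
  so that the group of automorphisms fixing the image of \<open>Q\<close> elementwise is in good position with
  respect to the Sylow subgroup \<open>Aut\<^sub>S(T)\<close>: it then meets \<open>Aut\<^sub>S(T)\<close> in index prime to \<open>p\<close>, and the
  intersection is induced by elements that centralize the image of \<open>Q\<close>.\<close>

lemma sylow_in_fixers:
  assumes syl: "sylow_axiom m" and R: "subgroup R S" and Q: "subgroup Q S" "Q \<subseteq> R"
  obtains \<tau> where "m R \<tau>" "fully_norm m (\<tau> ` R)"
    "\<not> p dvd card (fixers m (\<tau> ` R) (\<tau> ` Q)) div card (conj_auts (nrm (\<tau> ` R) \<inter> cen (\<tau> ` Q)) (\<tau> ` R))"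
proof -
  obtain \<psi> where \<psi>: "m R \<psi>" "fully_norm m (\<psi> ` R)" using exists_fully_norm[OF R] by blast
  define T where "T = \<psi> ` R"
  define Q' where "Q' = \<psi> ` Q"
  have T: "subgroup T S" unfolding T_def using mor_image[OF \<psi>(1)] .
  have Q's: "subgroup Q' S" "Q' \<subseteq> T" unfolding T_def Q'_def using mor_image_subgroup[OF \<psi>(1) Q] Q(2) by auto
  let ?H = "BijGroup T" and ?B = "conj_auts (nrm T) T" and ?D = "fixers m T Q'"
  let ?G = "?H\<lparr>carrier := auts m T\<rparr>"
  interpret H: group ?H by (rule group_BijGroup)
  have aG: "subgroup (auts m T) ?H" by (rule auts_subgroup[OF T])
  interpret G: group ?G using H.subgroup_imp_group[OF aG] .
  have B: "subgroup ?B ?G"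
    using H.subgroup_incl[OF conj_auts_subgroup[OF T nrm_subgroup[OF T] subset_refl] aG conj_auts_le_auts[OF T subset_refl]] .
  have DA: "?D \<subseteq> auts m T" by (auto simp: fixers_def)
  have D: "subgroup ?D ?G" using H.subgroup_incl[OF fixers_subgroup[OF T Q's(2)] aG DA] .
  have finA: "finite (auts m T)"
    using finite_Bij[OF finite_subgroup[OF T]] auts_Bij finite_subset by blast
  have "\<not> p dvd card (auts m T) div card ?B" using syl \<psi>(2) by (simp add: sylow_axiom_def T_def)
  then obtain g where g: "g \<in> auts m T"
    and np: "\<not> p dvd card ?D div card {d \<in> ?D. g \<otimes>\<^bsub>?G\<^esub> d \<otimes>\<^bsub>?G\<^esub> inv\<^bsub>?G\<^esub> g \<in> ?B}"
    using G.conjugate_meets_in_coprime_index[OF _ B _ D] finA by auto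
  \<comment> \<open>Conjugation by \<open>g\<close> carries the fixers of \<open>Q'\<close> to those of the image of \<open>Q'\<close> under \<open>g\<close>, so that
    \<open>g \<circ> \<psi>\<close> has the required property.\<close>
  define c where "c d = g \<otimes>\<^bsub>?G\<^esub> d \<otimes>\<^bsub>?G\<^esub> inv\<^bsub>?G\<^esub> g" for d
  have gm: "m T g" "g ` T = T" using g by (auto simp: auts_def)
  have cA: "c d \<in> auts m T" if "d \<in> auts m T" for d
    unfolding c_def using G.m_closed[OF G.m_closed[of g d] G.inv_closed[of g]] g that by simp
  have cg: "c d (g x) = g (d x)" if d: "d \<in> auts m T" and x: "x \<in> T" for d x
  proof -
    have "g \<in> carrier ?G" "d \<in> carrier ?G" using g d by auto
    then have "c d \<otimes>\<^bsub>?G\<^esub> g = g \<otimes>\<^bsub>?G\<^esub> d"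
      unfolding c_def by (metis G.inv_closed G.l_inv G.m_assoc G.m_closed G.r_one)
    moreover have "c d \<in> Bij T" "g \<in> Bij T" "d \<in> Bij T" using cA[OF d] g d auts_Bij by blast+
    ultimately have "compose T (c d) g = compose T g d" by (simp add: BijGroup_mult)
    then show ?thesis using x by (metis compose_eq)
  qed
  have fix_iff: "c d \<in> fixers m T (g ` Q') \<longleftrightarrow> d \<in> ?D" if d: "d \<in> auts m T" for d
  proof -
    have "c d (g x) = g x \<longleftrightarrow> d x = x" if x: "x \<in> Q'" for x
      using cg[OF d] x Q's(2) auts_mem[OF d] inj_onD[OF mor_inj[OF gm(1)]] by (metis subsetD)
    then show ?thesis using cA[OF d] d by (auto simp: fixers_def)
  qed
  have inj: "inj_on c (auts m T)"
  proof (rule inj_onI)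
    fix d e assume d: "d \<in> auts m T" and e: "e \<in> auts m T" and eq: "c d = c e"
    show "d = e"
    proof (rule extensionalityI[of _ T])
      show "d \<in> extensional T" "e \<in> extensional T" using d e by (auto simp: auts_def)
      fix x assume x: "x \<in> T"
      have "g (d x) = g (e x)" using cg[OF d x] cg[OF e x] eq by simp
      then show "d x = e x" using inj_onD[OF mor_inj[OF gm(1)]] auts_mem[OF d x] auts_mem[OF e x] by blast
    qed
  qed
  have surj: "\<exists>d\<in>auts m T. f = c d" if f: "f \<in> auts m T" for f
  proof -
    have "c ` auts m T = auts m T" using cA inj finA by (intro endo_inj_surj) auto
    then show ?thesis using f by blast
  qed
  have im1: "c ` ?D = fixers m T (g ` Q')"
  proof (intro subset_antisym subsetI)
    show "f \<in> fixers m T (g ` Q')" if "f \<in> c ` ?D" for f using that fix_iff DA by auto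
    fix f assume f: "f \<in> fixers m T (g ` Q')"
    then obtain d where "d \<in> auts m T" "f = c d" using surj[of f] by (auto simp: fixers_def)
    then show "f \<in> c ` ?D" using f fix_iff by blast
  qed
  have gQ: "subgroup (g ` Q') S" "g ` Q' \<subseteq> T" using mor_image_subgroup[OF gm(1) Q's] Q's(2) gm(2) by auto
  have im2: "c ` {d \<in> ?D. c d \<in> ?B} = conj_auts (nrm T \<inter> cen (g ` Q')) T"
    unfolding conj_auts_fixers[OF T gQ] im1[symmetric] by blast
  have "card (fixers m T (g ` Q')) = card ?D"
    unfolding im1[symmetric] using inj DA by (meson card_image inj_on_subset)
  moreover have "card (conj_auts (nrm T \<inter> cen (g ` Q')) T) = card {d \<in> ?D. c d \<in> ?B}"
    unfolding im2[symmetric] using inj DA by (intro card_image) (auto intro: inj_on_subset)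
  ultimately have np': "\<not> p dvd card (fixers m T (g ` Q')) div card (conj_auts (nrm T \<inter> cen (g ` Q')) T)"
    using np by (simp add: c_def)
  have i: "(\<lambda>x. g (\<psi> x)) ` R = T" "(\<lambda>x. g (\<psi> x)) ` Q = g ` Q'"
    using gm(2) by (auto simp: T_def Q'_def simp flip: image_image)
  show ?thesis
  proof (rule that[of "\<lambda>x. g (\<psi> x)"])
    show "m R (\<lambda>x. g (\<psi> x))" using mor_comp[OF \<psi>(1)] gm(1) by (simp add: T_def)
    show "fully_norm m ((\<lambda>x. g (\<psi> x)) ` R)" using \<psi>(2) i by (simp add: T_def)
    show "\<not> p dvd card (fixers m ((\<lambda>x. g (\<psi> x)) ` R) ((\<lambda>x. g (\<psi> x)) ` Q)) div
        card (conj_auts (nrm ((\<lambda>x. g (\<psi> x)) ` R) \<inter> cen ((\<lambda>x. g (\<psi> x)) ` Q)) ((\<lambda>x. g (\<psi> x)) ` R))"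
      using np' unfolding i .
  qed
qed

text \<open>In that situation the elements of \<open>N\<^sub>S(R) \<inter> C\<^sub>S(Q)\<close> induce automorphisms that \<open>\<tau>\<close> sends to
  fixers of the image of \<open>Q\<close>. Sylow's theorem among these gives a correction of \<open>\<tau>\<close>, invisible on
  \<open>Q\<close>, after which \<open>\<tau>\<close> extends beyond \<open>R\<close>.\<close>

lemma enlarge_within_centralizer:
  assumes ext: "extension_at m R" and \<tau>: "m R \<tau>" and T: "fully_cent m (\<tau> ` R)"
    and np: "\<not> p dvd card (fixers m (\<tau> ` R) (\<tau> ` Q)) div card (conj_auts (nrm (\<tau> ` R) \<inter> cen (\<tau> ` Q)) (\<tau> ` R))"
    and Q: "subgroup Q S" "Q \<subseteq> R" and RQ: "R \<subseteq> nrm Q" and notsub: "\<not> cen Q \<subseteq> R"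
  obtains R' g where "subgroup R' S" "R \<subset> R'" "R' \<subseteq> nrm Q" "m R' g" "\<And>x. x \<in> Q \<Longrightarrow> g x = \<tau> x"
proof -
  note R = mor_subgroup[OF \<tau>] and Ts = mor_image[OF \<tau>]
  let ?T = "\<tau> ` R" and ?Q' = "\<tau> ` Q"
  let ?D = "fixers m ?T ?Q'" and ?B = "conj_auts (nrm ?T \<inter> cen ?Q') ?T" and ?N = "nrm R \<inter> cen Q"
  have Q's: "subgroup ?Q' S" "?Q' \<subseteq> ?T" using mor_image_subgroup[OF \<tau> Q] Q(2) by auto
  note D = fixers_subgroup[OF Ts Q's(2)]
  have B: "subgroup ?B (BijGroup ?T)"
    by (rule conj_auts_subgroup[OF Ts]) (auto intro: subgroups_Inter_pair nrm_subgroup Ts cen_subgroup Q's)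
  have BD: "?B \<subseteq> ?D" using conj_auts_fixers[OF Ts Q's] by blast
  have N: "subgroup ?N S" by (intro subgroups_Inter_pair nrm_subgroup R cen_subgroup Q)
  have one: "\<one> \<in> nrm ?T" using nrm_subgroup[OF Ts] by (rule subgroup.one_closed)
  obtain d where d: "d \<in> ?D"
    "\<And>w. w \<in> ?N \<Longrightarrow> \<exists>b\<in>?B. \<forall>y\<in>R. d (\<tau> (conj_by w y)) = b (conj_by \<one> (d (\<tau> y)))"
  proof (rule twisted_sylow_auts[OF Ts D B BD np N _ R, of \<tau> "\<lambda>_. \<one>"])
    show "bij_betw \<tau> R ?T" using mor_inj[OF \<tau>] by (simp add: bij_betw_def)
    show "?N \<subseteq> nrm R" by blast
    show "(\<lambda>_. \<one>) \<in> hom (S\<lparr>carrier := ?N\<rparr>) S" by (auto simp: hom_def)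
    show "(\<lambda>_. \<one>) ` ?N \<subseteq> nrm ?T" using one by auto
    show "\<exists>b'\<in>?B. \<forall>y\<in>?T. conj_by \<one> (b y) = b' (conj_by \<one> y)" if b: "b \<in> ?B" for b
    proof (intro bexI[OF _ b] ballI)
      fix y assume y: "y \<in> ?T"
      have "b \<in> auts m ?T" using b BD by (auto simp: fixers_def)
      then have "b y \<in> ?T" using y auts_mem by blast
      then show "conj_by \<one> (b y) = b (conj_by \<one> y)" using y subgroup_in_carrier[OF Ts] by simp
    qed
    show "\<exists>d'\<in>?D. \<forall>y\<in>R. conj_by \<one> (d (\<tau> y)) = d' (\<tau> (conj_by w y))"
      if w: "w \<in> ?N" and d: "d \<in> ?D" for w d
    proof -
      have w': "inv w \<in> nrm R" "inv w \<in> cen Q" using subgroup.m_inv_closed[OF N w] by auto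
      define t where "t = (\<lambda>y. \<tau> (conj_by (inv w) (inv_into R \<tau> y)))"
      have t: "m ?T t" "t ` ?T = ?T" unfolding t_def by (rule conj_transport[OF \<tau> w'(1)])+
      have t\<tau>: "t (\<tau> y) = \<tau> (conj_by (inv w) y)" if "y \<in> R" for y
        using that by (simp add: t_def mor_inv_into[OF \<tau>])
      have tA: "restrict t ?T \<in> auts m ?T" using t by (rule restrict_auts)
      have "restrict t ?T (\<tau> y) = \<tau> y" if y: "y \<in> Q" for y
      proof -
        have "conj_by (inv w) y = y" using w'(2) cen_iff[OF Q(1)] y by blast
        moreover have "y \<in> R" using y Q(2) by blast
        ultimately show ?thesis using t\<tau> by simp
      qed
      then have tD: "restrict t ?T \<in> ?D" using tA by (auto simp: fixers_def)
      have "conj_by \<one> (d (\<tau> y)) = compose ?T d (restrict t ?T) (\<tau> (conj_by w y))" if y: "y \<in> R" for y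
      proof -
        have dA: "d \<in> auts m ?T" using d by (simp add: fixers_def)
        have "d (\<tau> y) \<in> ?T" using auts_mem[OF dA imageI[OF y]] .
        moreover have wy: "conj_by w y \<in> R" using w y nrmD(2) by blast
        moreover have "t (\<tau> (conj_by w y)) = \<tau> y"
          using t\<tau>[OF wy] w nrmD(1)[of w R] subgroup_in_carrier[OF R y] by simp
        ultimately show ?thesis using subgroup_in_carrier[OF Ts] by (simp add: compose_def)
      qed
      moreover have "compose ?T d (restrict t ?T) \<in> ?D"
        using subgroup.m_closed[OF D d tD] BijGroup_mult[of d ?T "restrict t ?T"] auts_Bij[of ?T] tA d
        by (auto simp: fixers_def subset_iff)
      ultimately show ?thesis by blast
    qed
  qed blast
  define h where "h = (\<lambda>x. d (\<tau> x))"
  have dA: "m ?T d" "d ` ?T = ?T" using d(1) by (auto simp: fixers_def auts_def)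
  have hm: "m R h" unfolding h_def using mor_comp[OF \<tau> dA(1)] .
  have hR: "h ` R = ?T" using dA(2) by (simp add: h_def flip: image_image)
  have hQ: "h x = \<tau> x" if "x \<in> Q" for x using d(1) that by (auto simp: h_def fixers_def)
  have NN: "?N \<subseteq> Nphi R h"
  proof
    fix w assume w: "w \<in> ?N"
    obtain b where b: "b \<in> ?B" "\<forall>y\<in>R. d (\<tau> (conj_by w y)) = b (conj_by \<one> (d (\<tau> y)))" using d(2)[OF w] by blast
    then obtain k where k: "k \<in> nrm ?T" "b = restrict (conj_by k) ?T" by (auto simp: conj_auts_def)
    have "h (conj_by w y) = conj_by k (h y)" if "y \<in> R" for y
    proof -
      have "h y \<in> ?T" using that hR by blast
      then show ?thesis using b(2) that k(2) subgroup_in_carrier[OF Ts] by (simp add: h_def)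
    qed
    then show "w \<in> Nphi R h" using w nrmD(1)[OF k(1)] by (auto simp: Nphi_def)
  qed
  obtain g where g: "m (Nphi R h) g" "\<And>x. x \<in> R \<Longrightarrow> g x = h x"
    using ext hm T hR by (auto simp: extension_at_def)
  \<comment> \<open>Intersecting with \<open>R C\<^sub>S(Q)\<close> keeps the enlarged group inside \<open>N\<^sub>S(Q)\<close>; it is larger than \<open>R\<close> since
    normalizers grow in \<open>p\<close>-groups.\<close>
  let ?RC = "R <#> cen Q"
  have RC: "subgroup ?RC S"
    using RQ nrm_conj_cen[OF Q(1)] by (intro mult_subgroup_nrm R cen_subgroup Q) auto
  have RCn: "?RC \<subseteq> nrm Q" using RQ cen_le_nrm[OF Q(1)] by (intro mult_least nrm_subgroup Q)
  note ms = mult_superset[OF R cen_subgroup[OF Q(1)]]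
  have "R \<subset> ?RC" using ms notsub by blast
  then obtain x where x: "x \<in> nrm R" "x \<in> ?RC" "x \<notin> R" using nrm_grows[OF RC R] by blast
  obtain r c where rc: "x = r \<otimes> c" "r \<in> R" "c \<in> cen Q" using x(2) by (auto simp: set_mult_def)
  have "c = inv r \<otimes> x"
    using rc subgroup_in_carrier[OF R] subgroup_in_carrier[OF cen_subgroup[OF Q(1)]] by (simp add: inv_cancel)
  moreover have "inv r \<in> nrm R" using rc(2) subgroup_le_nrm[OF R] R by (auto intro: subgroup.m_inv_closed)
  ultimately have "c \<in> ?N" using x(1) rc(3) nrm_subgroup[OF R] by (auto intro: subgroup.m_closed)
  then have xN: "x \<in> Nphi R h"
    using rc NN Nphi_superset(1)[OF hm] Nphi_subgroup[OF hm] by (auto intro: subgroup.m_closed)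
  let ?R' = "Nphi R h \<inter> ?RC"
  have R': "subgroup ?R' S" by (intro subgroups_Inter_pair Nphi_subgroup hm RC)
  show ?thesis
  proof (rule that[OF R'])
    show "R \<subset> ?R'" using x xN ms(1) Nphi_superset(1)[OF hm] by blast
    show "?R' \<subseteq> nrm Q" using RCn by blast
    show "m ?R' g" using mor_restrict[OF g(1) R'] by blast
    show "g x = \<tau> x" if "x \<in> Q" for x using g(2) hQ that Q(2) by auto
  qed
qed

end

text \<open>What can be said about \<open>F\<^sub>H\<close> before the extension axiom is known. The lemmas below assume that
  axiom for subgroups of larger order and extend morphisms from \<open>P\<close> to \<open>P C\<^sub>S(P)\<close>.\<close>

locale presaturated = fus +
  assumes syl: "sylow_axiom m"
    and to_fully_norm: "subgroup P S \<Longrightarrow> \<exists>\<eta>. m (nrm P) \<eta> \<and> fully_norm m (\<eta> ` P)"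
    and centric_generated: "m P f \<Longrightarrow> fus_gen (\<lambda>P f. m P f \<and> cntr m P) P f"
begin

lemma fully_norm_cent: "fully_norm m P \<Longrightarrow> fully_cent m P"
  using syl by (simp add: sylow_axiom_def)

text \<open>By descending induction on the order of \<open>R\<close>; there is nothing to do once \<open>R\<close> contains \<open>C\<^sub>S(Q)\<close>.
  Both \<open>R\<close> and its image under \<open>\<rho>\<close> are moved to one \<open>T\<close>, by \<open>\<tau>\<close> and \<open>\<tau>2\<close>, and these two maps extend to
  larger subgroups without change on \<open>Q\<close> and its image. Followed by a morphism \<open>\<eta>\<close> that makes the
  common image of \<open>Q\<close> fully normalized, the induction hypothesis applies to both, and \<open>\<rho>\<close> is the
  quotient of the two on \<open>Q\<close>.\<close>

lemma extend_from_overgroup: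
  assumes ext: "\<And>R. card R > k \<Longrightarrow> extension_at m R"
  shows "\<lbrakk>card Q = k; subgroup Q S; Q \<subset> R; R \<subseteq> nrm Q; fully_cent m Q; m R \<rho>; fully_cent m (\<rho> ` Q)\<rbrakk>
    \<Longrightarrow> \<exists>\<sigma>. m (pcen Q) \<sigma> \<and> (\<forall>x\<in>Q. \<sigma> x = \<rho> x)"
proof (induction "card (carrier S) - card R" arbitrary: Q R \<rho> rule: less_induct)
  case less
  note Q = less.prems(2,3) and RQ = less.prems(4) and fc = less.prems(5) and \<rho> = less.prems(6) and fc' = less.prems(7)
  note R = mor_subgroup[OF \<rho>]
  have Q': "Q \<subseteq> R" using Q by blast
  show ?case
  proof (cases "cen Q \<subseteq> R")
    case True
    then have "pcen Q \<subseteq> R" using R Q' by (intro mult_least)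
    then have "m (pcen Q) \<rho>" using mor_restrict[OF \<rho> pcen_subgroup[OF Q(1)]] by blast
    then show ?thesis by blast
  next
    case False
    let ?R2 = "\<rho> ` R" and ?Q2 = "\<rho> ` Q"
    note R2 = mor_image[OF \<rho>]
    have Q2: "subgroup ?Q2 S" using mor_image_subgroup[OF \<rho> Q(1) Q'] .
    have Q2R: "?Q2 \<subset> ?R2" using Q(2) mor_inj[OF \<rho>] by (metis image_strict_mono)
    have card2: "card ?Q2 = k" using mor_card[OF mor_restrict[OF \<rho> Q(1) Q']] less.prems(1) by simp
    have R2Q: "?R2 \<subseteq> nrm ?Q2" using mor_nrm[OF \<rho> Q(1) Q'] RQ by blast
    have not2: "\<not> cen ?Q2 \<subseteq> ?R2"
    proof
      assume sub: "cen ?Q2 \<subseteq> ?R2"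
      have "inv_into R \<rho> ` cen ?Q2 = cen (inv_into R \<rho> ` ?Q2)"
        by (rule fully_cent_image_cen[OF mor_inv[OF \<rho>] Q2 _ sub fc']) (use Q' in blast)
      moreover have "inv_into R \<rho> ` ?Q2 = Q" using mor_inv_image[OF \<rho> Q'] .
      moreover have "inv_into R \<rho> ` cen ?Q2 \<subseteq> R" using sub by (metis image_mono mor_inv_image[OF \<rho> subset_refl])
      ultimately show False using False by simp
    qed
    obtain \<tau> where \<tau>: "m R \<tau>" "fully_norm m (\<tau> ` R)"
      and np: "\<not> p dvd card (fixers m (\<tau> ` R) (\<tau> ` Q)) div card (conj_auts (nrm (\<tau> ` R) \<inter> cen (\<tau> ` Q)) (\<tau> ` R))"
      by (rule sylow_in_fixers[OF syl R Q(1) Q'])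
    have kR: "k < card R" using less.prems(1) Q(2) finite_subgroup[OF R] by (metis psubset_card_mono)
    obtain R1 g1 where 1: "subgroup R1 S" "R \<subset> R1" "R1 \<subseteq> nrm Q" "m R1 g1" "\<And>x. x \<in> Q \<Longrightarrow> g1 x = \<tau> x"
      by (rule enlarge_within_centralizer[OF ext[OF kR] \<tau>(1) fully_norm_cent[OF \<tau>(2)] np Q(1) Q' RQ False]) blast
    define \<tau>2 where "\<tau>2 = (\<lambda>y. \<tau> (inv_into R \<rho> y))"
    have \<tau>2\<rho>: "\<tau>2 (\<rho> x) = \<tau> x" if "x \<in> R" for x using that by (simp add: \<tau>2_def mor_inv_into[OF \<rho>])
    have \<tau>2: "m ?R2 \<tau>2" by (rule mor_right_factor[OF \<tau>(1) \<rho>]) (rule \<tau>2\<rho>)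
    have im2: "\<tau>2 ` ?R2 = \<tau> ` R" "\<tau>2 ` ?Q2 = \<tau> ` Q"
      unfolding image_image using \<tau>2\<rho> Q' by (auto intro!: image_cong simp del: image_eqI)
    have kR2: "k < card ?R2" using kR mor_card[OF \<rho>] by simp
    obtain R2' g2 where 2: "subgroup R2' S" "?R2 \<subset> R2'" "R2' \<subseteq> nrm ?Q2" "m R2' g2" "\<And>x. x \<in> ?Q2 \<Longrightarrow> g2 x = \<tau>2 x"
    proof (rule enlarge_within_centralizer[OF ext[OF kR2] \<tau>2 _ _ Q2 _ R2Q not2])
      show "fully_cent m (\<tau>2 ` ?R2)" unfolding im2 using fully_norm_cent[OF \<tau>(2)] .
      show "\<not> p dvd card (fixers m (\<tau>2 ` ?R2) (\<tau>2 ` ?Q2)) div card (conj_auts (nrm (\<tau>2 ` ?R2) \<inter> cen (\<tau>2 ` ?Q2)) (\<tau>2 ` ?R2))"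
        unfolding im2 using np .
      show "?Q2 \<subseteq> ?R2" using Q2R by blast
    qed blast
    let ?Q' = "\<tau> ` Q"
    obtain \<eta> where \<eta>: "m (nrm ?Q') \<eta>" "fully_norm m (\<eta> ` ?Q')"
      using to_fully_norm[OF mor_image_subgroup[OF \<tau>(1) Q(1) Q']] by blast
    have step: "\<exists>\<sigma>. m (pcen P) \<sigma> \<and> (\<forall>x\<in>P. \<sigma> x = \<eta> (g x))"
      if P: "card P = k" "subgroup P S" "P \<subset> U" and U: "U \<subset> V" "card U = card R"
        and V: "subgroup V S" "V \<subseteq> nrm P" and fcP: "fully_cent m P" and g: "m V g" "g ` P = ?Q'" for P U V g
    proof -
      have PV: "P \<subset> V" using P U by blast
      have "g ` V \<subseteq> nrm (g ` P)" using mor_nrm[OF g(1) P(2) psubset_imp_subset[OF PV]] V(2) by blast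
      then have "g ` V \<subseteq> nrm ?Q'" by (simp only: g(2))
      then have mV: "m V (\<lambda>x. \<eta> (g x))" using mor_comp'[OF g(1) \<eta>(1)] by blast
      have im: "(\<lambda>x. \<eta> (g x)) ` P = \<eta> ` ?Q'" using g(2) by (simp flip: image_image)
      have cV: "card U < card V" "card V \<le> card (carrier S)"
        using U(1) finite_subgroup[OF V(1)] subgroup.subset[OF V(1)] finite_S
        by (auto simp: psubset_card_mono card_mono)
      show ?thesis
      proof (rule less.hyps[OF _ P(1,2) PV V(2) fcP mV])
        show "card (carrier S) - card V < card (carrier S) - card R" using cV U(2) by simp
        show "fully_cent m ((\<lambda>x. \<eta> (g x)) ` P)" unfolding im using fully_norm_cent[OF \<eta>(2)] .
      qed
    qed
    have "g1 ` Q = ?Q'" using 1(5) by auto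
    then obtain \<sigma>1 where s1: "m (pcen Q) \<sigma>1" "\<And>x. x \<in> Q \<Longrightarrow> \<sigma>1 x = \<eta> (g1 x)"
      using step[OF less.prems(1) Q 1(2) refl 1(1,3) fc 1(4)] by blast
    have "g2 ` ?Q2 = ?Q'" using 2(5) im2(2) by (metis image_cong)
    then obtain \<sigma>2 where s2: "m (pcen ?Q2) \<sigma>2" "\<And>x. x \<in> ?Q2 \<Longrightarrow> \<sigma>2 x = \<eta> (g2 x)"
      using step[OF card2 Q2 Q2R 2(2) mor_card[OF \<rho>] 2(1,3) fc' 2(4)] by blast
    have eq: "\<sigma>2 (\<rho> x) = \<sigma>1 x" if "x \<in> Q" for x
      using s1(2)[OF that] s2(2)[of "\<rho> x"] 1(5)[OF that] 2(5)[of "\<rho> x"] \<tau>2\<rho>[of x] that Q' by auto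
    have "\<sigma>1 ` pcen Q = pcen (\<sigma>1 ` Q)" using pcen_image[OF s1(1) Q(1) subset_refl fc] .
    moreover have "\<sigma>2 ` pcen ?Q2 = pcen (\<sigma>2 ` ?Q2)" using pcen_image[OF s2(1) Q2 subset_refl fc'] .
    moreover have "\<sigma>2 ` ?Q2 = \<sigma>1 ` Q" using eq by (auto simp: image_image)
    ultimately have im: "\<sigma>1 ` pcen Q = \<sigma>2 ` pcen ?Q2" by simp
    define \<sigma> where "\<sigma> = (\<lambda>x. inv_into (pcen ?Q2) \<sigma>2 (\<sigma>1 x))"
    have "m (pcen Q) \<sigma>" unfolding \<sigma>_def by (rule mor_comp'[OF s1(1) mor_inv[OF s2(1)]]) (simp add: im)
    moreover have "\<sigma> x = \<rho> x" if "x \<in> Q" for x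
      using mor_inv_into[OF s2(1), of "\<rho> x"] eq[OF that] that mult_superset(1)[OF Q2 cen_subgroup[OF Q2]]
      by (auto simp: \<sigma>_def)
    ultimately show ?thesis by blast
  qed
qed

text \<open>A morphism lifts if it extends over the centralizer after both ends have been moved to fully
  centralized positions by morphisms defined on the normalizers. The condition asks this for all
  such moves, since for a composite the move at the middle subgroup can then be chosen freely.\<close>

definition lifts :: "'a set \<Rightarrow> ('a \<Rightarrow> 'a) \<Rightarrow> bool" where
  "lifts P f \<longleftrightarrow> (\<forall>\<eta> \<eta>'. m (nrm P) \<eta> \<longrightarrow> fully_cent m (\<eta> ` P) \<longrightarrow> m (nrm (f ` P)) \<eta>' \<longrightarrow>
     fully_cent m (\<eta>' ` f ` P) \<longrightarrow> (\<exists>\<sigma>. m (pcen (\<eta> ` P)) \<sigma> \<and> (\<forall>x\<in>P. \<sigma> (\<eta> x) = \<eta>' (f x))))"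

text \<open>Morphisms that lift form a fusion system, because any restriction from a strictly larger
  subgroup lifts by the preceding lemma. As it contains the centric part, it contains everything.\<close>

lemma all_lift:
  assumes ext: "\<And>R. card R > k \<Longrightarrow> extension_at m R"
    and f: "m P f" "card P = k" "\<not> cntr m P"
  shows "lifts P f"
proof -
  define X where "X = (\<lambda>P f. m P f \<and> (card P = k \<and> \<not> cntr m P \<longrightarrow> lifts P f))"
  have Xm: "m P f" if "X P f" for P f using that by (simp add: X_def)
  have restrict: "X R f" if Xf: "X P f" and R: "subgroup R S" "R \<subseteq> P" for P f R
  proof (cases "R = P")
    case False
    then have RP: "R \<subset> P" using R by blast
    have f: "m P f" using Xf by (rule Xm)
    note P = mor_subgroup[OF f]
    have "lifts R f" if k: "card R = k"
      unfolding lifts_def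
    proof (intro allI impI)
      fix \<eta> \<eta>' assume \<eta>: "m (nrm R) \<eta>" "fully_cent m (\<eta> ` R)" and \<eta>': "m (nrm (f ` R)) \<eta>'" "fully_cent m (\<eta>' ` f ` R)"
      let ?N = "nrm R \<inter> P"
      have N: "subgroup ?N S" by (intro subgroups_Inter_pair nrm_subgroup R P)
      have RN: "R \<subset> ?N" using nrm_grows[OF P R(1) RP] .
      have mN: "m ?N \<eta>" using mor_restrict[OF \<eta>(1) N] by blast
      have mfN: "m ?N f" using mor_restrict[OF f N] by blast
      have "f ` ?N \<subseteq> nrm (f ` R)" using mor_nrm[OF f R] by blast
      then have h: "m ?N (\<lambda>x. \<eta>' (f x))" using mor_comp'[OF mfN \<eta>'(1)] by blast
      define \<rho> where "\<rho> = (\<lambda>y. \<eta>' (f (inv_into ?N \<eta> y)))"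
      have \<rho>\<eta>: "\<rho> (\<eta> x) = \<eta>' (f x)" if "x \<in> ?N" for x
        using mor_inv_into[OF mN that] by (simp add: \<rho>_def)
      have m\<rho>: "m (\<eta> ` ?N) \<rho>" by (rule mor_right_factor[OF h mN]) (rule \<rho>\<eta>)
      have "\<exists>\<sigma>. m (pcen (\<eta> ` R)) \<sigma> \<and> (\<forall>x\<in>\<eta> ` R. \<sigma> x = \<rho> x)"
      proof (rule extend_from_overgroup[OF ext _ _ _ _ \<eta>(2) m\<rho>])
        show "card (\<eta> ` R) = k" using mor_card[OF mor_restrict[OF mN R(1)]] RN k by auto
        show "subgroup (\<eta> ` R) S" using mor_image_subgroup[OF mN R(1)] RN by blast
        show "\<eta> ` R \<subset> \<eta> ` ?N" using RN mor_inj[OF mN] by (metis image_strict_mono)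
        show "\<eta> ` ?N \<subseteq> nrm (\<eta> ` R)" using mor_nrm[OF mN R(1)] RN by blast
        have "\<rho> ` \<eta> ` R = \<eta>' ` f ` R" using \<rho>\<eta> RN by (force simp: image_image)
        then show "fully_cent m (\<rho> ` \<eta> ` R)" using \<eta>'(2) by simp
      qed
      then show "\<exists>\<sigma>. m (pcen (\<eta> ` R)) \<sigma> \<and> (\<forall>x\<in>R. \<sigma> (\<eta> x) = \<eta>' (f x))"
        using \<rho>\<eta> RN by (metis imageI psubsetE subsetD)
    qed
    then show ?thesis using mor_restrict[OF f R] by (simp add: X_def)
  qed (use Xf in simp)
  have "fus S p X"
  proof (rule fus.intro[OF p_group_axioms], rule fus_axioms.intro)
    fix P f g R x y
    show "X R (conj_by x)" if R: "subgroup R S" and x: "x \<in> carrier S"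
    proof (rule restrict[OF _ R subgroup.subset[OF R]])
      show "X (carrier S) (conj_by x)"
        using mor_conj[OF subgroup_self x] cntr_carrier by (simp add: X_def)
    qed
    assume f: "X P f"
    note mf = Xm[OF f]
    show P: "subgroup P S" using mor_subgroup[OF mf] .
    show "x \<in> P \<Longrightarrow> f x \<in> carrier S" using mor_closed[OF mf] .
    show "x \<in> P \<Longrightarrow> y \<in> P \<Longrightarrow> f (x \<otimes> y) = f x \<otimes> f y" using mor_mult[OF mf] .
    show "inj_on f P" using mor_inj[OF mf] .
    show "X P g" if eq: "\<And>x. x \<in> P \<Longrightarrow> f x = g x"
    proof -
      have "f ` P = g ` P" using eq by auto
      then have "lifts P f = lifts P g" using eq by (simp add: lifts_def)
      then show ?thesis using f mor_cong[OF mf eq] by (simp add: X_def)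
    qed
    show "X R f" if "subgroup R S" "R \<subseteq> P" using restrict[OF f that] .
    show "X P (g \<circ> f)" if g: "X (f ` P) g"
      unfolding X_def
    proof (intro conjI impI)
      note mg = Xm[OF g]
      show "m P (g \<circ> f)" using mor_comp_o[OF mf mg] .
      assume k: "card P = k \<and> \<not> cntr m P"
      then have "\<not> cntr m (f ` P)"
        using cntr_image[OF _ mor_inv[OF mf]] mor_inv_image[OF mf subset_refl] by metis
      then have lf: "lifts P f" and lg: "lifts (f ` P) g"
        using f g k mor_card[OF mf] by (auto simp: X_def)
      show "lifts P (g \<circ> f)"
        unfolding lifts_def
      proof (intro allI impI)
        fix \<eta> \<eta>' assume \<eta>: "m (nrm P) \<eta>" "fully_cent m (\<eta> ` P)"
          and \<eta>': "m (nrm ((g \<circ> f) ` P)) \<eta>'" "fully_cent m (\<eta>' ` (g \<circ> f) ` P)"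
        obtain \<theta> where \<theta>: "m (nrm (f ` P)) \<theta>" "fully_norm m (\<theta> ` f ` P)"
          using to_fully_norm[OF mor_image[OF mf]] by blast
        note \<theta>c = fully_norm_cent[OF \<theta>(2)]
        obtain \<sigma>1 where s1: "m (pcen (\<eta> ` P)) \<sigma>1" "\<And>x. x \<in> P \<Longrightarrow> \<sigma>1 (\<eta> x) = \<theta> (f x)"
          using lf \<eta> \<theta>(1) \<theta>c unfolding lifts_def by blast
        have gf: "(g \<circ> f) ` P = g ` f ` P" by (simp add: image_comp)
        obtain \<sigma>2 where s2: "m (pcen (\<theta> ` f ` P)) \<sigma>2" "\<And>x. x \<in> f ` P \<Longrightarrow> \<sigma>2 (\<theta> x) = \<eta>' (g x)"
          using lg \<eta>' \<theta>(1) \<theta>c unfolding lifts_def gf by blast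
        have \<eta>P: "subgroup (\<eta> ` P) S" using mor_image_subgroup[OF \<eta>(1) P subgroup_le_nrm[OF P]] .
        have "\<sigma>1 ` \<eta> ` P = \<theta> ` f ` P" using s1(2) by (auto simp: image_image)
        then have "\<sigma>1 ` pcen (\<eta> ` P) = pcen (\<theta> ` f ` P)"
          using pcen_image[OF s1(1) \<eta>P subset_refl \<eta>(2)] by simp
        then have "m (pcen (\<eta> ` P)) (\<lambda>x. \<sigma>2 (\<sigma>1 x))" using mor_comp[OF s1(1)] s2(1) by simp
        moreover have "\<forall>x\<in>P. \<sigma>2 (\<sigma>1 (\<eta> x)) = \<eta>' ((g \<circ> f) x)" using s1(2) s2(2) by simp
        ultimately show "\<exists>\<sigma>. m (pcen (\<eta> ` P)) \<sigma> \<and> (\<forall>x\<in>P. \<sigma> (\<eta> x) = \<eta>' ((g \<circ> f) x))" by blast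
      qed
    qed
    show "X (f ` P) (inv_into P f)"
      unfolding X_def
    proof (intro conjI impI)
      show "m (f ` P) (inv_into P f)" using mor_inv[OF mf] .
      assume k: "card (f ` P) = k \<and> \<not> cntr m (f ` P)"
      then have "\<not> cntr m P" using cntr_image[OF _ mf] by blast
      then have lf: "lifts P f" using f k mor_card[OF mf] by (auto simp: X_def)
      show "lifts (f ` P) (inv_into P f)"
        unfolding lifts_def mor_inv_image[OF mf subset_refl]
      proof (intro allI impI)
        fix \<eta> \<eta>' assume \<eta>: "m (nrm (f ` P)) \<eta>" "fully_cent m (\<eta> ` f ` P)"
          and \<eta>': "m (nrm P) \<eta>'" "fully_cent m (\<eta>' ` P)"
        obtain \<sigma> where s: "m (pcen (\<eta>' ` P)) \<sigma>" "\<And>x. x \<in> P \<Longrightarrow> \<sigma> (\<eta>' x) = \<eta> (f x)"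
          using lf \<eta> \<eta>' unfolding lifts_def by blast
        have \<eta>P: "subgroup (\<eta>' ` P) S" using mor_image_subgroup[OF \<eta>'(1) P subgroup_le_nrm[OF P]] .
        have "\<sigma> ` \<eta>' ` P = \<eta> ` f ` P" using s(2) by (auto simp: image_image)
        then have im: "\<sigma> ` pcen (\<eta>' ` P) = pcen (\<eta> ` f ` P)"
          using pcen_image[OF s(1) \<eta>P subset_refl \<eta>'(2)] by simp
        have "\<forall>x\<in>f ` P. inv_into (pcen (\<eta>' ` P)) \<sigma> (\<eta> x) = \<eta>' (inv_into P f x)"
        proof
          fix y assume "y \<in> f ` P"
          then obtain x where x: "x \<in> P" "y = f x" by blast
          have "\<eta>' x \<in> pcen (\<eta>' ` P)" using x(1) mult_superset(1)[OF \<eta>P cen_subgroup[OF \<eta>P]] by blast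
          then show "inv_into (pcen (\<eta>' ` P)) \<sigma> (\<eta> y) = \<eta>' (inv_into P f y)"
            using mor_inv_into[OF s(1)] s(2)[OF x(1)] mor_inv_into[OF mf x(1)] x(2) by metis
        qed
        then show "\<exists>\<sigma>. m (pcen (\<eta> ` f ` P)) \<sigma> \<and> (\<forall>x\<in>f ` P. \<sigma> (\<eta> x) = \<eta>' (inv_into P f x))"
          using mor_inv[OF s(1)] im by auto
      qed
    qed
  qed
  moreover have "\<forall>Q g. m Q g \<and> cntr m Q \<longrightarrow> X Q g" by (simp add: X_def)
  ultimately have "X P f" by (rule fus_genD[OF centric_generated[OF f(1)]])
  then show ?thesis using f by (simp add: X_def)
qed

text \<open>If \<open>P\<close> is centric, \<open>P C\<^sub>S(P)\<close> is \<open>P\<close>. Otherwise the lift is composed with the moves, which are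
  defined on the normalizers and so on \<open>P C\<^sub>S(P)\<close>; the inverse of the second move is available
  because the image of \<open>P\<close> is fully centralized.\<close>

lemma extend_to_centralizer:
  assumes ext: "\<And>R. card R > card P \<Longrightarrow> extension_at m R"
    and f: "m P f" "fully_cent m (f ` P)"
  obtains \<sigma> where "m (pcen P) \<sigma>" "\<And>x. x \<in> P \<Longrightarrow> \<sigma> x = f x"
proof (cases "cntr m P")
  case True
  note P = mor_subgroup[OF f(1)]
  have "cen P \<subseteq> P" using cntrD[OF True mor_id[OF P]] by simp
  then have "pcen P \<subseteq> P" using P by (intro mult_least) auto
  then have "m (pcen P) f" using mor_restrict[OF f(1) pcen_subgroup[OF P]] by blast
  then show ?thesis using that by blast
next
  case False
  note P = mor_subgroup[OF f(1)] and fP = mor_image[OF f(1)]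
  obtain \<eta> where \<eta>: "m (nrm P) \<eta>" "fully_norm m (\<eta> ` P)" using to_fully_norm[OF P] by blast
  obtain \<eta>' where \<eta>': "m (nrm (f ` P)) \<eta>'" "fully_norm m (\<eta>' ` f ` P)" using to_fully_norm[OF fP] by blast
  have "lifts P f" using all_lift[OF ext f(1) refl False] .
  then obtain \<sigma> where s: "m (pcen (\<eta> ` P)) \<sigma>" "\<And>x. x \<in> P \<Longrightarrow> \<sigma> (\<eta> x) = \<eta>' (f x)"
    using \<eta> \<eta>' fully_norm_cent unfolding lifts_def by blast
  have pn: "pcen P \<subseteq> nrm P" "pcen (f ` P) \<subseteq> nrm (f ` P)"
    using pcen_le_nrm P fP by auto
  have \<eta>P: "subgroup (\<eta> ` P) S" using mor_image_subgroup[OF \<eta>(1) P subgroup_le_nrm[OF P]] .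
  have mp: "m (pcen P) \<eta>" "m (pcen (f ` P)) \<eta>'"
    using mor_restrict[OF \<eta>(1) pcen_subgroup[OF P] pn(1)] mor_restrict[OF \<eta>'(1) pcen_subgroup[OF fP] pn(2)] .
  have PR: "P \<subseteq> pcen P" "cen P \<subseteq> pcen P" using mult_superset[OF P cen_subgroup[OF P]] by auto
  have "\<eta> ` pcen P = \<eta> ` P <#> \<eta> ` cen P" using mult_image[OF mp(1) PR] .
  moreover have "\<eta> ` cen P \<subseteq> cen (\<eta> ` P)" using mor_cen_image[OF mp(1) PR] .
  then have "\<eta> ` P <#> \<eta> ` cen P \<subseteq> pcen (\<eta> ` P)" unfolding set_mult_def by blast
  ultimately have sub: "\<eta> ` pcen P \<subseteq> pcen (\<eta> ` P)" by simp
  have h: "m (pcen P) (\<lambda>x. \<sigma> (\<eta> x))" using mor_comp'[OF mp(1) s(1) sub] .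
  have im: "\<sigma> ` pcen (\<eta> ` P) = \<eta>' ` pcen (f ` P)"
  proof -
    have "\<sigma> ` \<eta> ` P = \<eta>' ` f ` P" using s(2) by (auto simp: image_image)
    then show ?thesis
      using pcen_image[OF s(1) \<eta>P subset_refl fully_norm_cent[OF \<eta>(2)]] pcen_image[OF mp(2) fP subset_refl f(2)] by simp
  qed
  show ?thesis
  proof (rule that)
    show "m (pcen P) (\<lambda>x. inv_into (pcen (f ` P)) \<eta>' (\<sigma> (\<eta> x)))"
      by (rule mor_comp'[OF h mor_inv[OF mp(2)]]) (use sub im in blast)
    fix x assume x: "x \<in> P"
    then have "f x \<in> pcen (f ` P)" using mult_superset(1)[OF fP cen_subgroup[OF fP]] by blast
    then show "inv_into (pcen (f ` P)) \<eta>' (\<sigma> (\<eta> x)) = f x" using mor_inv_into[OF mp(2)] s(2)[OF x] by simp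
  qed
qed

end

context p_group
begin

lemma nrm_le_nrm_pcen: assumes Q: "subgroup Q S" shows "nrm Q \<subseteq> nrm (pcen Q)"
proof
  fix g assume g: "g \<in> nrm Q"
  note Qc = subgroup_in_carrier[OF Q] and Cc = subgroup_in_carrier[OF cen_subgroup[OF Q]]
  show "g \<in> nrm (pcen Q)"
  proof (rule nrmI[OF pcen_subgroup[OF Q] nrmD(1)[OF g]])
    fix x assume "x \<in> pcen Q"
    then obtain y c where x: "x = y \<otimes> c" "y \<in> Q" "c \<in> cen Q" by (auto simp: set_mult_def)
    then have "conj_by g x = conj_by g y \<otimes> conj_by g c" using Qc Cc nrmD(1)[OF g] by (simp add: conj_by_hom)
    then show "conj_by g x \<in> pcen Q"
      using nrmD(2)[OF g x(2)] nrm_conj_cen[OF Q g x(3)] by (auto simp: set_mult_def)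
  qed
qed

end

context fus
begin

lemma card_nrm_le: assumes f: "m R f" and P: "subgroup P S" "P \<subseteq> R" "nrm P \<subseteq> R"
  shows "card (nrm P) \<le> card (nrm (f ` P))"
proof (rule card_inj_on_le[of f])
  show "inj_on f (nrm P)" using mor_inj[OF f] P(3) by (rule inj_on_subset)
  show "f ` nrm P \<subseteq> nrm (f ` P)" using mor_nrm[OF f P(1,2)] P(3) by blast
  show "finite (nrm (f ` P))" using finite_subgroup nrm_subgroup mor_image_subgroup[OF f P(1,2)] by blast
qed

lemma card_cen_le: assumes f: "m R f" and P: "subgroup P S" "P \<subseteq> R" "cen P \<subseteq> R"
  shows "card (cen P) \<le> card (cen (f ` P))"
proof (rule card_inj_on_le[of f])
  show "inj_on f (cen P)" using mor_inj[OF f] P(3) by (rule inj_on_subset)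
  show "f ` cen P \<subseteq> cen (f ` P)" using mor_cen_image[OF f P(2,3)] .
  show "finite (cen (f ` P))" using finite_subgroup cen_subgroup mor_image_subgroup[OF f P(1,2)] by blast
qed

lemma aut_card:
  assumes \<alpha>: "m (carrier S) \<alpha>" and P: "subgroup P S"
  shows "card (nrm (\<alpha> ` P)) = card (nrm P)" "card (cen (\<alpha> ` P)) = card (cen P)" "\<alpha> ` cen P = cen (\<alpha> ` P)"
proof -
  note i = aut_inv_mor[OF \<alpha>] and Pc = subgroup.subset[OF P]
  have aP: "subgroup (\<alpha> ` P) S" using mor_image_subgroup[OF \<alpha> P Pc] .
  have sub: "nrm Q \<subseteq> carrier S" "cen Q \<subseteq> carrier S" for Q by (auto simp: nrm_def centralizer_def)
  have "card (nrm (\<alpha> ` P)) \<le> card (nrm (inv_into (carrier S) \<alpha> ` \<alpha> ` P))"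
    by (rule card_nrm_le[OF i aP subgroup.subset[OF aP] sub(1)])
  then show "card (nrm (\<alpha> ` P)) = card (nrm P)"
    using card_nrm_le[OF \<alpha> P Pc sub(1)] aut_inv_image(1)[OF \<alpha> Pc] by simp
  have "card (cen (\<alpha> ` P)) \<le> card (cen (inv_into (carrier S) \<alpha> ` \<alpha> ` P))"
    by (rule card_cen_le[OF i aP subgroup.subset[OF aP] sub(2)])
  then show c: "card (cen (\<alpha> ` P)) = card (cen P)"
    using card_cen_le[OF \<alpha> P Pc sub(2)] aut_inv_image(1)[OF \<alpha> Pc] by simp
  show "\<alpha> ` cen P = cen (\<alpha> ` P)"
  proof (rule card_subset_eq)
    show "finite (cen (\<alpha> ` P))" using finite_subgroup[OF cen_subgroup[OF aP]] .
    show "\<alpha> ` cen P \<subseteq> cen (\<alpha> ` P)" using mor_cen_image[OF \<alpha> Pc sub(2)] .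
    have "card (\<alpha> ` cen P) = card (cen P)" using mor_inj[OF \<alpha>] sub(2) by (meson card_image inj_on_subset)
    then show "card (\<alpha> ` cen P) = card (cen (\<alpha> ` P))" using c by simp
  qed
qed

lemma transport_auts:
  assumes \<tau>: "m P \<tau>" and Q: "Q \<subseteq> P" and C: "C \<subseteq> P"
  shows "card (fixers m P Q) \<le> card (fixers m (\<tau> ` P) (\<tau> ` Q))"
    "card (conj_auts (\<tau> ` C) (\<tau> ` P)) = card (conj_auts C P)"
proof -
  note P = mor_subgroup[OF \<tau>] and \<tau>P = mor_image[OF \<tau>]
  define tr where "tr f = restrict (\<lambda>y. \<tau> (f (inv_into P \<tau> y))) (\<tau> ` P)" for f
  have tr: "tr f (\<tau> x) = \<tau> (f x)" if "x \<in> P" for f x using that by (simp add: tr_def mor_inv_into[OF \<tau>])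
  have inj: "inj_on tr (auts m P)"
  proof (rule inj_onI)
    fix d e assume d: "d \<in> auts m P" and e: "e \<in> auts m P" and eq: "tr d = tr e"
    show "d = e"
    proof (rule extensionalityI[of _ P])
      show "d \<in> extensional P" "e \<in> extensional P" using d e by (auto simp: auts_def)
      fix x assume x: "x \<in> P"
      have "\<tau> (d x) = \<tau> (e x)" using tr[OF x] eq by metis
      then show "d x = e x" using inj_onD[OF mor_inj[OF \<tau>]] auts_mem[OF d x] auts_mem[OF e x] by blast
    qed
  qed
  have trA: "tr f \<in> auts m (\<tau> ` P)" if f: "f \<in> auts m P" for f
  proof -
    have mf: "m P f" "f ` P = P" using f by (auto simp: auts_def)
    have "m P (\<lambda>x. \<tau> (f x))" by (rule mor_comp'[OF mf(1) \<tau>]) (simp add: mf(2))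
    then have "m (\<tau> ` P) (tr f)" by (rule mor_right_factor[OF _ \<tau>]) (rule tr)
    moreover have "tr f ` \<tau> ` P = \<tau> ` f ` P" using tr by (auto simp: image_image)
    ultimately show ?thesis using mf(2) by (simp add: auts_def tr_def)
  qed
  have "inj_on tr (fixers m P Q)" using inj by (rule inj_on_subset) (auto simp: fixers_def)
  moreover have "tr ` fixers m P Q \<subseteq> fixers m (\<tau> ` P) (\<tau> ` Q)"
    using trA tr Q by (auto simp: fixers_def subset_iff)
  moreover have "finite (fixers m (\<tau> ` P) (\<tau> ` Q))"
    using finite_Bij[OF finite_subgroup[OF \<tau>P]] auts_Bij[of "\<tau> ` P"]
    by (auto simp: fixers_def intro: finite_subset)
  ultimately show "card (fixers m P Q) \<le> card (fixers m (\<tau> ` P) (\<tau> ` Q))" by (rule card_inj_on_le)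
  have Cn: "C \<subseteq> nrm P" using C subgroup_le_nrm[OF P] by blast
  have "tr (restrict (conj_by c) P) = restrict (conj_by (\<tau> c)) (\<tau> ` P)" if c: "c \<in> C" for c
  proof (rule extensionalityI[of _ "\<tau> ` P"])
    fix y assume "y \<in> \<tau> ` P"
    then obtain x where x: "x \<in> P" "y = \<tau> x" by blast
    then show "tr (restrict (conj_by c) P) y = restrict (conj_by (\<tau> c)) (\<tau> ` P) y"
      using tr mor_conj_by[OF \<tau>] c C by auto
  qed (auto simp: tr_def)
  then have "tr ` conj_auts C P = conj_auts (\<tau> ` C) (\<tau> ` P)" by (auto simp: conj_auts_def image_image)
  moreover have "inj_on tr (conj_auts C P)" using inj conj_auts_le_auts[OF P Cn] by (rule inj_on_subset)
  ultimately show "card (conj_auts (\<tau> ` C) (\<tau> ` P)) = card (conj_auts C P)" by (metis card_image)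
qed

end

context sat
begin

lemma m_factor:
  assumes "m P f"
  obtains \<alpha> \<mu> where "m (carrier S) \<alpha>" "O_rel (\<alpha> ` P) \<mu>" "\<And>x. x \<in> P \<Longrightarrow> f x = \<mu> (\<alpha> x)"
proof -
  have "gen_by O_rel (Collect (m (carrier S))) P f"
  proof (rule generation[OF O_rel_fus _ _ O_rel_invariant assms])
    show "m P f" if "O_rel P f" for P f using O_rel_le[OF that] .
    show "p_auts_in m O_rel Q" for Q by (rule p_auts_O_rel)
  qed
  then show ?thesis using that unfolding gen_by_def by blast
qed

text \<open>By invariance the two factors can be interchanged.\<close>

lemma m_factor':
  assumes f: "m P f"
  obtains \<beta> g where "m (carrier S) \<beta>" "O_rel P g" "\<And>x. x \<in> P \<Longrightarrow> f x = \<beta> (g x)"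
proof -
  obtain \<alpha> \<mu> where \<alpha>: "m (carrier S) \<alpha>" and mu: "O_rel (\<alpha> ` P) \<mu>" and eq: "\<And>x. x \<in> P \<Longrightarrow> f x = \<mu> (\<alpha> x)"
    using f by (rule m_factor) blast
  let ?i = "inv_into (carrier S) \<alpha>"
  note P = mor_subgroup[OF f]
  have "O_rel (?i ` \<alpha> ` P) (twist ?i \<mu>)"
    using O_rel_invariant mu aut_inv_mor[OF \<alpha>] by (auto simp: invariant_def)
  then have g: "O_rel P (twist ?i \<mu>)" using aut_inv_image(1)[OF \<alpha> subgroup.subset[OF P]] by simp
  show ?thesis
  proof (rule that[OF \<alpha> g])
    fix x assume x: "x \<in> P"
    have "\<alpha> (twist ?i \<mu> x) = \<mu> (\<alpha> x)"
      using aut_inv[OF \<alpha>] subgroup_in_carrier[OF P x] mor_closed[OF f x] eq[OF x] by (simp add: twist_def)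
    then show "f x = \<alpha> (twist ?i \<mu> x)" using eq[OF x] by simp
  qed
qed

end

section \<open>The subsystem belonging to a group of automorphisms of the \<open>p\<close>-group\<close>

text \<open>\<open>A\<close> stands for the preimage in \<open>Aut\<^sub>F(S)\<close> of a subgroup \<open>H\<close> of \<open>\<Gamma>\<^sub>p\<^sub>'(F)\<close>: a group of automorphisms
  that contains those which define \<open>Out\<^sup>0\<^sub>F(S)\<close>.\<close>

locale prime_index = sat +
  fixes A :: "('a \<Rightarrow> 'a) set"
  assumes aut_group_A: "aut_group m A"
    and A_contains: "m (carrier S) \<alpha> \<Longrightarrow> cntr m P \<Longrightarrow> O_rel P \<alpha> \<Longrightarrow> \<alpha> \<in> A"
begin

abbreviation E :: "'a set \<Rightarrow> ('a \<Rightarrow> 'a) \<Rightarrow> bool" where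
  "E \<equiv> gen_by O_rel A"

lemma A_mor: "\<alpha> \<in> A \<Longrightarrow> m (carrier S) \<alpha>"
  using aut_group_A by (auto simp: aut_group_def)

lemma E_fus: "fus S p E"
proof (rule gen_by_fus[OF O_rel_fus _ aut_group_A])
  show "m P f" if "O_rel P f" for P f using O_rel_le[OF that] .
  show "invariant A O_rel" using O_rel_invariant A_mor by (auto simp: invariant_def)
qed

sublocale E: fus S p E
  by (rule E_fus)

sublocale O: fus S p O_rel
  by (rule O_rel_fus)

lemma O_le_E: assumes "O_rel P f" shows "E P f"
  using assms O.mor_subgroup[OF assms] aut_group_A
  by (intro gen_byI[of _ "\<lambda>x. x" _ _ f]) (auto simp: aut_group_def)

lemma A_le_E: assumes "\<alpha> \<in> A" shows "E (carrier S) \<alpha>"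
  using assms mor_carrier_image[OF A_mor[OF assms]] O.mor_id[OF subgroup_self] subgroup_self
  by (intro gen_byI[of _ \<alpha> _ _ "\<lambda>x. x"]) auto

lemma E_le: assumes "E P f" shows "m P f"
proof -
  obtain \<alpha> \<mu> where P: "subgroup P S" and a: "\<alpha> \<in> A" "O_rel (\<alpha> ` P) \<mu>" "\<forall>x\<in>P. f x = \<mu> (\<alpha> x)"
    using assms unfolding gen_by_def by blast
  have "m P (\<lambda>x. \<mu> (\<alpha> x))"
    by (rule mor_comp[OF aut_restrict[OF A_mor[OF a(1)] P] O_rel_le[OF a(2)]])
  then show ?thesis by (rule mor_cong) (simp add: a(3))
qed

text \<open>Every morphism is an element of \<open>Aut\<^sub>F(S)\<close> after one of \<open>E\<close>, and the former preserves the
  orders of normalizers and centralizers. So the notions for \<open>E\<close> agree with those for \<open>F\<close>.\<close>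

lemma E_conj: assumes "m P f" obtains g where "E P g" "card (nrm (f ` P)) = card (nrm (g ` P))"
  "card (cen (f ` P)) = card (cen (g ` P))" "cen (g ` P) \<subseteq> g ` P \<Longrightarrow> cen (f ` P) \<subseteq> f ` P"
proof -
  obtain \<beta> g where \<beta>: "m (carrier S) \<beta>" and g: "O_rel P g" and eq: "\<And>x. x \<in> P \<Longrightarrow> f x = \<beta> (g x)"
    using assms by (rule m_factor') blast
  have im: "f ` P = \<beta> ` g ` P" using eq by (auto simp: image_image)
  have gP: "subgroup (g ` P) S" using O.mor_image[OF g] .
  show ?thesis
  proof (rule that[OF O_le_E[OF g]])
    show "cen (f ` P) \<subseteq> f ` P" if "cen (g ` P) \<subseteq> g ` P"
      unfolding im aut_card(3)[OF \<beta> gP, symmetric] using that by blast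
  qed (simp_all add: im aut_card[OF \<beta> gP])
qed

lemma fully_norm_E: "fully_norm E P \<longleftrightarrow> fully_norm m P"
proof
  assume P: "fully_norm E P"
  have "card (nrm (f ` P)) \<le> card (nrm P)" if "m P f" for f
    by (rule E_conj[OF that]) (use fully_normD[OF P] in simp)
  then show "fully_norm m P" using P by (auto simp: fully_norm_def)
qed (auto simp: fully_norm_def E_le)

lemma fully_cent_E: "fully_cent E P \<longleftrightarrow> fully_cent m P"
proof
  assume P: "fully_cent E P"
  have "card (cen (f ` P)) \<le> card (cen P)" if "m P f" for f
    by (rule E_conj[OF that]) (use fully_centD[OF P] in simp)
  then show "fully_cent m P" using P by (auto simp: fully_cent_def)
qed (auto simp: fully_cent_def E_le)

lemma cntr_E: "cntr E P \<longleftrightarrow> cntr m P"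
proof
  assume P: "cntr E P"
  have "cen (f ` P) \<subseteq> f ` P" if "m P f" for f
    by (rule E_conj[OF that]) (use cntrD[OF P] in simp)
  then show "cntr m P" using P by (auto simp: cntr_def)
next
  assume "cntr m P" then show "cntr E P" using E_le unfolding cntr_def by blast
qed

lemma sylow_E: "sylow_axiom E"
  unfolding sylow_axiom_def
proof (intro allI impI conjI)
  fix P assume "fully_norm E P"
  then have fn: "fully_norm m P" by (simp add: fully_norm_E)
  then have P: "subgroup P S" by (simp add: fully_norm_def)
  show "fully_cent E P" using sylow fn by (simp add: sylow_axiom_def fully_cent_E)
  have ind: "\<not> p dvd card (auts m P) div card (conj_auts (nrm P) P)" using sylow fn by (simp add: sylow_axiom_def)
  have sub: "auts E P \<subseteq> auts m P" using E_le by (auto simp: auts_def)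
  show "\<not> p dvd card (auts E P) div card (conj_auts (nrm P) P)"
    by (rule card_conj_auts_coprime_mono[OF P conj_auts_subgroup[OF P nrm_subgroup[OF P] subset_refl]
      E.auts_subgroup[OF P] auts_subgroup[OF P] E.conj_auts_le_auts[OF P subset_refl] sub ind])
qed

text \<open>Two factorizations \<open>\<mu> \<circ> \<alpha>\<close> of the same morphism on a centric subgroup differ, in the factor
  \<open>\<alpha>\<close>, by an automorphism whose restriction is in \<open>O_rel\<close>, and \<open>A\<close> contains all of these.\<close>

lemma E_extends:
  assumes f: "m R f" and P: "cntr m P" "P \<subseteq> R" and Ef: "E P f"
  shows "E R f"
proof -
  obtain \<alpha> \<mu> where \<alpha>: "m (carrier S) \<alpha>" and mu: "O_rel (\<alpha> ` R) \<mu>" and eq: "\<And>x. x \<in> R \<Longrightarrow> f x = \<mu> (\<alpha> x)"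
    using f by (rule m_factor) blast
  obtain \<beta> \<nu> where Ps: "subgroup P S" and b: "\<beta> \<in> A" and nu: "O_rel (\<beta> ` P) \<nu>" and eq': "\<forall>x\<in>P. f x = \<nu> (\<beta> x)"
    using Ef unfolding gen_by_def by blast
  note \<beta> = A_mor[OF b] and R = mor_subgroup[OF f]
  let ?i = "inv_into (carrier S) \<beta>"
  define \<gamma> where "\<gamma> = (\<lambda>x. \<alpha> (?i x))"
  have \<gamma>\<beta>: "\<gamma> (\<beta> x) = \<alpha> x" if "x \<in> R" for x
    using aut_inv(1)[OF \<beta> subgroup_in_carrier[OF R that]] by (simp add: \<gamma>_def)
  have m\<gamma>: "m (carrier S) \<gamma>"
    unfolding \<gamma>_def using mor_comp'[OF aut_inv_mor[OF \<beta>] \<alpha>] mor_carrier_image[OF aut_inv_mor[OF \<beta>]] by simp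
  have "O_rel (\<beta> ` P) \<gamma>"
  proof (rule O.mor_left_factor[OF nu mu])
    fix y assume "y \<in> \<beta> ` P"
    then obtain x where x: "x \<in> P" "y = \<beta> x" by blast
    then have xR: "x \<in> R" using P(2) by blast
    show "\<gamma> y \<in> \<alpha> ` R \<and> \<mu> (\<gamma> y) = \<nu> y" using \<gamma>\<beta>[OF xR] eq[OF xR] eq' x xR by auto
  qed
  moreover have "cntr m (\<beta> ` P)" using cntr_image[OF P(1) aut_restrict[OF \<beta> Ps]] .
  ultimately have "\<gamma> \<in> A" using A_contains[OF m\<gamma>] by blast
  then have c: "(\<lambda>x. \<gamma> (\<beta> x)) \<in> A" using aut_group_A b by (auto simp: aut_group_def)
  have im: "(\<lambda>x. \<gamma> (\<beta> x)) ` R = \<alpha> ` R" using \<gamma>\<beta> by auto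
  show "E R f"
    by (rule gen_byI[OF R c, of _ \<mu>]) (use mu im eq \<gamma>\<beta> in auto)
qed

text \<open>\<open>S\<close> itself is centric, so the factors \<open>\<alpha>\<close> are in the centric part, and \<open>O_rel\<close> is generated by its
  own centric part.\<close>

lemma E_centric_generated: assumes "E P f" shows "fus_gen (\<lambda>P f. E P f \<and> cntr E P) P f"
proof (rule fus_genI)
  fix M assume M: "fus S p M" and le: "\<forall>Q g. E Q g \<and> cntr E Q \<longrightarrow> M Q g"
  interpret M: fus S p M by fact
  obtain \<alpha> \<mu> where P: "subgroup P S" and a: "\<alpha> \<in> A" and mu: "O_rel (\<alpha> ` P) \<mu>" and eq: "\<forall>x\<in>P. f x = \<mu> (\<alpha> x)"
    using assms unfolding gen_by_def by blast
  have "M (carrier S) \<alpha>" using le A_le_E[OF a] E.cntr_carrier by blast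
  then have Ma: "M P \<alpha>" using M.aut_restrict[OF _ P] by blast
  have "Oc_rel (\<alpha> ` P) \<mu>" using O_rel_centric_generated[OF mu] .
  then have "M (\<alpha> ` P) \<mu>"
    unfolding Oc_rel_def using fus_genD[OF _ M] le O_le_E cntr_E by blast
  then show "M P f" using M.mor_cong[OF M.mor_comp[OF Ma]] eq by simp
qed

lemma fully_norm_aut: assumes \<alpha>: "m (carrier S) \<alpha>" and Q: "fully_norm m Q" shows "fully_norm m (\<alpha> ` Q)"
  unfolding fully_norm_def
proof (intro conjI allI impI)
  have Qs: "subgroup Q S" using Q by (simp add: fully_norm_def)
  have mQ: "m Q \<alpha>" using aut_restrict[OF \<alpha> Qs] .
  show "subgroup (\<alpha> ` Q) S" using mor_image[OF mQ] .
  fix f assume "m (\<alpha> ` Q) f"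
  then have "m Q (\<lambda>x. f (\<alpha> x))" using mor_comp[OF mQ] by blast
  then have "card (nrm ((\<lambda>x. f (\<alpha> x)) ` Q)) \<le> card (nrm Q)" by (rule fully_normD[OF Q])
  then show "card (nrm (f ` \<alpha> ` Q)) \<le> card (nrm (\<alpha> ` Q))"
    unfolding aut_card(1)[OF \<alpha> Qs] by (simp only: image_image)
qed

text \<open>Such a morphism exists in \<open>F\<close>. The automorphism of \<open>S\<close> in its factorization can be dropped, as it
  preserves full normalization.\<close>

lemma E_to_fully_norm: assumes P: "subgroup P S" shows "\<exists>\<eta>. E (nrm P) \<eta> \<and> fully_norm E (\<eta> ` P)"
proof -
  obtain \<psi> where \<psi>: "m P \<psi>" "fully_norm m (\<psi> ` P)" using exists_fully_norm[OF P] by blast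
  obtain d \<chi> where d: "d ` \<psi> ` P = \<psi> ` P" and \<chi>: "m (nrm P) \<chi>" "\<And>x. x \<in> P \<Longrightarrow> \<chi> x = d (\<psi> x)"
  proof (rule extend_to_normalizer[OF fus_axioms _ _ \<psi>])
    show "p_auts_in m m (\<psi> ` P)" by (simp add: p_auts_in_def)
  qed blast+
  obtain \<beta> g where \<beta>: "m (carrier S) \<beta>" and g: "O_rel (nrm P) g" and eq: "\<And>x. x \<in> nrm P \<Longrightarrow> \<chi> x = \<beta> (g x)"
    using \<chi>(1) by (rule m_factor') blast
  note PN = subgroup_le_nrm[OF P]
  have "\<chi> ` P = \<psi> ` P" using \<chi>(2) d by (metis (no_types, lifting) image_cong image_image)
  moreover have "\<chi> ` P = \<beta> ` g ` P" unfolding image_image using eq PN by (intro image_cong) auto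
  moreover have "g ` P \<subseteq> carrier S" using O.mor_closed[OF g] PN by blast
  ultimately have "g ` P = inv_into (carrier S) \<beta> ` \<psi> ` P" using aut_inv_image(1)[OF \<beta>, of "g ` P"] by simp
  then have "fully_norm m (g ` P)" using fully_norm_aut[OF aut_inv_mor[OF \<beta>] \<psi>(2)] by simp
  then show ?thesis using O_le_E[OF g] fully_norm_E by blast
qed

sublocale E: presaturated S p E
  by (rule presaturated.intro[OF E_fus], rule presaturated_axioms.intro)
    (use sylow_E E_to_fully_norm E_centric_generated in auto)

text \<open>\<open>sylow_in_fixers\<close> gives this for an isomorphic copy of \<open>Q C\<^sub>S(Q)\<close>. As \<open>Q\<close> is fully centralized, the
  isomorphism matches the centralizers, and the statement can be pulled back.\<close>

lemma conj_cen_sylow_in_fixers: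
  assumes Q: "subgroup Q S" "fully_cent E Q"
  shows "\<not> p dvd card (fixers E (pcen Q) Q) div card (conj_auts (cen Q) (pcen Q))"
proof -
  let ?D = "pcen Q"
  note D = pcen_subgroup[OF Q(1)]
  note QD = mult_superset[OF Q(1) cen_subgroup[OF Q(1)]]
  obtain \<tau> where \<tau>: "E ?D \<tau>"
    and np: "\<not> p dvd card (fixers E (\<tau> ` ?D) (\<tau> ` Q)) div card (conj_auts (nrm (\<tau> ` ?D) \<inter> cen (\<tau> ` Q)) (\<tau> ` ?D))"
    by (rule E.sylow_in_fixers[OF sylow_E D Q(1) QD(1)]) blast
  have c: "\<tau> ` cen Q = cen (\<tau> ` Q)" by (rule E.fully_cent_image_cen[OF \<tau> Q(1) QD Q(2)])
  have "cen (\<tau> ` Q) \<subseteq> nrm (\<tau> ` ?D)"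
    using c QD(2) subgroup_le_nrm[OF E.mor_image[OF \<tau>]] by blast
  then have eq: "nrm (\<tau> ` ?D) \<inter> cen (\<tau> ` Q) = \<tau> ` cen Q" using c by blast
  have "card (fixers E (\<tau> ` ?D) (\<tau> ` Q)) \<le> card (fixers E ?D Q)"
    using E.transport_auts(1)[OF E.mor_inv[OF \<tau>], of "\<tau> ` Q" "{}"] QD(1)
      E.mor_inv_image[OF \<tau> subset_refl] E.mor_inv_image[OF \<tau> QD(1)] by auto
  then have "card (fixers E (\<tau> ` ?D) (\<tau> ` Q)) = card (fixers E ?D Q)"
    using E.transport_auts(1)[OF \<tau> QD(1) QD(2)] by simp
  then show ?thesis using np E.transport_auts(2)[OF \<tau> QD] unfolding eq by simp
qed

text \<open>The extension \<open>\<phi>\<close> in \<open>F\<close> and the extension \<open>\<sigma>\<close> in \<open>E\<close>, defined only on \<open>P C\<^sub>S(P)\<close>, differ by an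
  automorphism \<open>\<delta>\<close> of \<open>Q C\<^sub>S(Q)\<close> that is the identity on \<open>Q\<close>. By the twisted Sylow theorem \<open>\<delta>\<close>
  can be multiplied by an automorphism in \<open>E\<close>, again the identity on \<open>Q\<close>, so that it extends to
  the image of \<open>\<phi>\<close>. The composite with \<open>\<phi>\<close> is in \<open>E\<close> on the centric subgroup \<open>P C\<^sub>S(P)\<close>, and
  therefore altogether.\<close>

lemma extension_fully_cent:
  assumes ext: "\<And>R. card R > card P \<Longrightarrow> extension_at E R"
    and f: "E P f" and fcP: "fully_cent E P" and fcQ: "fully_cent E (f ` P)"
  shows "\<exists>f'. E (Nphi P f) f' \<and> (\<forall>x\<in>P. f' x = f x)"
proof -
  define Q where "Q = f ` P"
  define N where "N = Nphi P f"
  let ?D = "pcen P" and ?D' = "pcen Q"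
  note mf = E_le[OF f] and P = E.mor_subgroup[OF f]
  have Q: "subgroup Q S" unfolding Q_def using E.mor_image[OF f] .
  have fcQ': "fully_cent E Q" using fcQ by (simp add: Q_def)
  note fcPm = fcP[unfolded fully_cent_E]
  have N: "subgroup N S" unfolding N_def using Nphi_subgroup[OF mf] .
  have DN: "?D \<subseteq> N" unfolding N_def using pcen_le_Nphi[OF mf] .
  have PD: "P \<subseteq> ?D" using mult_superset(1)[OF P cen_subgroup[OF P]] .
  note D's = pcen_subgroup[OF Q] and Ds = pcen_subgroup[OF P]
  have QD': "Q \<subseteq> ?D'" "cen Q \<subseteq> ?D'" using mult_superset[OF Q cen_subgroup[OF Q]] by auto
  obtain \<phi> where \<phi>: "m N \<phi>" "\<And>x. x \<in> P \<Longrightarrow> \<phi> x = f x"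
    using extension[of P] mf fcQ by (auto simp: extension_at_def fully_cent_E N_def)
  obtain \<sigma> where \<sigma>: "E ?D \<sigma>" "\<And>x. x \<in> P \<Longrightarrow> \<sigma> x = f x"
  proof (rule E.extend_to_centralizer[OF _ f fcQ])
    show "extension_at E R" if "card P < card R" for R using ext[OF that] .
  qed (rule that)
  have im: "\<phi> ` P = Q" "\<sigma> ` P = Q" unfolding Q_def using \<phi>(2) \<sigma>(2) by (auto intro!: image_cong)
  have \<phi>D: "\<phi> ` ?D = ?D'" using pcen_image[OF \<phi>(1) P DN fcPm] im by simp
  have \<sigma>D: "\<sigma> ` ?D = ?D'" using E.pcen_image[OF \<sigma>(1) P subset_refl fcP] im by simp
  have m\<phi>D: "m ?D \<phi>" using mor_restrict[OF \<phi>(1) Ds DN] .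
  define \<delta> where "\<delta> = (\<lambda>y. \<sigma> (inv_into ?D \<phi> y))"
  have \<delta>\<phi>: "\<delta> (\<phi> x) = \<sigma> x" if "x \<in> ?D" for x using that by (simp add: \<delta>_def mor_inv_into[OF m\<phi>D])
  have \<delta>: "m ?D' \<delta>"
    using mor_right_factor[OF E_le[OF \<sigma>(1)] m\<phi>D, of \<delta>] \<delta>\<phi> \<phi>D by simp
  have "\<delta> ` \<phi> ` ?D = \<sigma> ` ?D" unfolding image_image using \<delta>\<phi> by (intro image_cong) auto
  then have \<delta>D: "\<delta> ` ?D' = ?D'" using \<phi>D \<sigma>D by simp
  have \<delta>Q: "\<delta> y = y" if y: "y \<in> Q" for y
  proof -
    obtain x where x: "x \<in> P" "y = f x" using y by (auto simp: Q_def)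
    then show ?thesis using \<delta>\<phi>[of x] \<phi>(2)[of x] \<sigma>(2)[of x] PD by auto
  qed
  define W where "W = \<phi> ` N"
  have W: "subgroup W S" unfolding W_def using mor_image[OF \<phi>(1)] .
  have WQ: "W \<subseteq> nrm Q"
    using mor_nrm[OF \<phi>(1) P] Nphi_le_nrm[of P f] PD DN im(1) unfolding W_def N_def by blast
  have WD: "W \<subseteq> nrm ?D'" using WQ nrm_le_nrm_pcen[OF Q] by blast
  let ?F = "fixers E ?D' Q" and ?B = "conj_auts (cen Q) ?D'"
  have Fs: "subgroup ?F (BijGroup ?D')" by (rule E.fixers_subgroup[OF D's QD'(1)])
  have CD: "cen Q \<subseteq> nrm ?D'" using QD'(2) subgroup_le_nrm[OF D's] by blast
  have Bs: "subgroup ?B (BijGroup ?D')" by (rule conj_auts_subgroup[OF D's cen_subgroup[OF Q] CD])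
  have "\<forall>x\<in>Q. b x = x" if "b \<in> ?B" for b
    using that QD'(1) cen_iff[OF Q] by (auto simp: conj_auts_def)
  then have BF: "?B \<subseteq> ?F" using E.conj_auts_le_auts[OF D's CD] by (auto simp: fixers_def)
  obtain \<epsilon>0 where e0: "\<epsilon>0 \<in> ?F"
    "\<And>w. w \<in> W \<Longrightarrow> \<exists>b\<in>?B. \<forall>y\<in>?D'. \<epsilon>0 (\<delta> (conj_by w y)) = b (conj_by w (\<epsilon>0 (\<delta> y)))"
  proof (rule twisted_sylow_auts[OF D's Fs Bs BF conj_cen_sylow_in_fixers[OF Q fcQ'] W _ D's WD, of \<delta> "\<lambda>w. w"])
    show "bij_betw \<delta> ?D' ?D'" using mor_inj[OF \<delta>] \<delta>D by (simp add: bij_betw_def)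
    show "(\<lambda>w. w) \<in> hom (S\<lparr>carrier := W\<rparr>) S" using subgroup_in_carrier[OF W] by (auto simp: hom_def)
    show "(\<lambda>w. w) ` W \<subseteq> nrm ?D'" using WD by simp
    show "\<exists>b'\<in>?B. \<forall>y\<in>?D'. conj_by w (b y) = b' (conj_by w y)" if w: "w \<in> W" and b: "b \<in> ?B" for w b
    proof -
      obtain z where z: "z \<in> cen Q" "b = restrict (conj_by z) ?D'" using b by (auto simp: conj_auts_def)
      have c: "conj_by w z \<in> cen Q" using nrm_conj_cen[OF Q _ z(1)] w WQ by blast
      have wn: "w \<in> nrm ?D'" using w WD by blast
      have "conj_by w (b y) = restrict (conj_by (conj_by w z)) ?D' (conj_by w y)" if y: "y \<in> ?D'" for y
      proof -
        have "w \<in> carrier S" "z \<in> carrier S" "y \<in> carrier S"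
          using nrmD(1)[OF wn] subgroup_in_carrier[OF cen_subgroup[OF Q] z(1)] subgroup_in_carrier[OF D's y] .
        then show ?thesis using y nrmD(2)[OF wn y]
          by (simp add: z(2)) (simp add: conj_by_def inv_mult_group m_assoc inv_cancel)
      qed
      then show ?thesis using c by (auto simp: conj_auts_def)
    qed
    show "\<exists>d'\<in>?F. \<forall>y\<in>?D'. conj_by w (d (\<delta> y)) = d' (\<delta> (conj_by w y))" if w: "w \<in> W" and d: "d \<in> ?F" for w d
    proof -
      have wn: "w \<in> nrm ?D'" "w \<in> nrm Q" using w WD WQ by auto
      have w': "inv w \<in> nrm ?D'" "inv w \<in> nrm Q" using wn nrm_subgroup[OF D's] nrm_subgroup[OF Q] by (auto intro: subgroup.m_inv_closed)
      have dA: "d \<in> auts E ?D'" and dQ: "\<And>x. x \<in> Q \<Longrightarrow> d x = x" using d by (auto simp: fixers_def)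
      define t where "t = (\<lambda>y. \<delta> (conj_by (inv w) (inv_into ?D' \<delta> y)))"
      have t: "m ?D' t" "t ` ?D' = ?D'" "\<exists>k. \<forall>x\<in>?D'. (t ^^ (p ^ k)) x = x"
        using conj_transport[OF \<delta> w'(1)] unfolding \<delta>D t_def by auto
      then have "O_rel ?D' t" by (rule p_auts_inD[OF p_auts_O_rel])
      then have tA: "restrict t ?D' \<in> auts E ?D'" using O_le_E t(2) E.restrict_auts by blast
      have t\<delta>: "t (\<delta> y) = \<delta> (conj_by (inv w) y)" if "y \<in> ?D'" for y
        using that by (simp add: t_def mor_inv_into[OF \<delta>])
      have tQ: "t y = conj_by (inv w) y" if y: "y \<in> Q" for y
        using t\<delta>[of y] \<delta>Q[OF y] \<delta>Q[OF nrmD(2)[OF w'(2) y]] y QD'(1) by auto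
      let ?c = "restrict (conj_by w) ?D'"
      have cA: "?c \<in> auts E ?D'" using E.conj_auts_le_auts[OF D's subset_refl] wn(1) by (auto simp: conj_auts_def)
      \<comment> \<open>The element by which the twisted action moves \<open>d\<close>; it is in \<open>E\<close> because \<open>t\<close>, a conjugation
        transported by \<open>\<delta>\<close>, has \<open>p\<close>-power order.\<close>
      define d' where "d' = compose ?D' ?c (compose ?D' d (restrict t ?D'))"
      have dt: "compose ?D' d (restrict t ?D') \<in> auts E ?D'" using E.auts_compose[OF dA tA] .
      have d'A: "d' \<in> auts E ?D'" unfolding d'_def using E.auts_compose[OF cA dt] .
      have tD: "t y \<in> ?D'" if "y \<in> ?D'" for y using t(2) that by blast
      have d'y: "d' y = conj_by w (d (t y))" if "y \<in> ?D'" for y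
        using that auts_mem[OF dA tD[OF that]] by (simp add: d'_def compose_def)
      have "d' y = y" if y: "y \<in> Q" for y
      proof -
        have "d (t y) = conj_by (inv w) y" using tQ[OF y] dQ nrmD(2)[OF w'(2) y] by simp
        then show ?thesis
          using d'y[of y] y QD'(1) nrmD(1)[OF wn(2)] subgroup_in_carrier[OF Q y] by auto
      qed
      then have "d' \<in> ?F" using d'A by (simp add: fixers_def)
      moreover have "conj_by w (d (\<delta> y)) = d' (\<delta> (conj_by w y))" if y: "y \<in> ?D'" for y
      proof -
        have wy: "conj_by w y \<in> ?D'" using nrmD(2)[OF wn(1) y] .
        then have "\<delta> (conj_by w y) \<in> ?D'" using \<delta>D by blast
        then show ?thesis
          using d'y t\<delta>[OF wy] nrmD(1)[OF wn(1)] subgroup_in_carrier[OF D's y] by simp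
      qed
      ultimately show ?thesis by blast
    qed
  qed blast
  have eA: "E ?D' \<epsilon>0" "\<epsilon>0 ` ?D' = ?D'" and eQ: "\<And>x. x \<in> Q \<Longrightarrow> \<epsilon>0 x = x"
    using e0(1) by (auto simp: fixers_def auts_def)
  define \<epsilon> where "\<epsilon> = (\<lambda>y. \<epsilon>0 (\<delta> y))"
  have \<epsilon>: "m ?D' \<epsilon>" unfolding \<epsilon>_def using mor_comp'[OF \<delta> E_le[OF eA(1)]] \<delta>D by simp
  have \<epsilon>D: "\<epsilon> ` ?D' = ?D'" unfolding \<epsilon>_def using \<delta>D eA(2) by (simp flip: image_image)
  have WN: "W \<subseteq> Nphi ?D' \<epsilon>"
  proof
    fix w assume w: "w \<in> W"
    obtain b where b: "b \<in> ?B" "\<forall>y\<in>?D'. \<epsilon>0 (\<delta> (conj_by w y)) = b (conj_by w (\<epsilon>0 (\<delta> y)))" using e0(2)[OF w] by blast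
    obtain z where z: "z \<in> cen Q" "b = restrict (conj_by z) ?D'" using b(1) by (auto simp: conj_auts_def)
    have wn: "w \<in> nrm ?D'" using w WD by blast
    have zc: "z \<in> carrier S" using subgroup_in_carrier[OF cen_subgroup[OF Q] z(1)] .
    have "\<epsilon> (conj_by w y) = conj_by (z \<otimes> w) (\<epsilon> y)" if y: "y \<in> ?D'" for y
    proof -
      have ey: "\<epsilon> y \<in> ?D'" using \<epsilon>D y by blast
      have "\<epsilon> (conj_by w y) = conj_by z (conj_by w (\<epsilon> y))"
        using b(2) y z(2) nrmD(2)[OF wn ey] by (simp add: \<epsilon>_def)
      then show ?thesis using conj_by_mult[OF zc nrmD(1)[OF wn] subgroup_in_carrier[OF D's ey]] by simp
    qed
    then show "w \<in> Nphi ?D' \<epsilon>" using wn zc nrmD(1)[OF wn] by (auto simp: Nphi_def intro!: bexI[of _ "z \<otimes> w"])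
  qed
  have "fully_cent m ?D'" using cntr_fully_cent[OF cntr_pcen[OF Q fcQ'[unfolded fully_cent_E]]] .
  then obtain \<epsilon>' where e': "m (Nphi ?D' \<epsilon>) \<epsilon>'" "\<And>y. y \<in> ?D' \<Longrightarrow> \<epsilon>' y = \<epsilon> y"
    using extension[of ?D'] \<epsilon> \<epsilon>D by (auto simp: extension_at_def)
  define f' where "f' = (\<lambda>x. \<epsilon>' (\<phi> x))"
  have f': "m N f'" unfolding f'_def by (rule mor_comp'[OF \<phi>(1) e'(1)]) (use WN W_def in blast)
  have f'D: "f' x = \<epsilon>0 (\<sigma> x)" if x: "x \<in> ?D" for x
  proof -
    have "\<phi> x \<in> ?D'" using x \<phi>D by blast
    then show ?thesis using e'(2) \<delta>\<phi>[OF x] by (simp add: f'_def \<epsilon>_def)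
  qed
  have "E ?D (\<lambda>x. \<epsilon>0 (\<sigma> x))" using E.mor_comp[OF \<sigma>(1)] eA(1) \<sigma>D by simp
  then have "E ?D f'" by (rule E.mor_cong) (simp add: f'D)
  then have "E N f'" using E_extends[OF f' cntr_pcen[OF P fcPm] DN] by blast
  moreover have "f' x = f x" if x: "x \<in> P" for x
  proof -
    have "f x \<in> Q" using x by (simp add: Q_def)
    then show ?thesis using f'D[of x] PD x \<sigma>(2)[OF x] eQ by auto
  qed
  ultimately show ?thesis unfolding N_def by blast
qed

text \<open>A general \<open>P\<close> is first moved to a fully normalized subgroup by a morphism \<open>\<eta>\<close> of \<open>E\<close> on \<open>N\<^sub>S(P)\<close>,
  which carries \<open>N\<^sub>f\<close> into the corresponding subgroup for \<open>f \<circ> \<eta>\<^sup>-\<^sup>1\<close>.\<close>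

theorem extension_E: "extension_at E P"
proof (induction "card (carrier S) - card P" arbitrary: P rule: less_induct)
  case less
  have ext: "extension_at E R" if R: "card R > card P" for R
  proof (cases "subgroup R S")
    case True
    then have "card R \<le> card (carrier S)" using finite_S subgroup.subset by (intro card_mono)
    then show ?thesis using less R by simp
  next
    case False
    then show ?thesis using E.mor_subgroup by (auto simp: extension_at_def)
  qed
  show ?case
    unfolding extension_at_def
  proof (intro allI impI)
    fix f assume f: "E P f" and fc: "fully_cent E (f ` P)"
    note P = E.mor_subgroup[OF f]
    note PN = subgroup_le_nrm[OF P]
    obtain \<eta> where \<eta>: "E (nrm P) \<eta>" "fully_norm E (\<eta> ` P)" using E_to_fully_norm[OF P] by blast
    have \<eta>P: "E P \<eta>" using E.mor_restrict[OF \<eta>(1) P PN] .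
    define g where "g = (\<lambda>y. f (inv_into P \<eta> y))"
    have g\<eta>: "g (\<eta> x) = f x" if "x \<in> P" for x using that by (simp add: g_def E.mor_inv_into[OF \<eta>P])
    have g: "E (\<eta> ` P) g" by (rule E.mor_right_factor[OF f \<eta>P]) (rule g\<eta>)
    have im: "g ` \<eta> ` P = f ` P" unfolding image_image using g\<eta> by (intro image_cong) auto
    have "\<exists>g'. E (Nphi (\<eta> ` P) g) g' \<and> (\<forall>y\<in>\<eta> ` P. g' y = g y)"
    proof (rule extension_fully_cent[OF _ g E.fully_norm_cent[OF \<eta>(2)]])
      show "extension_at E R" if "card (\<eta> ` P) < card R" for R using ext that E.mor_card[OF \<eta>P] by simp
      show "fully_cent E (g ` \<eta> ` P)" unfolding im by (rule fc)
    qed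
    then obtain g' where g': "E (Nphi (\<eta> ` P) g) g'" "\<forall>y\<in>\<eta> ` P. g' y = g y" by blast
    have sub: "\<eta> ` Nphi P f \<subseteq> Nphi (\<eta> ` P) g"
    proof
      fix v assume "v \<in> \<eta> ` Nphi P f"
      then obtain w h where w: "w \<in> nrm P" "v = \<eta> w" "h \<in> carrier S" "\<forall>x\<in>P. f (conj_by w x) = conj_by h (f x)"
        by (auto simp: Nphi_def)
      have "g (conj_by v y) = conj_by h (g y)" if y: "y \<in> \<eta> ` P" for y
      proof -
        obtain x where x: "x \<in> P" "y = \<eta> x" using y by blast
        have "conj_by v y = \<eta> (conj_by w x)" using E.mor_conj_by[OF \<eta>(1) w(1)] x PN w(2) by auto
        then show ?thesis using g\<eta> nrmD(2)[OF w(1) x(1)] w(4) x by simp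
      qed
      moreover have "v \<in> nrm (\<eta> ` P)" using E.mor_nrm[OF \<eta>(1) P PN w(1,1)] w(2) by simp
      ultimately show "v \<in> Nphi (\<eta> ` P) g" using w(3) by (auto simp: Nphi_def)
    qed
    have N: "E (Nphi P f) \<eta>" using E.mor_restrict[OF \<eta>(1) E.Nphi_subgroup[OF f] Nphi_le_nrm] .
    have "E (Nphi P f) (\<lambda>x. g' (\<eta> x))" using E.mor_comp'[OF N g'(1) sub] .
    moreover have "\<forall>x\<in>P. g' (\<eta> x) = f x" using g'(2) g\<eta> by simp
    ultimately show "\<exists>f'. E (Nphi P f) f' \<and> (\<forall>x\<in>P. f' x = f x)" by blast
  qed
qed

end

section \<open>Saturated subsystems that contain the automorphisms of \<open>p\<close>-power order\<close>

context sat
begin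

lemma O_rel_least:
  assumes M: "fus S p M" and "\<And>P. p_auts_in m M P" and f: "O_rel P f"
  shows "M P f"
  using f unfolding O_rel_def
  by (rule fus_gen_least[OF _ M]) (use assms(2) in \<open>auto simp: p_aut_def p_auts_in_def\<close>)

text \<open>An automorphism \<open>\<alpha>\<close> of \<open>S\<close> that belongs to the subsystem \<open>m'\<close> on a centric subgroup \<open>P\<close> belongs to
  it on \<open>N\<^sub>S(P)\<close> too. It differs there from an extension \<open>\<psi>0\<close> inside \<open>m'\<close> by an automorphism that is
  the identity on \<open>P\<close> and moves each element within its coset of \<open>P\<close>; such an automorphism has
  \<open>p\<close>-power order.\<close>

lemma automorphism_in_subsystem:
  assumes m': "sat S p m'" and le: "\<And>P f. m' P f \<Longrightarrow> m P f" and pm': "\<And>P. p_auts_in m m' P"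
    and \<alpha>: "m (carrier S) \<alpha>"
  shows "cntr m P \<Longrightarrow> m' P \<alpha> \<Longrightarrow> m' (carrier S) \<alpha>"
proof (induction "card (carrier S) - card P" arbitrary: P rule: less_induct)
  case less
  interpret M: sat S p m' by fact
  note c = less.prems(1) and f = less.prems(2)
  note P = M.mor_subgroup[OF f]
  note Pc = subgroup_in_carrier[OF P]
  let ?N = "nrm P"
  note N = nrm_subgroup[OF P] and PN = subgroup_le_nrm[OF P]
  note Nc = subgroup_in_carrier[OF nrm_subgroup[OF P]]
  show ?case
  proof (cases "P = carrier S")
    case False
    then have "P \<subset> carrier S" using subgroup.subset[OF P] by blast
    then have "P \<subset> ?N" using nrm_grows[OF subgroup_self P] by blast
    then have lt: "card P < card ?N" "card ?N \<le> card (carrier S)"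
      using finite_subgroup[OF N] subgroup.subset[OF N] finite_S by (auto simp: psubset_card_mono card_mono)
    let ?i = "inv_into (carrier S) \<alpha>"
    have aP: "subgroup (\<alpha> ` P) S" using M.mor_image[OF f] .
    have c\<alpha>: "cntr m (\<alpha> ` P)" using cntr_image[OF c aut_restrict[OF \<alpha> P]] .
    then have "cntr m' (\<alpha> ` P)" using le unfolding cntr_def by blast
    then have "fully_cent m' (\<alpha> ` P)" by (rule M.cntr_fully_cent)
    then obtain \<psi>0 where \<psi>0: "m' (Nphi P \<alpha>) \<psi>0" "\<And>x. x \<in> P \<Longrightarrow> \<psi>0 x = \<alpha> x"
      using M.extension[of P] f by (auto simp: extension_at_def)
    have "?N \<subseteq> Nphi P \<alpha>"
    proof
      fix w assume w: "w \<in> ?N"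
      have "\<alpha> (conj_by w x) = conj_by (\<alpha> w) (\<alpha> x)" if "x \<in> P" for x
        using mor_conj_by[OF \<alpha>] Nc[OF w] Pc[OF that] by simp
      then show "w \<in> Nphi P \<alpha>" using w mor_closed[OF \<alpha>] Nc[OF w] by (auto simp: Nphi_def)
    qed
    then have \<psi>: "m' ?N \<psi>0" using M.mor_restrict[OF \<psi>0(1) N] by blast
    note m\<psi> = le[OF \<psi>]
    \<comment> \<open>The elements \<open>\<psi>0 g\<close> and \<open>\<alpha> g\<close> act alike on the image of \<open>P\<close>, which contains its centralizer.\<close>
    have shift: "\<exists>z\<in>P. \<psi>0 g = \<alpha> (g \<otimes> z)" if g: "g \<in> ?N" for g
    proof -
      note gc = Nc[OF g]
      have ac: "\<alpha> g \<in> carrier S" "\<psi>0 g \<in> carrier S" using mor_closed[OF \<alpha> gc] M.mor_closed[OF \<psi> g] .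
      have "inv (\<alpha> g) \<otimes> \<psi>0 g \<in> cen (\<alpha> ` P)"
        unfolding cen_iff[OF aP]
      proof (intro conjI ballI)
        show "inv (\<alpha> g) \<otimes> \<psi>0 g \<in> carrier S" using ac by simp
        fix y assume "y \<in> \<alpha> ` P"
        then obtain x where x: "x \<in> P" "y = \<alpha> x" by blast
        have gx: "conj_by g x \<in> P" using nrmD(2)[OF g x(1)] .
        have yc: "y \<in> carrier S" using x subgroup_in_carrier[OF aP] by blast
        have "conj_by (\<psi>0 g) y = \<psi>0 (conj_by g x)"
          using mor_conj_by[OF m\<psi> g, of x] x PN \<psi>0(2) by auto
        also have "\<dots> = conj_by (\<alpha> g) y"
          using \<psi>0(2)[OF gx] mor_conj_by[OF \<alpha> gc Pc[OF x(1)]] x(2) by simp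
        finally have "conj_by (\<psi>0 g) y = conj_by (\<alpha> g) y" .
        then show "conj_by (inv (\<alpha> g) \<otimes> \<psi>0 g) y = y" using ac yc by (simp add: conj_by_mult)
      qed
      then have "inv (\<alpha> g) \<otimes> \<psi>0 g \<in> \<alpha> ` P" using cntrD[OF c\<alpha> mor_id[OF aP]] by auto
      then obtain z where z: "z \<in> P" "\<alpha> z = inv (\<alpha> g) \<otimes> \<psi>0 g" by auto
      have "\<alpha> (g \<otimes> z) = \<psi>0 g" using mor_mult[OF \<alpha> gc Pc[OF z(1)]] z(2) ac by (simp add: inv_cancel)
      then show ?thesis using z(1) by metis
    qed
    define \<epsilon> where "\<epsilon> = (\<lambda>g. ?i (\<psi>0 g))"
    have e: "\<exists>z\<in>P. \<epsilon> g = g \<otimes> z" if g: "g \<in> ?N" for g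
    proof -
      obtain z where z: "z \<in> P" "\<psi>0 g = \<alpha> (g \<otimes> z)" using shift[OF g] by blast
      then show ?thesis using aut_inv(1)[OF \<alpha>] Nc[OF g] Pc by (auto simp: \<epsilon>_def)
    qed
    have a\<epsilon>: "\<alpha> (\<epsilon> g) = \<psi>0 g" if "g \<in> ?N" for g
      using aut_inv(2)[OF \<alpha> M.mor_closed[OF \<psi> that]] by (simp add: \<epsilon>_def)
    have eP: "\<epsilon> x = x" if "x \<in> P" for x using \<psi>0(2)[OF that] aut_inv(1)[OF \<alpha> Pc[OF that]] by (simp add: \<epsilon>_def)
    have m\<epsilon>: "m ?N \<epsilon>"
      unfolding \<epsilon>_def by (rule mor_comp'[OF m\<psi> aut_inv_mor[OF \<alpha>]]) (use mor_closed[OF m\<psi>] in auto)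
    have "\<epsilon> ` ?N \<subseteq> ?N"
    proof
      fix y assume "y \<in> \<epsilon> ` ?N"
      then obtain g where g: "g \<in> ?N" "y = \<epsilon> g" by blast
      then obtain z where "z \<in> P" "y = g \<otimes> z" using e by blast
      then show "y \<in> ?N" using g(1) PN subgroup.m_closed[OF N] by blast
    qed
    then have eN: "\<epsilon> ` ?N = ?N" using finite_subgroup[OF N] mor_inj[OF m\<epsilon>] by (intro endo_inj_surj)
    have pw: "(\<epsilon> ^^ n) g = g \<otimes> z [^] n" if g: "g \<in> ?N" and z: "z \<in> P" "\<epsilon> g = g \<otimes> z" for g z n
    proof (induction n)
      case 0
      then show ?case using Nc[OF g] by simp
    next
      case (Suc n)
      have zn: "z [^] n \<in> P" using P z(1) by (induction n) (auto simp: subgroup.one_closed subgroup.m_closed)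
      have "\<epsilon> (g \<otimes> z [^] n) = (g \<otimes> z) \<otimes> z [^] n"
        using mor_mult[OF m\<epsilon> g, of "z [^] n"] zn PN eP z(2) by auto
      then show ?case using Suc z(1) Nc[OF g] Pc by (simp add: m_assoc nat_pow_Suc2[symmetric] del: nat_pow_Suc)
    qed
    obtain k where k: "order S = p ^ k" using order_S by blast
    have "(\<epsilon> ^^ (p ^ k)) g = g" if g: "g \<in> ?N" for g
    proof -
      obtain z where z: "z \<in> P" "\<epsilon> g = g \<otimes> z" using e[OF g] by blast
      show ?thesis using pw[OF g z] pow_order_eq_1[OF Pc[OF z(1)]] k Nc[OF g] by simp
    qed
    then have "\<exists>k. \<forall>g\<in>?N. (\<epsilon> ^^ (p ^ k)) g = g" by blast
    then have "m' ?N \<epsilon>" by (rule p_auts_inD[OF pm' m\<epsilon> eN])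
    then have "m' (\<epsilon> ` ?N) \<alpha>" by (rule M.mor_right_factor[OF \<psi>]) (rule a\<epsilon>)
    then have "m' ?N \<alpha>" using eN by simp
    then show ?thesis using less.hyps[OF _ cntr_overgroup[OF c N PN]] lt by simp
  qed (use f in simp)
qed

text \<open>The second part is \<open>generation\<close> for \<open>m'\<close>, with the system \<open>O_rel\<close> of \<open>m\<close>.\<close>

lemma subsystem_prime_index:
  assumes m': "sat S p m'" and le: "\<And>P f. m' P f \<Longrightarrow> m P f" and pm': "\<And>P. p_auts_in m m' P"
  shows "prime_index S p m (Collect (m' (carrier S)))"
    and "m' P f \<longleftrightarrow> gen_by O_rel (Collect (m' (carrier S))) P f"
proof -
  interpret M: sat S p m' by fact
  have O: "m' P f" if "O_rel P f" for P f by (rule O_rel_least[OF M.fus_axioms pm' that])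
  show "prime_index S p m (Collect (m' (carrier S)))"
  proof (rule prime_index.intro[OF sat_axioms], rule prime_index_axioms.intro)
    show "aut_group m (Collect (m' (carrier S)))"
      using M.aut_group_full le unfolding aut_group_def by auto
    show "\<alpha> \<in> Collect (m' (carrier S))" if "m (carrier S) \<alpha>" "cntr m P" "O_rel P \<alpha>" for \<alpha> P
      using automorphism_in_subsystem[OF m' le pm' that(1,2) O[OF that(3)]] by simp
  qed
  show "m' P f \<longleftrightarrow> gen_by O_rel (Collect (m' (carrier S))) P f"
  proof
    assume f: "m' P f"
    show "gen_by O_rel (Collect (m' (carrier S))) P f"
    proof (rule M.generation[OF O_rel_fus O _ _ f])
      show "p_auts_in m' O_rel Q" for Q
        using p_auts_O_rel[of Q] le unfolding p_auts_in_def by blast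
      show "invariant (Collect (m' (carrier S))) O_rel"
        using O_rel_invariant le by (auto simp: invariant_def)
    qed
  next
    assume "gen_by O_rel (Collect (m' (carrier S))) P f"
    then obtain \<alpha> \<mu> where P: "subgroup P S" and a: "m' (carrier S) \<alpha>" and mu: "O_rel (\<alpha> ` P) \<mu>" and eq: "\<forall>x\<in>P. f x = \<mu> (\<alpha> x)"
      unfolding gen_by_def by blast
    show "m' P f"
      by (rule M.mor_cong[OF M.mor_comp[OF M.aut_restrict[OF a P] O[OF mu]]]) (use eq in simp)
  qed
qed

end

lemma (in prime_index) p_auts_E: "p_auts_in m E P"
  using p_auts_O_rel[of P] O_le_E unfolding p_auts_in_def by blast

lemma (in prime_index) E_automorphism:
  assumes "E (carrier S) \<alpha>" shows "\<exists>\<beta>\<in>A. \<forall>x\<in>carrier S. \<alpha> x = \<beta> x"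
proof -
  obtain \<beta> \<mu> where b: "\<beta> \<in> A" and mu: "O_rel (\<beta> ` carrier S) \<mu>" and eq: "\<forall>x\<in>carrier S. \<alpha> x = \<mu> (\<beta> x)"
    using assms unfolding gen_by_def by blast
  have "O_rel (carrier S) \<mu>" using mu mor_carrier_image[OF A_mor[OF b]] by simp
  then have "\<mu> \<in> A" using A_contains[OF O_rel_le cntr_carrier] by blast
  then have "(\<lambda>x. \<mu> (\<beta> x)) \<in> A" using aut_group_A b by (auto simp: aut_group_def)
  then show ?thesis using eq by (intro bexI[of _ "\<lambda>x. \<mu> (\<beta> x)"]) auto
qed

section \<open>The residual of a finite group\<close>

text \<open>In the quotient by a normal subgroup of index prime to \<open>p\<close> the order of the element divides both
  a power of \<open>p\<close> and that index.\<close>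

lemma (in group) p_element_in_O_p':
  assumes "finite (carrier G)" "prime p" and x: "x \<in> carrier G" "x [^] (p ^ k) = \<one>"
  shows "x \<in> O_p' p G"
  unfolding O_p'_def
proof (rule InterI, elim CollectE conjE)
  fix N assume N: "N \<lhd> G" and cop: "coprime p (card (rcosets N))"
  interpret N: normal N G by fact
  let ?r = "card (rcosets N)"
  interpret Q: group "G Mod N" by (rule N.factorgroup_is_group)
  have fin: "finite (rcosets N)" using assms(1) rcosets_part_G[OF N.subgroup_axioms] by (metis finite_UnionD)
  have ord: "order (G Mod N) = ?r" by (simp add: order_def FactGroup_def)
  have xc: "N #> x \<in> carrier (G Mod N)" using x(1) by (auto simp: carrier_FactGroup)
  have "(N #> x) [^]\<^bsub>G Mod N\<^esub> ?r = N" using Q.pow_order_eq_1[OF xc] ord by simp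
  moreover have "(N #> x) [^]\<^bsub>G Mod N\<^esub> (p ^ k) = N"
    using N.FactGroup_pow[OF x(1), of "p ^ k"] x(2) coset_mult_one[OF N.subset] by simp
  ultimately have "Q.ord (N #> x) dvd ?r" "Q.ord (N #> x) dvd p ^ k"
    using Q.pow_eq_id[OF xc] by simp_all
  moreover have "coprime (p ^ k) ?r" using cop by simp
  ultimately have "Q.ord (N #> x) = 1" by (metis coprime_common_divisor_nat nat_dvd_1_iff_1 One_nat_def coprime_def)
  then have "N #> x = N" using Q.ord_eq_1[OF xc] by simp
  then show "x \<in> N" using rcos_self[OF x(1) N.subgroup_axioms] by simp
qed

text \<open>The subgroup generated by the elements of \<open>p\<close>-power order is normal, and its index is prime to
  \<open>p\<close> because it contains a Sylow subgroup.\<close>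

lemma (in group) O_p'_le_generate:
  assumes fin: "finite (carrier G)" and p: "prime p"
  shows "O_p' p G \<subseteq> generate G {x \<in> carrier G. \<exists>k. x [^] (p ^ k :: nat) = \<one>}"
proof -
  let ?X = "{x \<in> carrier G. \<exists>k. x [^] (p ^ k :: nat) = \<one>}"
  let ?N = "generate G ?X"
  have N: "?N \<lhd> G"
  proof (rule normal_generateI)
    fix x g assume x: "x \<in> ?X" and g: "g \<in> carrier G"
    then obtain k where k: "x [^] (p ^ k :: nat) = \<one>" "x \<in> carrier G" by blast
    have "(g \<otimes> x \<otimes> inv g) [^] n = g \<otimes> x [^] n \<otimes> inv g" for n :: nat
      using g k(2) by (induction n) (simp_all add: m_assoc inv_cancel)
    then have "(g \<otimes> x \<otimes> inv g) [^] (p ^ k) = \<one>" using g k by simp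
    then show "g \<otimes> x \<otimes> inv g \<in> ?X" using g k(2) by blast
  qed auto
  interpret N: normal ?N G by fact
  have pos: "order G > 0" using fin order_gt_0_iff_finite by simp
  define a where "a = multiplicity p (order G)"
  obtain s where s: "order G = p ^ a * s" "\<not> p dvd s"
    using multiplicity_decompose'[of "order G" p] pos p unfolding a_def
    by (metis gr_implies_not0 nat_dvd_1_iff_1 not_prime_1)
  obtain H where H: "subgroup H G" "card H = p ^ a"
    using sylow_thm[OF p is_group s(1) fin] by blast
  have "H \<subseteq> ?X"
  proof
    fix x assume x: "x \<in> H"
    interpret H: group "G\<lparr>carrier := H\<rparr>" using H(1) by (simp add: subgroup.subgroup_is_group)
    have "x [^]\<^bsub>G\<lparr>carrier := H\<rparr>\<^esub> (p ^ a) = \<one>"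
      using H.pow_order_eq_1[of x] x H(2) by (simp add: order_def)
    then have "x [^] (p ^ a) = \<one>" by (simp add: nat_pow_consistent[symmetric])
    then show "x \<in> ?X" using subgroup.mem_carrier[OF H(1) x] by blast
  qed
  then have HN: "H \<subseteq> ?N" using generate.incl[of _ ?X G] by blast
  have "p ^ a dvd card ?N"
    using card_rcosets_div(2)[OF fin N.subgroup_axioms H(1) HN] H(2) by simp
  then obtain t where t: "card ?N = p ^ a * t" by blast
  have "card (rcosets ?N) * (p ^ a * t) = p ^ a * s" using lagrange[OF N.subgroup_axioms] s(1) t by simp
  then have "card (rcosets ?N) dvd s" using prime_gt_0_nat[OF p] by (auto simp: mult.commute mult.left_commute)
  then have "\<not> p dvd card (rcosets ?N)" using s(2) dvd_trans by blast
  then have "coprime p (card (rcosets ?N))" using p by (simp add: prime_imp_coprime)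
  then show ?thesis using N unfolding O_p'_def by blast
qed

section \<open>Fusion systems as families of morphism sets\<close>

context p_group
begin

text \<open>The passage between the two encodings: \<open>mo\<close> takes the morphisms to the whole group, and \<open>fam\<close>
  recovers the others by shrinking targets.\<close>

definition mo :: "'a hom_family \<Rightarrow> 'a set \<Rightarrow> ('a \<Rightarrow> 'a) \<Rightarrow> bool" where
  "mo F P f \<longleftrightarrow> restrict f P \<in> F P (carrier S)"

definition fam :: "('a set \<Rightarrow> ('a \<Rightarrow> 'a) \<Rightarrow> bool) \<Rightarrow> 'a hom_family" where
  "fam m P Q = {f \<in> extensional P. subgroup Q S \<and> f ` P \<subseteq> Q \<and> m P f}"

lemma conj_map_eq: "conj_map S x P = restrict (conj_by x) P"
  by (auto simp: conj_map_def conj_by_def restrict_def fun_eq_iff)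

lemma restrict_inv_into: "restrict (inv_into P (restrict f P)) (f ` P) = restrict (inv_into P f) (f ` P)"
proof (rule restrict_ext)
  fix y assume "y \<in> f ` P"
  have "(\<lambda>x. x \<in> P \<and> restrict f P x = y) = (\<lambda>x. x \<in> P \<and> f x = y)" by auto
  then show "inv_into P (restrict f P) y = inv_into P f y" by (simp add: inv_into_def)
qed

lemma fusion_systemD:
  assumes F: "fusion_system S F"
  shows "\<phi> \<in> F P Q \<Longrightarrow> subgroup P S" "\<phi> \<in> F P Q \<Longrightarrow> subgroup Q S"
    "\<phi> \<in> F P Q \<Longrightarrow> \<psi> \<in> F Q R \<Longrightarrow> compose P \<psi> \<phi> \<in> F P R"
    "subgroup P S \<Longrightarrow> subgroup Q S \<Longrightarrow> Hom_S S P Q \<subseteq> F P Q"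
    "\<phi> \<in> F P Q \<Longrightarrow> \<phi> \<in> Inj S P Q"
    "\<phi> \<in> F P Q \<Longrightarrow> \<exists>R. subgroup R S \<and> R \<subseteq> Q \<and> (\<exists>\<chi>\<in>isos F P R. \<phi> = compose P (\<lambda>x\<in>R. x) \<chi>)"
proof -
  note F' = F[unfolded fusion_system_def]
  note obj = F'[THEN conjunct1] and rest = F'[THEN conjunct2, THEN conjunct2]
  note comp = rest[THEN conjunct1] and hom = rest[THEN conjunct2, THEN conjunct1]
    and fac = rest[THEN conjunct2, THEN conjunct2]
  show 1: "\<phi> \<in> F P Q \<Longrightarrow> subgroup P S" and 2: "\<phi> \<in> F P Q \<Longrightarrow> subgroup Q S" using obj by auto
  show "\<phi> \<in> F P Q \<Longrightarrow> \<psi> \<in> F Q R \<Longrightarrow> compose P \<psi> \<phi> \<in> F P R" using comp by simp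
  show "subgroup P S \<Longrightarrow> subgroup Q S \<Longrightarrow> Hom_S S P Q \<subseteq> F P Q" using hom by simp
  show "\<phi> \<in> Inj S P Q" if "\<phi> \<in> F P Q" using hom 1[OF that] 2[OF that] that by auto
  show "\<exists>R. subgroup R S \<and> R \<subseteq> Q \<and> (\<exists>\<chi>\<in>isos F P R. \<phi> = compose P (\<lambda>x\<in>R. x) \<chi>)" if "\<phi> \<in> F P Q"
    using fac[rule_format, OF that] .
qed

lemma inclusion_mem:
  assumes F: "fusion_system S F" and R: "subgroup R S" "subgroup Q S" "R \<subseteq> Q"
  shows "(\<lambda>x\<in>R. x) \<in> F R Q"
proof -
  have "(\<lambda>x\<in>R. x) = conj_map S \<one> R"
    unfolding conj_map_eq using subgroup_in_carrier[OF R(1)] by (intro restrict_ext) simp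
  moreover have "conj_map S \<one> R ` R \<subseteq> Q"
    unfolding conj_map_eq using subgroup_in_carrier[OF R(1)] R(3) by auto
  ultimately have "(\<lambda>x\<in>R. x) \<in> Hom_S S R Q" unfolding Hom_S_def by blast
  then show ?thesis using fusion_systemD(4)[OF F R(1,2)] by blast
qed

lemma InjD:
  assumes "\<phi> \<in> Inj S P Q"
  shows "\<phi> \<in> extensional P" "inj_on \<phi> P" "\<And>x. x \<in> P \<Longrightarrow> \<phi> x \<in> Q"
    "\<And>x y. x \<in> P \<Longrightarrow> y \<in> P \<Longrightarrow> \<phi> (x \<otimes> y) = \<phi> x \<otimes> \<phi> y"
proof -
  have h: "\<phi> \<in> hom (S\<lparr>carrier := P\<rparr>) (S\<lparr>carrier := Q\<rparr>)" and i: "inj_on \<phi> P" and e: "\<phi> \<in> extensional P"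
    using assms by (auto simp: Inj_def mon_def)
  show "\<phi> \<in> extensional P" "inj_on \<phi> P" using e i .
  show "\<phi> x \<in> Q" if "x \<in> P" for x using hom_in_carrier[OF h, of x] that by simp
  show "\<phi> (x \<otimes> y) = \<phi> x \<otimes> \<phi> y" if "x \<in> P" "y \<in> P" for x y using hom_mult[OF h, of x y] that by simp
qed

text \<open>The isomorphism in the factorization of \<open>\<phi>\<close> has to be \<open>\<phi>\<close> itself, with its image as target.\<close>

lemma fusion_corestrict:
  assumes F: "fusion_system S F" and \<phi>: "\<phi> \<in> F P Q"
  shows "subgroup (\<phi> ` P) S" "\<phi> \<in> F P (\<phi> ` P)" "restrict (inv_into P \<phi>) (\<phi> ` P) \<in> F (\<phi> ` P) P"
proof -
  obtain R \<chi> where R: "subgroup R S" "\<chi> \<in> isos F P R" "\<phi> = compose P (\<lambda>x\<in>R. x) \<chi>"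
    using fusion_systemD(6)[OF F \<phi>] by blast
  obtain \<psi> where \<chi>: "\<chi> \<in> F P R" and \<psi>: "\<psi> \<in> F R P"
    "compose P \<psi> \<chi> = (\<lambda>x\<in>P. x)" "compose R \<chi> \<psi> = (\<lambda>x\<in>R. x)"
    using R(2) by (auto simp: isos_def)
  note \<chi>I = InjD[OF fusion_systemD(5)[OF F \<chi>]] and \<psi>I = InjD[OF fusion_systemD(5)[OF F \<psi>(1)]]
  have eq: "\<phi> = \<chi>"
    by (rule extensionalityI[of _ P]) (use \<chi>I in \<open>auto simp: R(3) compose_eq\<close>)
  have RP: "R = \<phi> ` P"
  proof (intro subset_antisym subsetI)
    fix y assume y: "y \<in> R"
    have "\<chi> (\<psi> y) = y" using fun_cong[OF \<psi>(3), of y] y by (simp add: compose_eq)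
    then show "y \<in> \<phi> ` P" using \<psi>I(3)[OF y] eq by force
  qed (use \<chi>I(3) eq in auto)
  show "subgroup (\<phi> ` P) S" "\<phi> \<in> F P (\<phi> ` P)" using R(1) \<chi> eq RP by auto
  have "restrict (inv_into P \<phi>) (\<phi> ` P) = \<psi>"
  proof (rule extensionalityI[of _ "\<phi> ` P"])
    fix y assume "y \<in> \<phi> ` P"
    then obtain x where x: "x \<in> P" "y = \<phi> x" by blast
    have "\<psi> (\<chi> x) = x" using fun_cong[OF \<psi>(2), of x] x by (simp add: compose_eq)
    then show "restrict (inv_into P \<phi>) (\<phi> ` P) y = \<psi> y"
      using x eq \<chi>I(2) by (simp add: inv_into_f_f)
  qed (use \<psi>I(1) RP in auto)
  then show "restrict (inv_into P \<phi>) (\<phi> ` P) \<in> F (\<phi> ` P) P" using \<psi>(1) RP by simp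
qed

lemma fusion_retarget:
  assumes F: "fusion_system S F" and \<phi>: "\<phi> \<in> F P Q" and R: "subgroup R S" "\<phi> ` P \<subseteq> R"
  shows "\<phi> \<in> F P R"
proof -
  note c = fusion_corestrict[OF F \<phi>]
  have "compose P (\<lambda>x\<in>\<phi> ` P. x) \<phi> \<in> F P R"
    using fusion_systemD(3)[OF F c(2) inclusion_mem[OF F c(1) R]] .
  moreover have "compose P (\<lambda>x\<in>\<phi> ` P. x) \<phi> = \<phi>"
    by (rule extensionalityI[of _ P]) (use InjD(1)[OF fusion_systemD(5)[OF F \<phi>]] in \<open>auto simp: compose_eq\<close>)
  ultimately show ?thesis by simp
qed

lemma mo_fus: assumes F: "fusion_system S F" shows "fus S p (mo F)"
proof (rule fus.intro[OF p_group_axioms], rule fus_axioms.intro)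
  fix P f g R x y
  show "mo F R (conj_by x)" if R: "subgroup R S" and x: "x \<in> carrier S"
  proof -
    have "conj_map S x R ` R \<subseteq> carrier S" unfolding conj_map_eq using x subgroup_in_carrier[OF R] by auto
    then have "conj_map S x R \<in> Hom_S S R (carrier S)" unfolding Hom_S_def using x by blast
    then show ?thesis
      using fusion_systemD(4)[OF F R subgroup_self] unfolding mo_def conj_map_eq by blast
  qed
  assume f: "mo F P f"
  then have f': "restrict f P \<in> F P (carrier S)" by (simp add: mo_def)
  note I = InjD[OF fusion_systemD(5)[OF F f']] 
  have im: "restrict f P ` P = f ` P" by simp
  note c = fusion_corestrict[OF F f', unfolded im]
  show P: "subgroup P S" using fusion_systemD(1)[OF F f'] .
  show "x \<in> P \<Longrightarrow> f x \<in> carrier S" using I(3)[of x] by simp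
  show "x \<in> P \<Longrightarrow> y \<in> P \<Longrightarrow> f (x \<otimes> y) = f x \<otimes> f y" using I(4)[of x y] P by (simp add: subgroup.m_closed)
  show "inj_on f P" using I(2) by (simp add: inj_on_def)
  show "mo F P g" if "\<And>x. x \<in> P \<Longrightarrow> f x = g x"
    using f' restrict_ext[of P f g] that by (simp add: mo_def)
  show "mo F R f" if R: "subgroup R S" "R \<subseteq> P"
  proof -
    have "compose R (restrict f P) (\<lambda>x\<in>R. x) \<in> F R (carrier S)"
      using fusion_systemD(3)[OF F inclusion_mem[OF F R(1) P R(2)] f'] .
    moreover have "compose R (restrict f P) (\<lambda>x\<in>R. x) = restrict f R"
      using R(2) by (auto simp: compose_def restrict_def fun_eq_iff)
    ultimately show ?thesis by (simp add: mo_def)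
  qed
  show "mo F P (g \<circ> f)" if g: "mo F (f ` P) g"
  proof -
    have "compose P (restrict g (f ` P)) (restrict f P) \<in> F P (carrier S)"
      by (rule fusion_systemD(3)[OF F c(2) g[unfolded mo_def]])
    moreover have "compose P (restrict g (f ` P)) (restrict f P) = restrict (g \<circ> f) P"
      by (auto simp: compose_def restrict_def fun_eq_iff)
    ultimately show ?thesis by (simp add: mo_def)
  qed
  show "mo F (f ` P) (inv_into P f)"
    unfolding mo_def
  proof (rule fusion_retarget[OF F, where Q = P])
    show "restrict (inv_into P f) (f ` P) \<in> F (f ` P) P" using c(3) unfolding restrict_inv_into .
    show "restrict (inv_into P f) (f ` P) ` f ` P \<subseteq> carrier S"
      using inv_into_into[of _ f P] subgroup_in_carrier[OF P] by auto
  qed (rule subgroup_self)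
qed

lemma fam_mo: assumes F: "fusion_system S F" shows "fam (mo F) = F"
proof (intro ext subset_antisym subsetI)
  fix P Q \<phi> assume \<phi>: "\<phi> \<in> F P Q"
  note I = InjD[OF fusion_systemD(5)[OF F \<phi>]]
  have Q: "subgroup Q S" using fusion_systemD(2)[OF F \<phi>] .
  have "\<phi> \<in> F P (carrier S)"
    using fusion_retarget[OF F \<phi> subgroup_self] I(3) subgroup_in_carrier[OF Q] by blast
  moreover have "restrict \<phi> P = \<phi>" using I(1) by (rule extensional_restrict)
  ultimately show "\<phi> \<in> fam (mo F) P Q" using I Q by (auto simp: fam_def mo_def)
next
  fix P Q \<phi> assume \<phi>: "\<phi> \<in> fam (mo F) P Q"
  then have "restrict \<phi> P = \<phi>" by (auto simp: fam_def extensional_restrict)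
  then show "\<phi> \<in> F P Q" using \<phi> fusion_retarget[OF F, of \<phi> P "carrier S" Q] by (auto simp: fam_def mo_def)
qed

lemma fam_mono: "(\<And>P f. m P f \<Longrightarrow> m' P f) \<Longrightarrow> fam m \<le> fam m'"
  by (auto simp: fam_def le_fun_def)

lemma mo_mono: "F \<le> F' \<Longrightarrow> mo F P f \<Longrightarrow> mo F' P f"
  by (auto simp: mo_def le_fun_def)

end

context fus
begin

lemma fam_conj_map:
  assumes "subgroup P S" "subgroup Q S" "x \<in> carrier S" "conj_map S x P ` P \<subseteq> Q"
  shows "conj_map S x P \<in> fam m P Q"
proof -
  have "m P (restrict (conj_by x) P)"
    by (rule mor_cong[OF mor_conj[OF assms(1,3)]]) simp
  then show ?thesis using assms by (auto simp: fam_def conj_map_eq)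
qed

lemma fam_isos: assumes "subgroup P S" and \<phi>: "\<phi> \<in> extensional P" "m P \<phi>"
  shows "\<phi> \<in> isos (fam m) P (\<phi> ` P)"
  unfolding isos_def
proof (intro CollectI conjI bexI)
  show "\<phi> \<in> fam m P (\<phi> ` P)" using \<phi> mor_image by (simp add: fam_def)
  let ?\<psi> = "restrict (inv_into P \<phi>) (\<phi> ` P)"
  have "m (\<phi> ` P) ?\<psi>" by (rule mor_cong[OF mor_inv[OF \<phi>(2)]]) simp
  then show "?\<psi> \<in> fam m (\<phi> ` P) P" using mor_inv_into[OF \<phi>(2)] assms(1) by (auto simp: fam_def)
  show "compose P ?\<psi> \<phi> = (\<lambda>x\<in>P. x)" "compose (\<phi> ` P) \<phi> ?\<psi> = (\<lambda>x\<in>\<phi> ` P. x)"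
    using mor_inv_into[OF \<phi>(2)] by (auto simp: compose_def fun_eq_iff)
qed

lemma fam_fusion: "fusion_system S (fam m)"
  unfolding fusion_system_def
proof (intro conjI allI impI ballI)
  fix P Q R
  show "subgroup P S" "subgroup Q S" if "fam m P Q \<noteq> {}" using that mor_subgroup by (auto simp: fam_def)
  show "(\<lambda>x\<in>P. x) \<in> fam m P P" if P: "subgroup P S"
    using mor_cong[OF mor_id[OF P], of "\<lambda>x\<in>P. x"] P by (auto simp: fam_def)
  fix \<phi> assume "\<phi> \<in> fam m P Q"
  then have \<phi>: "\<phi> \<in> extensional P" "subgroup Q S" "\<phi> ` P \<subseteq> Q" "m P \<phi>" by (auto simp: fam_def)
  {
    fix \<psi> assume "\<psi> \<in> fam m Q R"
    then have \<psi>: "subgroup R S" "\<psi> ` Q \<subseteq> R" "m Q \<psi>" by (auto simp: fam_def)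
    have "m P (compose P \<psi> \<phi>)"
      by (rule mor_cong[OF mor_comp'[OF \<phi>(4) \<psi>(3) \<phi>(3)]]) (simp add: compose_eq)
    moreover have "compose P \<psi> \<phi> ` P \<subseteq> R" using \<phi>(3) \<psi>(2) by (auto simp: compose_def)
    ultimately show "compose P \<psi> \<phi> \<in> fam m P R" using \<psi>(1) by (simp add: fam_def)
  }
  show "\<exists>R. subgroup R S \<and> R \<subseteq> Q \<and> (\<exists>\<chi>\<in>isos (fam m) P R. \<phi> = compose P (\<lambda>x\<in>R. x) \<chi>)"
  proof (intro exI[of _ "\<phi> ` P"] conjI bexI)
    show "subgroup (\<phi> ` P) S" using mor_image[OF \<phi>(4)] .
    show "\<phi> \<in> isos (fam m) P (\<phi> ` P)" using fam_isos[OF mor_subgroup[OF \<phi>(4)] \<phi>(1,4)] .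
    show "\<phi> = compose P (\<lambda>x\<in>\<phi> ` P. x) \<phi>"
      by (rule extensionalityI[of _ P]) (use \<phi> in \<open>auto simp: compose_eq\<close>)
  qed (use \<phi> in auto)
next
  fix P Q assume PQ: "subgroup P S \<and> subgroup Q S"
  show "Hom_S S P Q \<subseteq> fam m P Q" using PQ fam_conj_map by (auto simp: Hom_S_def)
  show "fam m P Q \<subseteq> Inj S P Q"
    using mor_inj mor_mult by (auto simp: fam_def Inj_def mon_def hom_def)
qed

lemma mo_fam: "mo (fam m) P f \<longleftrightarrow> m P f"
proof
  assume "mo (fam m) P f"
  then have "m P (restrict f P)" by (simp add: mo_def fam_def)
  then show "m P f" by (rule mor_cong) simp
next
  assume f: "m P f"
  then have "m P (restrict f P)" by (rule mor_cong) simp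
  then show "mo (fam m) P f" using mor_closed[OF f] subgroup_self by (auto simp: mo_def fam_def)
qed

lemma fam_auts: assumes P: "subgroup P S" shows "fam m P P = auts m P"
proof (intro subset_antisym subsetI)
  fix f assume "f \<in> fam m P P"
  then have f: "f \<in> extensional P" "f ` P \<subseteq> P" "m P f" by (auto simp: fam_def)
  have "f ` P = P" using finite_subgroup[OF P] f(2) mor_inj[OF f(3)] by (rule endo_inj_surj)
  then show "f \<in> auts m P" using f by (simp add: auts_def)
qed (use P in \<open>auto simp: fam_def auts_def\<close>)

lemma F_conjugate_fam: "F_conjugate (fam m) P P' \<longleftrightarrow> (\<exists>f. m P f \<and> P' = f ` P)"
proof
  assume "F_conjugate (fam m) P P'"
  then obtain \<phi> \<psi> where \<phi>: "\<phi> \<in> fam m P P'" and \<psi>: "\<psi> \<in> fam m P' P" "compose P' \<phi> \<psi> = (\<lambda>x\<in>P'. x)"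
    by (auto simp: F_conjugate_def isos_def)
  have "P' \<subseteq> \<phi> ` P"
  proof
    fix y assume y: "y \<in> P'"
    have "\<phi> (\<psi> y) = y" using fun_cong[OF \<psi>(2), of y] y by (simp add: compose_eq)
    moreover have "\<psi> y \<in> P" using \<psi>(1) y by (auto simp: fam_def)
    ultimately show "y \<in> \<phi> ` P" by force
  qed
  then show "\<exists>f. m P f \<and> P' = f ` P" using \<phi> by (auto simp: fam_def)
next
  assume "\<exists>f. m P f \<and> P' = f ` P"
  then obtain f where f: "m P f" "P' = f ` P" by blast
  have "m P (restrict f P)" by (rule mor_cong[OF f(1)]) simp
  then have "restrict f P \<in> isos (fam m) P (restrict f P ` P)"
    by (rule fam_isos[OF mor_subgroup[OF f(1)] restrict_extensional])
  moreover have "restrict f P ` P = P'" using f(2) by simp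
  ultimately show "F_conjugate (fam m) P P'" by (auto simp: F_conjugate_def)
qed

lemma normalizer_nrm: assumes P: "subgroup P S" shows "normalizer S P = nrm P"
proof -
  have "g <# P #> inv g = conj_by g ` P" for g
    by (auto simp: l_coset_def r_coset_def conj_by_def)
  then show ?thesis using subgroup.subset[OF P] by (auto simp: normalizer_def stabilizer_def nrm_def)
qed

lemma fully_cent_fam: assumes P: "subgroup P S" shows "fully_centralized S (fam m) P \<longleftrightarrow> fully_cent m P"
  using P by (auto simp: fully_centralized_def fully_cent_def F_conjugate_fam)

lemma fully_norm_fam: assumes P: "subgroup P S" shows "fully_normalized S (fam m) P \<longleftrightarrow> fully_norm m P"
  using P by (auto simp: fully_normalized_def fully_norm_def F_conjugate_fam normalizer_nrm mor_image)

lemma centric_fam: "centric S (fam m) P \<longleftrightarrow> cntr m P"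
proof -
  have "centralizer S P' = center S P' \<longleftrightarrow> cen P' \<subseteq> P'" if "subgroup P' S" for P'
    using subgroup.subset[OF that] by (auto simp: centralizer_def center_def)
  then have "(centralizer S (f ` P) = center S (f ` P)) = (cen (f ` P) \<subseteq> f ` P)" if "m P f" for f
    using mor_image[OF that] by blast
  then show ?thesis unfolding centric_def cntr_def F_conjugate_fam by blast
qed

lemma Hom_S_conj_auts: assumes P: "subgroup P S" shows "Hom_S S P P = conj_auts (nrm P) P"
proof (intro subset_antisym subsetI)
  fix f assume "f \<in> Hom_S S P P"
  then obtain x where x: "x \<in> carrier S" "f = restrict (conj_by x) P" "f ` P \<subseteq> P"
    by (auto simp: Hom_S_def conj_map_eq)
  then have "x \<in> nrm P" by (intro nrmI[OF P]) auto
  then show "f \<in> conj_auts (nrm P) P" using x by (auto simp: conj_auts_def)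
next
  fix f assume "f \<in> conj_auts (nrm P) P"
  then show "f \<in> Hom_S S P P" by (auto simp: Hom_S_def conj_map_eq conj_auts_def nrmD)
qed

lemma N_phi_eq: assumes f: "m P f" shows "N_phi S P f = Nphi P f"
proof -
  note P = mor_subgroup[OF f]
  have "(\<lambda>y\<in>f ` P. f (conj_map S g P (inv_into P f y))) \<in> Hom_S S (f ` P) (f ` P)
      \<longleftrightarrow> (\<exists>h\<in>carrier S. \<forall>x\<in>P. f (conj_by g x) = conj_by h (f x))" (is "?l \<in> _ \<longleftrightarrow> _") if g: "g \<in> nrm P" for g
  proof -
    have l: "?l (f x) = f (conj_by g x)" if "x \<in> P" for x using that by (simp add: mor_inv_into[OF f] conj_map_eq)
    have "?l = conj_map S h (f ` P) \<longleftrightarrow> (\<forall>x\<in>P. f (conj_by g x) = conj_by h (f x))" for h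
    proof
      assume "?l = conj_map S h (f ` P)"
      then show "\<forall>x\<in>P. f (conj_by g x) = conj_by h (f x)" using l by (metis conj_map_eq imageI restrict_apply')
    next
      assume "\<forall>x\<in>P. f (conj_by g x) = conj_by h (f x)"
      then show "?l = conj_map S h (f ` P)"
        by (intro extensionalityI[of _ "f ` P"]) (auto simp: conj_map_eq mor_inv_into[OF f])
    qed
    moreover have "?l ` f ` P \<subseteq> f ` P" using l nrmD(2)[OF g] by auto
    ultimately show ?thesis unfolding Hom_S_def by (simp only: mem_Collect_eq) metis
  qed
  then show ?thesis by (auto simp: N_phi_def Nphi_def normalizer_nrm[OF P])
qed

lemma Aut_F_group: assumes P: "subgroup P S"
  shows "group (Aut_F (fam m) P)" "carrier (Aut_F (fam m) P) = auts m P" "finite (carrier (Aut_F (fam m) P))"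
proof -
  interpret B: group "BijGroup P" by (rule group_BijGroup)
  show c: "carrier (Aut_F (fam m) P) = auts m P" by (simp add: Aut_F_def fam_auts[OF P])
  show "group (Aut_F (fam m) P)"
    unfolding Aut_F_def fam_auts[OF P] using B.subgroup_imp_group[OF auts_subgroup[OF P]] .
  show "finite (carrier (Aut_F (fam m) P))"
    unfolding c using finite_Bij[OF finite_subgroup[OF P]] auts_Bij finite_subset by blast
qed

lemma Sylow_fam: assumes P: "subgroup P S"
  shows "is_Sylow p (Aut_F (fam m) P) (Hom_S S P P) \<longleftrightarrow>
    card (conj_auts (nrm P) P) = p ^ multiplicity p (card (auts m P))"
proof -
  interpret B: group "BijGroup P" by (rule group_BijGroup)
  have "subgroup (conj_auts (nrm P) P) (Aut_F (fam m) P)"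
    unfolding Aut_F_def fam_auts[OF P]
    by (rule B.subgroup_incl[OF conj_auts_subgroup[OF P nrm_subgroup[OF P] subset_refl] auts_subgroup[OF P]
      conj_auts_le_auts[OF P subset_refl]])
  then show ?thesis using Aut_F_group(2)[OF P] by (simp add: is_Sylow_def Hom_S_conj_auts[OF P] order_def)
qed

lemma saturated_fam:
  "saturated p S (fam m) \<longleftrightarrow>
    (\<forall>P. fully_norm m P \<longrightarrow> fully_cent m P \<and> card (conj_auts (nrm P) P) = p ^ multiplicity p (card (auts m P))) \<and>
    (\<forall>P. extension_at m P)"
proof -
  have 1: "(subgroup P S \<and> fully_normalized S (fam m) P \<longrightarrow>
        fully_centralized S (fam m) P \<and> is_Sylow p (Aut_F (fam m) P) (Hom_S S P P)) \<longleftrightarrow>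
      (fully_norm m P \<longrightarrow> fully_cent m P \<and> card (conj_auts (nrm P) P) = p ^ multiplicity p (card (auts m P)))" for P
  proof (cases "subgroup P S")
    case True
    then show ?thesis by (simp add: fully_norm_fam fully_cent_fam Sylow_fam)
  next
    case False
    then show ?thesis by (simp add: fully_norm_def)
  qed
  have 2: "(\<forall>\<phi>\<in>fam m P (carrier S). fully_centralized S (fam m) (\<phi> ` P) \<longrightarrow>
        (\<exists>\<phi>'\<in>fam m (N_phi S P \<phi>) (carrier S). restrict \<phi>' P = \<phi>)) \<longleftrightarrow> extension_at m P" for P
  proof
    assume l: "\<forall>\<phi>\<in>fam m P (carrier S). fully_centralized S (fam m) (\<phi> ` P) \<longrightarrow>
        (\<exists>\<phi>'\<in>fam m (N_phi S P \<phi>) (carrier S). restrict \<phi>' P = \<phi>)"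
    show "extension_at m P"
      unfolding extension_at_def
    proof (intro allI impI)
      fix f assume f: "m P f" and fc: "fully_cent m (f ` P)"
      have f': "m P (restrict f P)" by (rule mor_cong[OF f]) simp
      have "restrict f P \<in> fam m P (carrier S)" using f' mor_closed[OF f] subgroup_self by (auto simp: fam_def)
      then obtain \<phi>' where \<phi>': "\<phi>' \<in> fam m (N_phi S P (restrict f P)) (carrier S)" "restrict \<phi>' P = restrict f P"
        using l fc fully_cent_fam[OF mor_image[OF f]] by auto
      have "N_phi S P (restrict f P) = Nphi P f"
      proof -
        have "\<And>g x. g \<in> nrm P \<Longrightarrow> x \<in> P \<Longrightarrow> conj_by g x \<in> P" by (rule nrmD(2))
        then have "Nphi P (restrict f P) = Nphi P f" by (auto simp: Nphi_def)
        then show ?thesis using N_phi_eq[OF f'] by simp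
      qed
      then have "m (Nphi P f) \<phi>'" using \<phi>'(1) by (auto simp: fam_def)
      moreover have "\<forall>x\<in>P. \<phi>' x = f x" using \<phi>'(2) by (metis restrict_apply')
      ultimately show "\<exists>f'. m (Nphi P f) f' \<and> (\<forall>x\<in>P. f' x = f x)" by blast
    qed
  next
    assume r: "extension_at m P"
    show "\<forall>\<phi>\<in>fam m P (carrier S). fully_centralized S (fam m) (\<phi> ` P) \<longrightarrow>
        (\<exists>\<phi>'\<in>fam m (N_phi S P \<phi>) (carrier S). restrict \<phi>' P = \<phi>)"
    proof (intro ballI impI)
      fix \<phi> assume \<phi>: "\<phi> \<in> fam m P (carrier S)" and fc: "fully_centralized S (fam m) (\<phi> ` P)"
      have m\<phi>: "m P \<phi>" and ext: "\<phi> \<in> extensional P" using \<phi> by (auto simp: fam_def)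
      then obtain f' where f': "m (Nphi P \<phi>) f'" "\<forall>x\<in>P. f' x = \<phi> x"
        using r fc fully_cent_fam[OF mor_image] by (auto simp: extension_at_def)
      let ?f = "restrict f' (Nphi P \<phi>)"
      have "m (Nphi P \<phi>) ?f" by (rule mor_cong[OF f'(1)]) simp
      then have "?f \<in> fam m (N_phi S P \<phi>) (carrier S)"
        unfolding N_phi_eq[OF m\<phi>] using mor_closed[OF f'(1)] subgroup_self by (auto simp: fam_def)
      moreover have "restrict ?f P = \<phi>"
        using Nphi_superset(1)[OF m\<phi>] f'(2) ext by (intro extensionalityI[of _ P]) auto
      ultimately show "\<exists>\<phi>'\<in>fam m (N_phi S P \<phi>) (carrier S). restrict \<phi>' P = \<phi>" by blast
    qed
  qed
  show ?thesis unfolding saturated_def using 1 2 fam_fusion by simp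
qed

lemma saturated_fam_sat: assumes "saturated p S (fam m)" shows "sat S p m"
proof (rule sat.intro[OF fus_axioms], rule sat_axioms.intro)
  show "extension_at m P" for P using assms by (simp add: saturated_fam)
  show "sylow_axiom m"
    unfolding sylow_axiom_def
  proof (intro allI impI conjI)
    fix P assume fn: "fully_norm m P"
    then show "fully_cent m P" using assms by (simp add: saturated_fam)
    have P: "subgroup P S" using fn by (simp add: fully_norm_def)
    let ?n = "card (auts m P)"
    have c: "card (conj_auts (nrm P) P) = p ^ multiplicity p ?n" using assms fn by (simp add: saturated_fam)
    have "?n > 0" using Aut_F_group[OF P] auts_id[OF P] by (auto simp: card_gt_0_iff)
    then obtain r where r: "?n = p ^ multiplicity p ?n * r" "\<not> p dvd r"
      using multiplicity_decompose'[of ?n p] prime_p by (metis gr_implies_not0 nat_dvd_1_iff_1 not_prime_1)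
    have "?n div p ^ multiplicity p ?n = r"
      using r(1) prime_gt_0_nat[OF prime_p] by (metis nonzero_mult_div_cancel_left power_not_zero not_gr_zero)
    then show "\<not> p dvd ?n div card (conj_auts (nrm P) P)" using r(2) c by simp
  qed
qed

text \<open>Elements of \<open>p\<close>-power order lie in \<open>O\<^sup>p\<^sup>'(Aut\<^sub>F(P))\<close>, and they generate it.\<close>

lemma O_p'_fam:
  assumes P: "subgroup P S" and M: "fus S p M" and le: "\<And>f. M P f \<Longrightarrow> m P f"
  shows "O_p' p (Aut_F (fam m) P) \<subseteq> carrier (Aut_F (fam M) P) \<longleftrightarrow> p_auts_in m M P"
proof -
  interpret M: fus S p M by fact
  interpret B: group "BijGroup P" by (rule group_BijGroup)
  let ?G = "Aut_F (fam m) P"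
  interpret G: group ?G by (rule Aut_F_group(1)[OF P])
  note Gc = Aut_F_group(2)[OF P] and fin = Aut_F_group(3)[OF P]
  have pow: "restrict f P [^]\<^bsub>?G\<^esub> n = restrict (f ^^ n) P" if "m P f" "f ` P = P" for f and n :: nat
  proof -
    have "restrict f P [^]\<^bsub>?G\<^esub> n = restrict f P [^]\<^bsub>BijGroup P\<^esub> n"
      unfolding Aut_F_def by (rule B.nat_pow_consistent[symmetric])
    then show ?thesis using BijGroup_pow(1)[OF that(2) mor_inj[OF that(1)]] by simp
  qed
  have one: "\<one>\<^bsub>?G\<^esub> = (\<lambda>x\<in>P. x)" by (simp add: Aut_F_def BijGroup_def)
  show ?thesis
  proof
    assume O: "O_p' p ?G \<subseteq> carrier (Aut_F (fam M) P)"
    show "p_auts_in m M P"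
      unfolding p_auts_in_def
    proof (intro allI impI)
      fix f k assume f: "m P f" "f ` P = P" and k: "\<forall>x\<in>P. (f ^^ (p ^ k)) x = x"
      have "restrict f P [^]\<^bsub>?G\<^esub> (p ^ k) = \<one>\<^bsub>?G\<^esub>"
        unfolding pow[OF f] one using k by (intro restrict_ext) auto
      then have "restrict f P \<in> O_p' p ?G"
        using G.p_element_in_O_p'[OF fin prime_p] restrict_auts[OF f] Gc by blast
      then have "restrict f P \<in> auts M P" using O M.Aut_F_group(2)[OF P] by blast
      then have "M P (restrict f P)" by (simp add: auts_def)
      then show "M P f" by (rule M.mor_cong) simp
    qed
  next
    assume pM: "p_auts_in m M P"
    have sub: "subgroup (auts M P) ?G"
      unfolding Aut_F_def fam_auts[OF P]
      by (rule B.subgroup_incl[OF M.auts_subgroup[OF P] auts_subgroup[OF P]]) (use le in \<open>auto simp: auts_def\<close>)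
    have "{x \<in> carrier ?G. \<exists>k. x [^]\<^bsub>?G\<^esub> (p ^ k :: nat) = \<one>\<^bsub>?G\<^esub>} \<subseteq> auts M P"
    proof
      fix x assume "x \<in> {x \<in> carrier ?G. \<exists>k. x [^]\<^bsub>?G\<^esub> (p ^ k :: nat) = \<one>\<^bsub>?G\<^esub>}"
      then obtain k where x: "x \<in> auts m P" and k: "x [^]\<^bsub>?G\<^esub> (p ^ k :: nat) = \<one>\<^bsub>?G\<^esub>" using Gc by blast
      have mx: "m P x" "x ` P = P" "x \<in> extensional P" using x by (auto simp: auts_def)
      have rx: "restrict x P = x" using mx(3) by (rule extensional_restrict)
      have "restrict (x ^^ (p ^ k)) P = (\<lambda>x\<in>P. x)" using pow[OF mx(1,2), of "p ^ k"] k one rx by simp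
      then have "\<forall>y\<in>P. (x ^^ (p ^ k)) y = y" by (metis restrict_apply')
      then have "M P x" using pM mx unfolding p_auts_in_def by blast
      then show "x \<in> auts M P" using mx by (simp add: auts_def)
    qed
    then have "generate ?G {x \<in> carrier ?G. \<exists>k. x [^]\<^bsub>?G\<^esub> (p ^ k :: nat) = \<one>\<^bsub>?G\<^esub>} \<subseteq> auts M P"
      using G.generate_subgroup_incl[OF _ sub] by blast
    then show "O_p' p ?G \<subseteq> carrier (Aut_F (fam M) P)"
      using G.O_p'_le_generate[OF fin prime_p] M.Aut_F_group(2)[OF P] by blast
  qed
qed

lemma fam_le_iff: assumes "fus S p M" shows "fam M \<le> fam m \<longleftrightarrow> (\<forall>P f. M P f \<longrightarrow> m P f)"
proof
  interpret M: fus S p M by fact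
  assume "fam M \<le> fam m"
  then show "\<forall>P f. M P f \<longrightarrow> m P f" using mo_mono[of "fam M" "fam m"] mo_fam M.mo_fam by blast
qed (use fam_mono in blast)

end

context sat
begin

lemma O_star_fam: "O_star p S (fam m) = fam O_rel"
proof (rule antisym)
  interpret O: fus S p O_rel by (rule O_rel_fus)
  have "O_p' p (Aut_F (fam m) P) \<subseteq> carrier (Aut_F (fam O_rel) P)" if "subgroup P S" for P
    using O_p'_fam[OF that O_rel_fus O_rel_le] p_auts_O_rel by blast
  moreover have "fam O_rel \<le> fam m" by (rule fam_mono) (rule O_rel_le)
  ultimately show "O_star p S (fam m) \<le> fam O_rel"
    unfolding O_star_def using O.fam_fusion by (intro Inf_lower) blast
  show "fam O_rel \<le> O_star p S (fam m)"
    unfolding O_star_def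
  proof (rule Inf_greatest)
    fix F' assume "F' \<in> {F'. fusion_system S F' \<and> F' \<le> fam m \<and>
      (\<forall>P. subgroup P S \<longrightarrow> O_p' p (Aut_F (fam m) P) \<subseteq> carrier (Aut_F F' P))}"
    then have F': "fusion_system S F'" "F' \<le> fam m"
      and O: "\<And>P. subgroup P S \<Longrightarrow> O_p' p (Aut_F (fam m) P) \<subseteq> carrier (Aut_F F' P)" by auto
    have fm: "fam (mo F') = F'" by (rule fam_mo[OF F'(1)])
    have M: "fus S p (mo F')" by (rule mo_fus[OF F'(1)])
    have le: "mo F' P f \<Longrightarrow> m P f" for P f using mo_mono[OF F'(2)] mo_fam by blast
    have "p_auts_in m (mo F') P" for P
    proof (cases "subgroup P S")
      case True
      then show ?thesis using O_p'_fam[OF True M le] O fm by simp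
    next
      case False
      then show ?thesis using mor_subgroup by (auto simp: p_auts_in_def)
    qed
    then have "fam O_rel \<le> fam (mo F')" using O_rel_least[OF M] by (intro fam_mono) blast
    then show "fam O_rel \<le> F'" using fm by simp
  qed
qed

lemma index_prime_to_p_fam:
  assumes M: "fus S p M"
  shows "index_prime_to_p p S (fam m) (fam M) \<longleftrightarrow>
    saturated p S (fam M) \<and> (\<forall>P f. M P f \<longrightarrow> m P f) \<and> (\<forall>P. p_auts_in m M P)"
proof -
  have "(\<forall>P. subgroup P S \<longrightarrow> O_p' p (Aut_F (fam m) P) \<subseteq> carrier (Aut_F (fam M) P)) \<longleftrightarrow> (\<forall>P. p_auts_in m M P)"
    if le: "\<forall>P f. M P f \<longrightarrow> m P f"
  proof -
    have "p_auts_in m M P" if "\<not> subgroup P S" for P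
      using mor_subgroup that by (auto simp: p_auts_in_def)
    then show ?thesis using O_p'_fam[OF _ M] le by blast
  qed
  then show ?thesis unfolding index_prime_to_p_def fam_le_iff[OF M] by blast
qed

end

section \<open>The group \<open>\<Gamma>\<^sub>p\<^sub>'(F)\<close>\<close>

context sat
begin

abbreviation "AutG \<equiv> Aut_F (fam m) (carrier S)"
abbreviation "OutG \<equiv> Out_F S (fam m) (carrier S)"
abbreviation "Gam \<equiv> Gamma_p' p S (fam m)"
abbreviation "InnS \<equiv> Inn S (carrier S)"
abbreviation "Out0G \<equiv> Out0 p S (fam m)"
abbreviation "rs f \<equiv> restrict f (carrier S)"

definition cls :: "('a \<Rightarrow> 'a) \<Rightarrow> ('a \<Rightarrow> 'a) set set" where
  "cls \<alpha> = Gamma_class p S (fam m) (rs \<alpha>)"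

lemma AutG: "group AutG" "carrier AutG = auts m (carrier S)"
  by (rule Aut_F_group[OF subgroup_self])+

lemma rs_AutG: "m (carrier S) \<alpha> \<Longrightarrow> rs \<alpha> \<in> carrier AutG"
  using restrict_auts[of "carrier S" \<alpha>] mor_carrier_image[of \<alpha>] AutG(2) by simp

lemma AutG_mor: "a \<in> carrier AutG \<Longrightarrow> m (carrier S) a" "a \<in> carrier AutG \<Longrightarrow> rs a = a"
  unfolding AutG(2) by (simp_all add: auts_def extensional_restrict)

lemma AutG_mult:
  assumes "m (carrier S) \<alpha>" "m (carrier S) \<beta>"
  shows "rs \<beta> \<otimes>\<^bsub>AutG\<^esub> rs \<alpha> = rs (\<lambda>x. \<beta> (\<alpha> x))"
proof -
  have "rs \<beta> \<in> Bij (carrier S)" "rs \<alpha> \<in> Bij (carrier S)"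
    using rs_AutG[OF assms(1)] rs_AutG[OF assms(2)] auts_Bij unfolding AutG(2) by blast+
  then have "rs \<beta> \<otimes>\<^bsub>AutG\<^esub> rs \<alpha> = compose (carrier S) (rs \<beta>) (rs \<alpha>)" by (simp add: Aut_F_def BijGroup_mult)
  also have "\<dots> = rs (\<lambda>x. \<beta> (\<alpha> x))"
    using mor_closed[OF assms(1)] by (auto simp: compose_def fun_eq_iff)
  finally show ?thesis .
qed

lemma AutG_one: "\<one>\<^bsub>AutG\<^esub> = rs (\<lambda>x. x)"
  by (simp add: Aut_F_def BijGroup_def)

lemma AutG_inv: assumes "m (carrier S) \<alpha>" shows "inv\<^bsub>AutG\<^esub> (rs \<alpha>) = rs (inv_into (carrier S) \<alpha>)"
proof -
  interpret G: group AutG by (rule AutG(1))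
  note i = aut_inv_mor[OF assms]
  have "rs (inv_into (carrier S) \<alpha>) \<otimes>\<^bsub>AutG\<^esub> rs \<alpha> = \<one>\<^bsub>AutG\<^esub>"
    unfolding AutG_mult[OF assms i] AutG_one by (rule restrict_ext) (rule aut_inv(1)[OF assms])
  then show ?thesis using G.inv_equality rs_AutG[OF assms] rs_AutG[OF i] by blast
qed

lemma Inn_conj_auts: "InnS = conj_auts (carrier S) (carrier S)"
  by (auto simp: Inn_def conj_auts_def conj_map_eq)

lemma nrm_carrier: "nrm (carrier S) = carrier S"
  using subgroup_le_nrm[OF subgroup_self] by (auto simp: nrm_def)

lemma Inn_normal: "InnS \<lhd> AutG"
proof -
  interpret B: group "BijGroup (carrier S)" by (rule group_BijGroup)
  interpret G: group AutG by (rule AutG(1))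
  have "subgroup InnS AutG"
    unfolding Aut_F_def fam_auts[OF subgroup_self] Inn_conj_auts
    using subgroup_self nrm_carrier
    by (intro B.subgroup_incl conj_auts_subgroup auts_subgroup conj_auts_le_auts) auto
  then show ?thesis
  proof (rule G.normal_invI)
    fix a h assume a: "a \<in> carrier AutG" and h: "h \<in> InnS"
    obtain g where g: "g \<in> carrier S" "h = rs (conj_by g)" using h by (auto simp: Inn_conj_auts conj_auts_def)
    note am = AutG_mor[OF a]
    note ag = mor_closed[OF am(1) g(1)]
    have cg: "m (carrier S) (conj_by g)" "m (carrier S) (conj_by (a g))"
      using mor_conj[OF subgroup_self] g(1) ag by auto
    have "a \<otimes>\<^bsub>AutG\<^esub> h = rs a \<otimes>\<^bsub>AutG\<^esub> rs (conj_by g)" by (simp only: am(2) g(2))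
    also have "\<dots> = rs (\<lambda>x. a (conj_by g x))" by (rule AutG_mult[OF cg(1) am(1)])
    also have "\<dots> = rs (\<lambda>x. conj_by (a g) (a x))"
      by (rule restrict_ext) (rule mor_conj_by[OF am(1) g(1)])
    also have "\<dots> = rs (conj_by (a g)) \<otimes>\<^bsub>AutG\<^esub> rs a" by (rule AutG_mult[OF am(1) cg(2), symmetric])
    finally have eq: "a \<otimes>\<^bsub>AutG\<^esub> h = rs (conj_by (a g)) \<otimes>\<^bsub>AutG\<^esub> a" by (simp only: am(2))
    have "a \<otimes>\<^bsub>AutG\<^esub> h \<otimes>\<^bsub>AutG\<^esub> inv\<^bsub>AutG\<^esub> a = rs (conj_by (a g))"
      unfolding eq using a rs_AutG[OF cg(2)] G.m_assoc G.r_inv G.r_one G.inv_closed by presburger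
    then show "a \<otimes>\<^bsub>AutG\<^esub> h \<otimes>\<^bsub>AutG\<^esub> inv\<^bsub>AutG\<^esub> a \<in> InnS"
      using ag by (auto simp: Inn_conj_auts conj_auts_def)
  qed
qed

lemma OutG: "group OutG" "(\<lambda>a. InnS #>\<^bsub>AutG\<^esub> a) \<in> hom AutG OutG"
    "carrier OutG = (\<lambda>a. InnS #>\<^bsub>AutG\<^esub> a) ` carrier AutG"
  unfolding Out_F_def
  using normal.factorgroup_is_group[OF Inn_normal] normal.r_coset_hom_Mod[OF Inn_normal] carrier_FactGroup by auto

definition out0_gens :: "('a \<Rightarrow> 'a) set set" where
  "out0_gens = {InnS #>\<^bsub>AutG\<^esub> a | a. a \<in> carrier AutG \<and> (\<exists>P. cntr m P \<and> O_rel P a)}"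

lemma restrict_O_star: assumes "subgroup P S" shows "restrict \<alpha> P \<in> O_star p S (fam m) P (carrier S) \<longleftrightarrow> O_rel P \<alpha>"
proof -
  interpret O: fus S p O_rel by (rule O_rel_fus)
  show ?thesis using O.mo_fam[of P \<alpha>] unfolding O_star_fam mo_def .
qed

lemma Out0_generate: "Out0G = generate OutG out0_gens"
proof -
  interpret G: group AutG by (rule AutG(1))
  interpret N: normal InnS AutG by (rule Inn_normal)
  have "{a \<in> carrier OutG. \<exists>\<alpha>\<in>a. \<exists>P. centric S (fam m) P \<and> restrict \<alpha> P \<in> O_star p S (fam m) P (carrier S)} = out0_gens"
  proof (intro subset_antisym subsetI)
    fix a assume "a \<in> {a \<in> carrier OutG. \<exists>\<alpha>\<in>a. \<exists>P. centric S (fam m) P \<and> restrict \<alpha> P \<in> O_star p S (fam m) P (carrier S)}"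
    then obtain \<alpha> P b where b: "b \<in> carrier AutG" "a = InnS #>\<^bsub>AutG\<^esub> b" and \<alpha>: "\<alpha> \<in> a"
      and P: "cntr m P" "restrict \<alpha> P \<in> O_star p S (fam m) P (carrier S)"
      unfolding OutG(3) centric_fam by blast
    have P': "subgroup P S" using P(1) by (simp add: cntr_def)
    have \<alpha>c: "\<alpha> \<in> carrier AutG" using \<alpha> b G.r_coset_subset_G[OF N.subset] by blast
    have "a = InnS #>\<^bsub>AutG\<^esub> \<alpha>" using G.repr_independence[OF _ _ N.subgroup_axioms, of \<alpha> b] \<alpha> b by blast
    then show "a \<in> out0_gens" using \<alpha>c P restrict_O_star[OF P'] unfolding out0_gens_def by blast
  next
    fix a assume "a \<in> out0_gens"
    then obtain \<alpha> P where \<alpha>: "\<alpha> \<in> carrier AutG" "a = InnS #>\<^bsub>AutG\<^esub> \<alpha>" and P: "cntr m P" "O_rel P \<alpha>"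
      unfolding out0_gens_def by blast
    have P': "subgroup P S" using P(1) by (simp add: cntr_def)
    have "a \<in> carrier OutG" using \<alpha> unfolding OutG(3) by blast
    moreover have "\<alpha> \<in> a" using G.rcos_self[OF \<alpha>(1) N.subgroup_axioms] \<alpha>(2) by simp
    ultimately show "a \<in> {a \<in> carrier OutG. \<exists>\<alpha>\<in>a. \<exists>P. centric S (fam m) P \<and> restrict \<alpha> P \<in> O_star p S (fam m) P (carrier S)}"
      using P restrict_O_star[OF P'] centric_fam by blast
  qed
  then show ?thesis by (simp add: Out0_def)
qed

text \<open>The generators are closed under conjugation: that of \<open>\<alpha>\<close> by \<open>\<beta>\<close> is \<open>twist \<beta> \<alpha>\<close>, which is in \<open>O_rel\<close> on
  the image of \<open>P\<close> under \<open>\<beta>\<close>.\<close>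

lemma Out0_normal: "Out0G \<lhd> OutG"
proof -
  interpret O: fus S p O_rel by (rule O_rel_fus)
  interpret Q: group OutG by (rule OutG(1))
  interpret G: group AutG by (rule AutG(1))
  interpret h: group_hom AutG OutG "\<lambda>a. InnS #>\<^bsub>AutG\<^esub> a"
    using OutG(2) by unfold_locales
  show ?thesis
    unfolding Out0_generate
  proof (rule Q.normal_generateI)
    show "out0_gens \<subseteq> carrier OutG" unfolding out0_gens_def OutG(3) by blast
    fix b c assume "b \<in> out0_gens" "c \<in> carrier OutG"
    then obtain \<alpha> P \<beta> where \<alpha>: "\<alpha> \<in> carrier AutG" "b = InnS #>\<^bsub>AutG\<^esub> \<alpha>" and P: "cntr m P" "O_rel P \<alpha>"
      and \<beta>: "\<beta> \<in> carrier AutG" "c = InnS #>\<^bsub>AutG\<^esub> \<beta>"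
      unfolding out0_gens_def OutG(3) by blast
    note am = AutG_mor[OF \<alpha>(1)] and bm = AutG_mor[OF \<beta>(1)]
    let ?t = "\<beta> \<otimes>\<^bsub>AutG\<^esub> \<alpha> \<otimes>\<^bsub>AutG\<^esub> inv\<^bsub>AutG\<^esub> \<beta>"
    have t: "?t \<in> carrier AutG" using \<alpha>(1) \<beta>(1) by simp
    have eq: "c \<otimes>\<^bsub>OutG\<^esub> b \<otimes>\<^bsub>OutG\<^esub> inv\<^bsub>OutG\<^esub> c = InnS #>\<^bsub>AutG\<^esub> ?t"
      using \<alpha> \<beta> by (simp add: h.hom_mult h.hom_inv)
    have ba: "m (carrier S) (\<lambda>x. \<beta> (\<alpha> x))" using mor_comp[OF am(1)] bm(1) mor_carrier_image[OF am(1)] by simp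
    have "?t = rs \<beta> \<otimes>\<^bsub>AutG\<^esub> rs \<alpha> \<otimes>\<^bsub>AutG\<^esub> inv\<^bsub>AutG\<^esub> rs \<beta>" by (simp only: am(2) bm(2))
    also have "\<dots> = rs (\<lambda>x. \<beta> (\<alpha> x)) \<otimes>\<^bsub>AutG\<^esub> rs (inv_into (carrier S) \<beta>)"
      by (simp only: AutG_mult[OF am(1) bm(1)] AutG_inv[OF bm(1)])
    also have "\<dots> = rs (\<lambda>x. \<beta> (\<alpha> (inv_into (carrier S) \<beta> x)))"
      by (rule AutG_mult[OF aut_inv_mor[OF bm(1)] ba])
    finally have tw: "?t = rs (twist \<beta> \<alpha>)" unfolding twist_def .
    have Ps: "subgroup P S" using P(1) by (simp add: cntr_def)
    have "O_rel (\<beta> ` P) (twist \<beta> \<alpha>)" using O_rel_invariant bm(1) P(2) by (auto simp: invariant_def)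
    then have "O_rel (\<beta> ` P) ?t"
      unfolding tw by (rule O.mor_cong) (use mor_closed[OF aut_restrict[OF bm(1) Ps]] in auto)
    moreover have "cntr m (\<beta> ` P)" using cntr_image[OF P(1) aut_restrict[OF bm(1) Ps]] .
    ultimately show "c \<otimes>\<^bsub>OutG\<^esub> b \<otimes>\<^bsub>OutG\<^esub> inv\<^bsub>OutG\<^esub> c \<in> out0_gens"
      unfolding eq out0_gens_def using t by blast
  qed
qed

lemma Gam: "group Gam" and class_hom: "(\<lambda>a. Gamma_class p S (fam m) a) \<in> hom AutG Gam"
  and Gam_carrier: "carrier Gam = Gamma_class p S (fam m) ` carrier AutG"
proof -
  interpret N: normal Out0G OutG by (rule Out0_normal)
  show "group Gam" unfolding Gamma_p'_def by (rule N.factorgroup_is_group)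
  have "(\<lambda>a. Out0G #>\<^bsub>OutG\<^esub> a) \<circ> (\<lambda>a. InnS #>\<^bsub>AutG\<^esub> a) \<in> hom AutG Gam"
    unfolding Gamma_p'_def by (rule Group.hom_compose[OF OutG(2) N.r_coset_hom_Mod])
  then show "(\<lambda>a. Gamma_class p S (fam m) a) \<in> hom AutG Gam" by (simp add: Gamma_class_def comp_def)
  show "carrier Gam = Gamma_class p S (fam m) ` carrier AutG"
    unfolding Gamma_p'_def carrier_FactGroup OutG(3) image_image Gamma_class_def ..
qed

lemma cls_closed: "m (carrier S) \<alpha> \<Longrightarrow> cls \<alpha> \<in> carrier Gam"
  unfolding cls_def Gam_carrier using rs_AutG by blast

lemma cls_mult:
  "m (carrier S) \<alpha> \<Longrightarrow> m (carrier S) \<beta> \<Longrightarrow> cls (\<lambda>x. \<beta> (\<alpha> x)) = cls \<beta> \<otimes>\<^bsub>Gam\<^esub> cls \<alpha>"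
  unfolding cls_def using hom_mult[OF class_hom rs_AutG rs_AutG, of \<beta> \<alpha>] AutG_mult[of \<alpha> \<beta>] by simp

lemma cls_one: "cls (\<lambda>x. x) = \<one>\<^bsub>Gam\<^esub>"
proof -
  interpret h: group_hom AutG Gam "Gamma_class p S (fam m)"
    using AutG(1) Gam class_hom by (simp add: group_hom_def group_hom_axioms_def)
  show ?thesis unfolding cls_def using h.hom_one AutG_one by simp
qed

lemma cls_cong: "(\<And>x. x \<in> carrier S \<Longrightarrow> \<alpha> x = \<beta> x) \<Longrightarrow> cls \<alpha> = cls \<beta>"
  unfolding cls_def using restrict_ext[of "carrier S" \<alpha> \<beta>] by simp

lemma cls_inv: assumes "m (carrier S) \<alpha>" shows "cls (inv_into (carrier S) \<alpha>) = inv\<^bsub>Gam\<^esub> cls \<alpha>"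
proof -
  interpret h: group_hom AutG Gam "Gamma_class p S (fam m)"
    using AutG(1) Gam class_hom by (simp add: group_hom_def group_hom_axioms_def)
  show ?thesis unfolding cls_def using h.hom_inv[OF rs_AutG[OF assms]] AutG_inv[OF assms] by simp
qed

lemma cls_onto: assumes "\<gamma> \<in> carrier Gam" obtains \<alpha> where "m (carrier S) \<alpha>" "\<gamma> = cls \<alpha>"
proof -
  obtain a where a: "a \<in> carrier AutG" "\<gamma> = Gamma_class p S (fam m) a" using assms unfolding Gam_carrier by blast
  show ?thesis using that[OF AutG_mor(1)[OF a(1)]] a(2) AutG_mor(2)[OF a(1)] by (simp add: cls_def)
qed

lemma class_one_iff: "m (carrier S) \<alpha> \<Longrightarrow> cls \<alpha> = \<one>\<^bsub>Gam\<^esub> \<longleftrightarrow> InnS #>\<^bsub>AutG\<^esub> rs \<alpha> \<in> Out0G"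
proof -
  interpret N: normal Out0G OutG by (rule Out0_normal)
  assume \<alpha>: "m (carrier S) \<alpha>"
  have c: "InnS #>\<^bsub>AutG\<^esub> rs \<alpha> \<in> carrier OutG" using rs_AutG[OF \<alpha>] unfolding OutG(3) by blast
  have one: "\<one>\<^bsub>Gam\<^esub> = Out0G" by (simp add: Gamma_p'_def)
  show "cls \<alpha> = \<one>\<^bsub>Gam\<^esub> \<longleftrightarrow> InnS #>\<^bsub>AutG\<^esub> rs \<alpha> \<in> Out0G"
    unfolding cls_def Gamma_class_def one
    using N.coset_join1[OF _ c N.subgroup_axioms] N.coset_join2[OF c N.subgroup_axioms] by blast
qed

lemma cls_trivial: assumes \<alpha>: "m (carrier S) \<alpha>" and P: "cntr m P" "O_rel P \<alpha>" shows "cls \<alpha> = \<one>\<^bsub>Gam\<^esub>"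
proof -
  have Ps: "subgroup P S" using P(1) by (simp add: cntr_def)
  interpret O: fus S p O_rel by (rule O_rel_fus)
  have "O_rel P (rs \<alpha>)"
    by (rule O.mor_cong[OF P(2)]) (use subgroup_in_carrier[OF Ps] in auto)
  then have "InnS #>\<^bsub>AutG\<^esub> rs \<alpha> \<in> out0_gens" unfolding out0_gens_def using rs_AutG[OF \<alpha>] P(1) by blast
  then show ?thesis unfolding class_one_iff[OF \<alpha>] Out0_generate by (rule generate.incl)
qed

text \<open>Inner automorphisms and the generators of \<open>Out\<^sup>0\<^sub>F(S)\<close> come from \<open>A\<close>, hence so does everything
  that becomes trivial in \<open>\<Gamma>\<^sub>p\<^sub>'(F)\<close>. Equality can hold only on the carrier, as \<open>\<alpha>\<close> is arbitrary
  elsewhere.\<close>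

lemma cls_kernel:
  assumes A: "prime_index S p m A" and \<alpha>: "m (carrier S) \<alpha>" and one: "cls \<alpha> = \<one>\<^bsub>Gam\<^esub>"
  shows "\<exists>\<beta>\<in>A. \<forall>x\<in>carrier S. \<alpha> x = \<beta> x"
proof -
  interpret A: prime_index S p m A by fact
  interpret G: group AutG by (rule AutG(1))
  interpret N: normal InnS AutG by (rule Inn_normal)
  interpret Q: group OutG by (rule OutG(1))
  interpret h: group_hom AutG OutG "\<lambda>a. InnS #>\<^bsub>AutG\<^esub> a"
    using OutG(2) by unfold_locales
  let ?A = "rs ` A"
  have sub: "subgroup ?A AutG"
  proof (rule subgroup.intro)
    show "?A \<subseteq> carrier AutG" using rs_AutG A.A_mor by blast
    show "\<one>\<^bsub>AutG\<^esub> \<in> ?A" using AutG_one A.aut_group_A by (auto simp: aut_group_def)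
    fix a b assume "a \<in> ?A"
    then obtain \<beta> where \<beta>: "\<beta> \<in> A" "a = rs \<beta>" by blast
    have "inv_into (carrier S) \<beta> \<in> A" using A.aut_group_A \<beta>(1) by (auto simp: aut_group_def)
    then show "inv\<^bsub>AutG\<^esub> a \<in> ?A" unfolding \<beta>(2) AutG_inv[OF A.A_mor[OF \<beta>(1)]] by blast
    assume "b \<in> ?A"
    then obtain \<gamma> where \<gamma>: "\<gamma> \<in> A" "b = rs \<gamma>" by blast
    have "(\<lambda>x. \<beta> (\<gamma> x)) \<in> A" using A.aut_group_A \<beta>(1) \<gamma>(1) by (auto simp: aut_group_def)
    then show "a \<otimes>\<^bsub>AutG\<^esub> b \<in> ?A"
      unfolding \<beta>(2) \<gamma>(2) AutG_mult[OF A.A_mor[OF \<gamma>(1)] A.A_mor[OF \<beta>(1)]] by blast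
  qed
  have Inn: "InnS \<subseteq> ?A"
  proof
    fix h assume "h \<in> InnS"
    then obtain g where g: "g \<in> carrier S" "h = rs (conj_by g)" by (auto simp: Inn_conj_auts conj_auts_def)
    have "conj_by g \<in> A"
      by (rule A.A_contains[OF mor_conj[OF subgroup_self g(1)] cntr_carrier fus.mor_conj[OF O_rel_fus, OF subgroup_self g(1)]])
    then show "h \<in> ?A" using g(2) by blast
  qed
  have coset: "InnS #>\<^bsub>AutG\<^esub> a \<subseteq> ?A" if "a \<in> ?A" for a
    using that Inn subgroup.m_closed[OF sub] unfolding r_coset_def by blast
  have gens: "\<exists>a\<in>?A. b = InnS #>\<^bsub>AutG\<^esub> a" if "b \<in> generate OutG out0_gens" for b
    using that
  proof (induction rule: generate.induct)
    case one
    have "\<one>\<^bsub>OutG\<^esub> = InnS #>\<^bsub>AutG\<^esub> \<one>\<^bsub>AutG\<^esub>" using h.hom_one by simp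
    then show ?case using subgroup.one_closed[OF sub] by blast
  next
    case (incl b)
    then obtain a P where a: "a \<in> carrier AutG" "b = InnS #>\<^bsub>AutG\<^esub> a" "cntr m P" "O_rel P a"
      unfolding out0_gens_def by blast
    have "a \<in> A" using A.A_contains[OF AutG_mor(1)[OF a(1)] a(3,4)] .
    then have "a \<in> ?A" using AutG_mor(2)[OF a(1)] by (metis imageI)
    then show ?case using a(2) by blast
  next
    case (inv b)
    then obtain a P where a: "a \<in> carrier AutG" "b = InnS #>\<^bsub>AutG\<^esub> a" "cntr m P" "O_rel P a"
      unfolding out0_gens_def by blast
    have "a \<in> A" using A.A_contains[OF AutG_mor(1)[OF a(1)] a(3,4)] .
    then have "inv\<^bsub>AutG\<^esub> a \<in> ?A" using AutG_mor(2)[OF a(1)] subgroup.m_inv_closed[OF sub] by (metis imageI)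
    moreover have "inv\<^bsub>OutG\<^esub> b = InnS #>\<^bsub>AutG\<^esub> inv\<^bsub>AutG\<^esub> a" using a(1,2) h.hom_inv by simp
    ultimately show ?case by blast
  next
    case (eng b c)
    then obtain a d where ad: "a \<in> ?A" "b = InnS #>\<^bsub>AutG\<^esub> a" "d \<in> ?A" "c = InnS #>\<^bsub>AutG\<^esub> d" by blast
    have "a \<in> carrier AutG" "d \<in> carrier AutG" using ad subgroup.mem_carrier[OF sub] by auto
    then have "b \<otimes>\<^bsub>OutG\<^esub> c = InnS #>\<^bsub>AutG\<^esub> (a \<otimes>\<^bsub>AutG\<^esub> d)" using ad h.hom_mult by simp
    then show ?case using subgroup.m_closed[OF sub ad(1,3)] by blast
  qed
  have "InnS #>\<^bsub>AutG\<^esub> rs \<alpha> \<in> generate OutG out0_gens"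
    using one class_one_iff[OF \<alpha>] Out0_generate by simp
  then obtain a where a: "a \<in> ?A" "InnS #>\<^bsub>AutG\<^esub> rs \<alpha> = InnS #>\<^bsub>AutG\<^esub> a" using gens by blast
  have "rs \<alpha> \<in> InnS #>\<^bsub>AutG\<^esub> a" using G.rcos_self[OF rs_AutG[OF \<alpha>] N.subgroup_axioms] a(2) by simp
  then have "rs \<alpha> \<in> ?A" using coset[OF a(1)] by blast
  then obtain \<beta> where "\<beta> \<in> A" "rs \<alpha> = rs \<beta>" by blast
  then show ?thesis by (metis restrict_apply')
qed

section \<open>The functor \<open>\<theta>\<close>\<close>

abbreviation "Cent \<equiv> centric_cat S (fam m)"

lemma Cent_iff: "\<phi> \<in> Cent P Q \<longleftrightarrow> cntr m P \<and> cntr m Q \<and> \<phi> \<in> fam m P Q"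
  by (auto simp: centric_cat_def full_subcategory_def centric_fam)

lemma O_star_centric_iff: "\<phi> \<in> O_star_centric p S (fam m) P Q \<longleftrightarrow> cntr m P \<and> cntr m Q \<and> \<phi> \<in> fam O_rel P Q"
  by (auto simp: O_star_centric_def full_subcategory_def centric_fam O_star_fam)

text \<open>The two factorizations differ by the automorphism \<open>\<alpha> \<circ> \<beta>\<^sup>-\<^sup>1\<close>, which agrees with \<open>\<mu>\<^sup>-\<^sup>1 \<circ> \<nu>\<close> on the
  centric subgroup \<open>\<beta>(P)\<close>.\<close>

lemma cls_unique:
  assumes P: "cntr m P" and a: "m (carrier S) \<alpha>" "O_rel (\<alpha> ` P) \<mu>" and b: "m (carrier S) \<beta>" "O_rel (\<beta> ` P) \<nu>"
    and eq: "\<And>x. x \<in> P \<Longrightarrow> \<mu> (\<alpha> x) = \<nu> (\<beta> x)"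
  shows "cls \<alpha> = cls \<beta>"
proof -
  interpret O: fus S p O_rel by (rule O_rel_fus)
  interpret Q: group Gam by (rule Gam)
  have Ps: "subgroup P S" using P by (simp add: cntr_def)
  let ?i = "inv_into (carrier S) \<beta>"
  note i = aut_inv_mor[OF b(1)]
  define \<gamma> where "\<gamma> = (\<lambda>x. \<alpha> (?i x))"
  have \<gamma>\<beta>: "\<gamma> (\<beta> x) = \<alpha> x" if "x \<in> P" for x
    using aut_inv(1)[OF b(1) subgroup_in_carrier[OF Ps that]] by (simp add: \<gamma>_def)
  have m\<gamma>: "m (carrier S) \<gamma>" unfolding \<gamma>_def using mor_comp'[OF i a(1)] mor_carrier_image[OF i] by simp
  have "O_rel (\<beta> ` P) \<gamma>" by (rule O.mor_left_factor[OF b(2) a(2)]) (use \<gamma>\<beta> eq in auto)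
  moreover have "cntr m (\<beta> ` P)" using cntr_image[OF P aut_restrict[OF b(1) Ps]] .
  ultimately have "cls \<gamma> = \<one>\<^bsub>Gam\<^esub>" using cls_trivial[OF m\<gamma>] by blast
  then have "cls \<alpha> \<otimes>\<^bsub>Gam\<^esub> inv\<^bsub>Gam\<^esub> cls \<beta> = \<one>\<^bsub>Gam\<^esub>"
    unfolding \<gamma>_def cls_mult[OF i a(1)] cls_inv[OF b(1)] .
  then show ?thesis using cls_closed[OF a(1)] cls_closed[OF b(1)] by (metis Q.inv_equality Q.inv_inv Q.inv_closed)
qed

text \<open>By \<open>cls_unique\<close> the value is the same for all factorizations of the morphism.\<close>

definition theta :: "'a set \<Rightarrow> 'a set \<Rightarrow> ('a \<Rightarrow> 'a) \<Rightarrow> ('a \<Rightarrow> 'a) set set" where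
  "theta P Q \<phi> = (if \<phi> \<in> Cent P Q
     then SOME g. \<exists>\<alpha> \<mu>. m (carrier S) \<alpha> \<and> O_rel (\<alpha> ` P) \<mu> \<and> (\<forall>x\<in>P. \<phi> x = \<mu> (\<alpha> x)) \<and> g = cls \<alpha> else undefined)"

lemma theta_eq:
  assumes \<phi>: "\<phi> \<in> Cent P Q" and a: "m (carrier S) \<alpha>" "O_rel (\<alpha> ` P) \<mu>" "\<And>x. x \<in> P \<Longrightarrow> \<phi> x = \<mu> (\<alpha> x)"
  shows "theta P Q \<phi> = cls \<alpha>"
proof -
  let ?R = "\<lambda>g. \<exists>\<alpha> \<mu>. m (carrier S) \<alpha> \<and> O_rel (\<alpha> ` P) \<mu> \<and> (\<forall>x\<in>P. \<phi> x = \<mu> (\<alpha> x)) \<and> g = cls \<alpha>"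
  have "?R (cls \<alpha>)" using a by blast
  then have "?R (Eps ?R)" by (rule someI)
  then obtain \<beta> \<nu> where b: "m (carrier S) \<beta>" "O_rel (\<beta> ` P) \<nu>" "\<forall>x\<in>P. \<phi> x = \<nu> (\<beta> x)" "Eps ?R = cls \<beta>" by blast
  have P: "cntr m P" using \<phi> by (simp add: Cent_iff)
  have "cls \<beta> = cls \<alpha>" by (rule cls_unique[OF P b(1,2) a(1,2)]) (use a(3) b(3) in metis)
  then show ?thesis using \<phi> b(4) by (simp add: theta_def)
qed

lemma Cent_factor:
  assumes "\<phi> \<in> Cent P Q"
  obtains \<alpha> \<mu> where "m (carrier S) \<alpha>" "O_rel (\<alpha> ` P) \<mu>" "\<forall>x\<in>P. \<phi> x = \<mu> (\<alpha> x)"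
proof -
  have "m P \<phi>" using assms by (simp add: Cent_iff fam_def)
  then show ?thesis by (rule m_factor) (use that in blast)
qed

lemma theta_is_theta_hat: "is_theta_hat p S (fam m) theta"
  unfolding is_theta_hat_def functor_to_B_def
proof (intro conjI allI ballI impI)
  interpret O: fus S p O_rel by (rule O_rel_fus)
  have idS: "m (carrier S) (\<lambda>x. x)" by (rule mor_id[OF subgroup_self])
  fix P Q R
  show "theta P Q \<phi> \<in> carrier Gam" if \<phi>: "\<phi> \<in> Cent P Q" for \<phi>
  proof -
    obtain \<alpha> \<mu> where "m (carrier S) \<alpha>" "O_rel (\<alpha> ` P) \<mu>" "\<forall>x\<in>P. \<phi> x = \<mu> (\<alpha> x)" using \<phi> by (rule Cent_factor)
    then show ?thesis using theta_eq[OF \<phi>, of \<alpha> \<mu>] cls_closed by simp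
  qed
  show one: "theta P Q \<phi> = \<one>\<^bsub>Gam\<^esub>" if \<phi>: "\<phi> \<in> O_star_centric p S (fam m) P Q" for P Q \<phi>
  proof -
    have "\<phi> \<in> Cent P Q" and O: "O_rel P \<phi>"
      using \<phi> fam_mono[of O_rel m] O_rel_le by (auto simp: Cent_iff O_star_centric_iff fam_def)
    then show ?thesis using theta_eq[of \<phi> P Q "\<lambda>x. x" \<phi>] idS cls_one by simp
  qed
  show "theta P P (\<lambda>x\<in>P. x) = \<one>\<^bsub>Gam\<^esub>" if "P \<in> {P. centric S (fam m) P}"
  proof (rule one)
    have c: "cntr m P" using that by (simp add: centric_fam)
    then have P: "subgroup P S" by (simp add: cntr_def)
    have "O_rel P (\<lambda>x\<in>P. x)" by (rule O.mor_cong[OF O.mor_id[OF P]]) simp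
    then show "(\<lambda>x\<in>P. x) \<in> O_star_centric p S (fam m) P P" using c P by (auto simp: O_star_centric_iff fam_def)
  qed
  show "theta P R (compose P \<psi> \<phi>) = theta Q R \<psi> \<otimes>\<^bsub>Gam\<^esub> theta P Q \<phi>" if \<phi>: "\<phi> \<in> Cent P Q" and \<psi>: "\<psi> \<in> Cent Q R" for \<phi> \<psi>
  proof -
    obtain \<alpha> \<mu> where a: "m (carrier S) \<alpha>" "O_rel (\<alpha> ` P) \<mu>" "\<forall>x\<in>P. \<phi> x = \<mu> (\<alpha> x)" using \<phi> by (rule Cent_factor)
    obtain \<beta> \<nu> where b: "m (carrier S) \<beta>" "O_rel (\<beta> ` Q) \<nu>" "\<forall>x\<in>Q. \<psi> x = \<nu> (\<beta> x)" using \<psi> by (rule Cent_factor)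
    have P: "subgroup P S" "cntr m P" "cntr m Q" "cntr m R" and mph: "m P \<phi>" "\<phi> ` P \<subseteq> Q"
      using \<phi> \<psi> by (auto simp: Cent_iff fam_def cntr_def)
    have comp: "compose P \<psi> \<phi> \<in> Cent P R"
      using fusion_systemD(3)[OF fam_fusion, of \<phi> P Q \<psi> R] \<phi> \<psi> by (simp add: Cent_iff)
    have t: "O_rel (\<beta> ` \<alpha> ` P) (twist \<beta> \<mu>)" using O_rel_invariant b(1) a(2) by (auto simp: invariant_def)
    have app: "twist \<beta> \<mu> (\<beta> (\<alpha> x)) = \<beta> (\<phi> x)" if "x \<in> P" for x
      using twist_apply[OF b(1), of "\<alpha> x"] a(3) that mor_closed[OF aut_restrict[OF a(1) P(1)] that] by simp
    have "twist \<beta> \<mu> ` \<beta> ` \<alpha> ` P \<subseteq> \<beta> ` Q" using app mph(2) by auto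
    then have n: "O_rel (\<beta> ` \<alpha> ` P) (\<lambda>x. \<nu> (twist \<beta> \<mu> x))" using O.mor_comp'[OF t b(2)] by blast
    have ba: "m (carrier S) (\<lambda>x. \<beta> (\<alpha> x))" using mor_comp[OF a(1)] b(1) mor_carrier_image[OF a(1)] by simp
    have "theta P R (compose P \<psi> \<phi>) = cls (\<lambda>x. \<beta> (\<alpha> x))"
    proof (rule theta_eq[OF comp ba, of "\<lambda>x. \<nu> (twist \<beta> \<mu> x)"])
      show "O_rel ((\<lambda>x. \<beta> (\<alpha> x)) ` P) (\<lambda>x. \<nu> (twist \<beta> \<mu> x))" using n by (simp add: image_image)
      show "compose P \<psi> \<phi> x = \<nu> (twist \<beta> \<mu> (\<beta> (\<alpha> x)))" if "x \<in> P" for x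
        using that app b(3) mph(2) by (auto simp: compose_eq)
    qed
    also have "\<dots> = cls \<beta> \<otimes>\<^bsub>Gam\<^esub> cls \<alpha>" by (rule cls_mult[OF a(1) b(1)])
    also have "cls \<beta> = theta Q R \<psi>" using theta_eq[OF \<psi> b(1,2)] b(3) by simp
    also have "cls \<alpha> = theta P Q \<phi>" using theta_eq[OF \<phi> a(1,2)] a(3) by simp
    finally show ?thesis .
  qed
  show "theta P Q \<phi> = undefined" if "\<phi> \<notin> Cent P Q" for \<phi> using that by (simp add: theta_def)
next
  fix \<alpha> assume \<alpha>: "\<alpha> \<in> fam m (carrier S) (carrier S)"
  interpret O: fus S p O_rel by (rule O_rel_fus)
  have m\<alpha>: "m (carrier S) \<alpha>" "rs \<alpha> = \<alpha>" using \<alpha> by (auto simp: fam_def extensional_restrict)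
  have "\<alpha> \<in> Cent (carrier S) (carrier S)" using \<alpha> cntr_carrier by (simp add: Cent_iff)
  then have "theta (carrier S) (carrier S) \<alpha> = cls \<alpha>"
    using theta_eq[of \<alpha> "carrier S" "carrier S" \<alpha> "\<lambda>x. x"] m\<alpha>(1) O.mor_id[OF subgroup_self] mor_carrier_image[OF m\<alpha>(1)] by simp
  then show "theta (carrier S) (carrier S) \<alpha> = Gamma_class p S (fam m) \<alpha>" by (simp add: cls_def m\<alpha>(2))
qed

text \<open>A functor that is trivial on \<open>O_rel\<close> is determined by its values on \<open>Aut\<^sub>F(S)\<close>: a morphism is
  \<open>\<mu> \<circ> \<alpha>\<close> restricted to \<open>P\<close>, and the restriction of \<open>\<alpha>\<close> is linked to \<open>\<alpha>\<close> by two inclusions, which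
  are in \<open>O_rel\<close>.\<close>

lemma is_theta_hat_unique: assumes t: "is_theta_hat p S (fam m) t" shows "t = theta"
proof (intro ext)
  interpret O: fus S p O_rel by (rule O_rel_fus)
  interpret Q: group Gam by (rule Gam)
  note t' = t[unfolded is_theta_hat_def functor_to_B_def]
  note closed = t'[THEN conjunct1, THEN conjunct1, rule_format]
    and comp = t'[THEN conjunct1, THEN conjunct2, THEN conjunct2, rule_format]
    and full = t'[THEN conjunct2, THEN conjunct1, rule_format]
    and triv = t'[THEN conjunct2, THEN conjunct2, THEN conjunct1, rule_format]
    and undef = t'[THEN conjunct2, THEN conjunct2, THEN conjunct2, rule_format]
  have OC: "\<phi> \<in> Cent P Q" if "\<phi> \<in> O_star_centric p S (fam m) P Q" for P Q \<phi>
    using that O_rel_le by (auto simp: Cent_iff O_star_centric_iff fam_def)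
  fix P Q \<phi>
  show "t P Q \<phi> = theta P Q \<phi>"
  proof (cases "\<phi> \<in> Cent P Q")
    case False
    then show ?thesis using undef by (simp add: theta_def)
  next
    case True
    obtain \<alpha> \<mu> where a: "m (carrier S) \<alpha>" "O_rel (\<alpha> ` P) \<mu>" "\<forall>x\<in>P. \<phi> x = \<mu> (\<alpha> x)" using True by (rule Cent_factor)
    have cP: "cntr m P" "cntr m Q" and \<phi>: "\<phi> \<in> extensional P" "\<phi> ` P \<subseteq> Q" "m P \<phi>"
      using True by (auto simp: Cent_iff fam_def)
    have P: "subgroup P S" "subgroup Q S" using cP by (auto simp: cntr_def)
    let ?P1 = "\<alpha> ` P"
    have aP: "m P \<alpha>" using aut_restrict[OF a(1) P(1)] .
    have c1: "cntr m ?P1" using cntr_image[OF cP(1) aP] .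
    then have P1: "subgroup ?P1 S" by (simp add: cntr_def)
    have incl: "(\<lambda>x\<in>R. x) \<in> O_star_centric p S (fam m) R (carrier S)" if c: "cntr m R" for R
    proof -
      have R: "subgroup R S" using c by (simp add: cntr_def)
      have "O_rel R (\<lambda>x\<in>R. x)" by (rule O.mor_cong[OF O.mor_id[OF R]]) simp
      then show ?thesis using c cntr_carrier subgroup_self subgroup_in_carrier[OF R] by (auto simp: O_star_centric_iff fam_def)
    qed
    define a1 where "a1 = restrict \<alpha> P"
    define u1 where "u1 = restrict \<mu> ?P1"
    have "m P a1" unfolding a1_def by (rule mor_cong[OF aP]) simp
    then have a1: "a1 \<in> Cent P ?P1" using cP(1) c1 P1 by (auto simp: Cent_iff fam_def a1_def)
    have "O_rel ?P1 u1" unfolding u1_def by (rule O.mor_cong[OF a(2)]) simp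
    moreover have "u1 ` ?P1 \<subseteq> Q" using a(3) \<phi>(2) by (auto simp: u1_def)
    ultimately have u1: "u1 \<in> O_star_centric p S (fam m) ?P1 Q"
      using c1 cP(2) P(2) by (auto simp: O_star_centric_iff fam_def u1_def)
    have "compose P u1 a1 = \<phi>"
      by (rule extensionalityI[of _ P]) (use \<phi>(1) a(3) in \<open>auto simp: compose_eq a1_def u1_def\<close>)
    then have "t P Q \<phi> = \<one>\<^bsub>Gam\<^esub> \<otimes>\<^bsub>Gam\<^esub> t P ?P1 a1"
      using comp[OF a1 OC[OF u1]] triv[OF u1] by simp
    then have 1: "t P Q \<phi> = t P ?P1 a1" using closed[OF a1] by simp
    have "m (carrier S) (rs \<alpha>)" by (rule mor_cong[OF a(1)]) simp
    then have ra: "rs \<alpha> \<in> fam m (carrier S) (carrier S)" using mor_closed[OF a(1)] subgroup_self by (auto simp: fam_def)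
    then have raC: "rs \<alpha> \<in> Cent (carrier S) (carrier S)" using cntr_carrier by (simp add: Cent_iff)
    have "compose P (rs \<alpha>) (\<lambda>x\<in>P. x) = compose P (\<lambda>x\<in>?P1. x) a1"
      using subgroup_in_carrier[OF P(1)] by (auto simp: compose_def fun_eq_iff a1_def)
    then have "t (carrier S) (carrier S) (rs \<alpha>) \<otimes>\<^bsub>Gam\<^esub> t P (carrier S) (\<lambda>x\<in>P. x)
        = t ?P1 (carrier S) (\<lambda>x\<in>?P1. x) \<otimes>\<^bsub>Gam\<^esub> t P ?P1 a1"
      using comp[OF OC[OF incl[OF cP(1)]] raC] comp[OF a1 OC[OF incl[OF c1]]] by simp
    then have "t (carrier S) (carrier S) (rs \<alpha>) = t P ?P1 a1"
      unfolding triv[OF incl[OF cP(1)]] triv[OF incl[OF c1]] using closed[OF a1] closed[OF raC] by simp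
    then show ?thesis using 1 full[OF ra] theta_eq[OF True a(1,2)] a(3) by (simp add: cls_def)
  qed
qed

lemma theta_hat_eq: "theta_hat p S (fam m) = theta"
  unfolding theta_hat_def using theta_is_theta_hat is_theta_hat_unique by (rule the_equality)

section \<open>The correspondence\<close>

definition aut_of :: "('a \<Rightarrow> 'a) set set set \<Rightarrow> ('a \<Rightarrow> 'a) set" where
  "aut_of H = {\<alpha>. m (carrier S) \<alpha> \<and> cls \<alpha> \<in> H}"

lemma aut_of_prime_index: assumes H: "subgroup H Gam" shows "prime_index S p m (aut_of H)"
proof (rule prime_index.intro[OF sat_axioms], rule prime_index_axioms.intro)
  interpret Q: group Gam by (rule Gam)
  show "aut_group m (aut_of H)"
    unfolding aut_group_def
  proof (intro conjI ballI)
    show "aut_of H \<subseteq> Collect (m (carrier S))" by (auto simp: aut_of_def)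
    show "(\<lambda>x. x) \<in> aut_of H" using mor_id[OF subgroup_self] cls_one subgroup.one_closed[OF H] by (simp add: aut_of_def)
    fix \<alpha> \<beta> assume \<alpha>: "\<alpha> \<in> aut_of H"
    then show "inv_into (carrier S) \<alpha> \<in> aut_of H"
      using aut_inv_mor cls_inv subgroup.m_inv_closed[OF H] by (simp add: aut_of_def)
    assume \<beta>: "\<beta> \<in> aut_of H"
    show "(\<lambda>x. \<beta> (\<alpha> x)) \<in> aut_of H"
      using \<alpha> \<beta> cls_mult[of \<alpha> \<beta>] subgroup.m_closed[OF H] mor_comp'[of "carrier S" \<alpha> "carrier S" \<beta>] mor_carrier_image[of \<alpha>]
      by (simp add: aut_of_def)
  qed
  show "\<alpha> \<in> aut_of H" if "m (carrier S) \<alpha>" "cntr m P" "O_rel P \<alpha>" for \<alpha> P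
    using that cls_trivial[OF that] subgroup.one_closed[OF H] by (simp add: aut_of_def)
qed

lemma theta_hat_preimage_iff:
  "\<phi> \<in> theta_hat_preimage p S (fam m) H P Q \<longleftrightarrow> \<phi> \<in> Cent P Q \<and> gen_by O_rel (aut_of H) P \<phi>"
proof -
  have "theta P Q \<phi> \<in> H \<longleftrightarrow> gen_by O_rel (aut_of H) P \<phi>" if \<phi>: "\<phi> \<in> Cent P Q"
  proof
    assume H: "theta P Q \<phi> \<in> H"
    obtain \<alpha> \<mu> where a: "m (carrier S) \<alpha>" "O_rel (\<alpha> ` P) \<mu>" "\<forall>x\<in>P. \<phi> x = \<mu> (\<alpha> x)" using \<phi> by (rule Cent_factor)
    have "\<alpha> \<in> aut_of H" using a(1) H theta_eq[OF \<phi> a(1,2)] a(3) by (simp add: aut_of_def)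
    moreover have "subgroup P S" using \<phi> by (simp add: Cent_iff cntr_def)
    ultimately show "gen_by O_rel (aut_of H) P \<phi>" using a unfolding gen_by_def by blast
  next
    assume "gen_by O_rel (aut_of H) P \<phi>"
    then obtain \<alpha> \<mu> where a: "\<alpha> \<in> aut_of H" "O_rel (\<alpha> ` P) \<mu>" "\<forall>x\<in>P. \<phi> x = \<mu> (\<alpha> x)" unfolding gen_by_def by blast
    then have m\<alpha>: "m (carrier S) \<alpha>" "cls \<alpha> \<in> H" by (auto simp: aut_of_def)
    show "theta P Q \<phi> \<in> H" using theta_eq[OF \<phi> m\<alpha>(1) a(2)] a(3) m\<alpha>(2) by simp
  qed
  then show ?thesis unfolding theta_hat_preimage_def theta_hat_eq by blast
qed

text \<open>The preimage under \<open>\<theta>\<close> is the centric part of \<open>gen_by O_rel (aut_of H)\<close>, which generates that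
  system.\<close>

lemma F_sub_eq: assumes H: "subgroup H Gam" shows "F_sub p S (fam m) H = fam (gen_by O_rel (aut_of H))"
proof -
  interpret A: prime_index S p m "aut_of H" by (rule aut_of_prime_index[OF H])
  show ?thesis
    unfolding F_sub_def generated_fusion_system_def
  proof (rule antisym)
    have "theta_hat_preimage p S (fam m) H P Q \<subseteq> fam (gen_by O_rel (aut_of H)) P Q" for P Q
    proof
      fix \<phi> assume "\<phi> \<in> theta_hat_preimage p S (fam m) H P Q"
      then have "\<phi> \<in> fam m P Q" "gen_by O_rel (aut_of H) P \<phi>" by (simp_all add: theta_hat_preimage_iff Cent_iff)
      then show "\<phi> \<in> fam (gen_by O_rel (aut_of H)) P Q" by (simp add: fam_def)
    qed
    then have "theta_hat_preimage p S (fam m) H \<le> fam (gen_by O_rel (aut_of H))" by (simp add: le_fun_def)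
    then show "Inf {F. fusion_system S F \<and> theta_hat_preimage p S (fam m) H \<le> F} \<le> fam (gen_by O_rel (aut_of H))"
      using A.E.fam_fusion by (intro Inf_lower) blast
    show "fam (gen_by O_rel (aut_of H)) \<le> Inf {F. fusion_system S F \<and> theta_hat_preimage p S (fam m) H \<le> F}"
    proof (rule Inf_greatest)
      fix X assume "X \<in> {F. fusion_system S F \<and> theta_hat_preimage p S (fam m) H \<le> F}"
      then have X: "fusion_system S X" and le: "\<And>P Q. theta_hat_preimage p S (fam m) H P Q \<subseteq> X P Q"
        by (auto simp: le_fun_def)
      have "\<forall>P f. A.E P f \<and> cntr A.E P \<longrightarrow> mo X P f"
      proof (intro allI impI)
        fix P f assume f: "A.E P f \<and> cntr A.E P"
        have r: "A.E P (restrict f P)" by (rule A.E.mor_cong[OF conjunct1[OF f]]) simp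
        have "restrict f P \<in> fam m P (carrier S)"
          using A.E_le[OF r] mor_closed[OF A.E_le[OF conjunct1[OF f]]] subgroup_self by (auto simp: fam_def)
        then have "restrict f P \<in> theta_hat_preimage p S (fam m) H P (carrier S)"
          using f r A.cntr_E cntr_carrier by (simp add: theta_hat_preimage_iff Cent_iff)
        then show "mo X P f" using le unfolding mo_def by blast
      qed
      then have "mo X P f" if "A.E P f" for P f
        using fus_genD[OF A.E_centric_generated[OF that] mo_fus[OF X]] by blast
      then have "fam (gen_by O_rel (aut_of H)) \<le> fam (mo X)" by (rule fam_mono)
      then show "fam (gen_by O_rel (aut_of H)) \<le> X" by (simp add: fam_mo[OF X])
    qed
  qed
qed

text \<open>\<open>H\<close> is the set of classes of the automorphisms of \<open>S\<close> in \<open>F\<^sub>H\<close>, which gives injectivity. A subsystem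
  of index prime to \<open>p\<close> is \<open>F\<^sub>H\<close> for the set \<open>H\<close> of classes of its automorphisms of \<open>S\<close>.\<close>

theorem correspondence:
  assumes satF: "saturated p S (fam m)"
  shows "bij_betw (F_sub p S (fam m)) {H. subgroup H Gam} {F'. index_prime_to_p p S (fam m) F'}"
  unfolding bij_betw_def
proof (intro conjI subset_antisym subsetI)
  interpret Q: group Gam by (rule Gam)
  show "inj_on (F_sub p S (fam m)) {H. subgroup H Gam}"
  proof (rule inj_onI)
    have recover: "h \<in> H \<longleftrightarrow> (\<exists>\<alpha>. h = cls \<alpha> \<and> mo (F_sub p S (fam m) H) (carrier S) \<alpha>)" if H: "subgroup H Gam" for H h
    proof -
      interpret A: prime_index S p m "aut_of H" by (rule aut_of_prime_index[OF H])
      have mo: "mo (F_sub p S (fam m) H) (carrier S) \<alpha> \<longleftrightarrow> A.E (carrier S) \<alpha>" for \<alpha>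
        unfolding F_sub_eq[OF H] by (rule A.E.mo_fam)
      show ?thesis
      proof
        assume h: "h \<in> H"
        obtain \<alpha> where \<alpha>: "m (carrier S) \<alpha>" "h = cls \<alpha>" using subgroup.mem_carrier[OF H h] by (rule cls_onto)
        then have "\<alpha> \<in> aut_of H" using h by (simp add: aut_of_def)
        then show "\<exists>\<alpha>. h = cls \<alpha> \<and> mo (F_sub p S (fam m) H) (carrier S) \<alpha>" using \<alpha>(2) mo A.A_le_E by blast
      next
        assume "\<exists>\<alpha>. h = cls \<alpha> \<and> mo (F_sub p S (fam m) H) (carrier S) \<alpha>"
        then obtain \<alpha> where \<alpha>: "h = cls \<alpha>" "A.E (carrier S) \<alpha>" using mo by blast
        then obtain \<beta> where "\<beta> \<in> aut_of H" "\<forall>x\<in>carrier S. \<alpha> x = \<beta> x" using A.E_automorphism by blast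
        then show "h \<in> H" using \<alpha>(1) cls_cong[of \<alpha> \<beta>] by (simp add: aut_of_def)
      qed
    qed
    fix H K assume "H \<in> {H. subgroup H Gam}" "K \<in> {H. subgroup H Gam}" "F_sub p S (fam m) H = F_sub p S (fam m) K"
    then show "H = K" using recover[of H] recover[of K] by auto
  qed
next
  fix F' assume "F' \<in> F_sub p S (fam m) ` {H. subgroup H Gam}"
  then obtain H where H: "subgroup H Gam" and F': "F' = F_sub p S (fam m) H" by blast
  interpret A: prime_index S p m "aut_of H" by (rule aut_of_prime_index[OF H])
  have "saturated p S (fam A.E)"
    unfolding A.E.saturated_fam
  proof (intro conjI allI impI)
    show "extension_at A.E P" for P by (rule A.extension_E)
    fix P assume fn: "fully_norm A.E P"
    then have fnm: "fully_norm m P" by (simp add: A.fully_norm_E)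
    then have P: "subgroup P S" by (simp add: fully_norm_def)
    show "fully_cent A.E P" by (rule A.E.fully_norm_cent[OF fn])
    have np: "\<not> p dvd card (auts A.E P) div card (conj_auts (nrm P) P)"
      using A.sylow_E fn by (simp add: sylow_axiom_def)
    have c: "card (conj_auts (nrm P) P) = p ^ multiplicity p (card (auts m P))"
      using satF fnm by (simp add: saturated_fam)
    interpret B: group "BijGroup P" by (rule group_BijGroup)
    have "finite (carrier (BijGroup P))" using finite_Bij[OF finite_subgroup[OF P]] by (simp add: BijGroup_def)
    then have dvd: "card (conj_auts (nrm P) P) dvd card (auts A.E P)"
      by (rule B.card_rcosets_div(2)[OF _ A.E.auts_subgroup[OF P] conj_auts_subgroup[OF P nrm_subgroup[OF P] subset_refl]
        A.E.conj_auts_le_auts[OF P subset_refl]])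
    let ?k = "multiplicity p (card (auts m P))"
    obtain r where r: "card (auts A.E P) = p ^ ?k * r" using dvd unfolding c by blast
    have "\<not> p dvd r" using np unfolding c r using prime_gt_0_nat[OF prime_p] by simp
    then have "multiplicity p (card (auts A.E P)) = ?k"
      unfolding r using prime_p by (intro multiplicity_eqI) (auto simp: prime_gt_0_nat)
    then show "card (conj_auts (nrm P) P) = p ^ multiplicity p (card (auts A.E P))" using c by simp
  qed
  then show "F' \<in> {F'. index_prime_to_p p S (fam m) F'}"
    unfolding F' F_sub_eq[OF H] using index_prime_to_p_fam[OF A.E_fus] A.E_le A.p_auts_E by simp
next
  fix F' assume "F' \<in> {F'. index_prime_to_p p S (fam m) F'}"
  then have ind: "index_prime_to_p p S (fam m) F'" by simp
  then have sF': "saturated p S F'" by (simp add: index_prime_to_p_def)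
  then have fs: "fusion_system S F'" by (simp add: saturated_def)
  define m' where "m' = mo F'"
  have fm: "fam m' = F'" unfolding m'_def by (rule fam_mo[OF fs])
  have M: "fus S p m'" unfolding m'_def by (rule mo_fus[OF fs])
  have m': "sat S p m'" using fus.saturated_fam_sat[OF M] sF' fm by simp
  have le: "m' P f \<Longrightarrow> m P f" and pm': "p_auts_in m m' P" for P f
    using ind index_prime_to_p_fam[OF M] unfolding fm by auto
  let ?A = "Collect (m' (carrier S))"
  have A: "prime_index S p m ?A" by (rule subsystem_prime_index(1)[OF m' le pm'])
  interpret A: prime_index S p m ?A by (rule A)
  interpret M: fus S p m' by (rule M)
  define H where "H = cls ` ?A"
  have H: "subgroup H Gam"
  proof (rule subgroup.intro)
    show "H \<subseteq> carrier Gam" using cls_closed le by (auto simp: H_def)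
    show "\<one>\<^bsub>Gam\<^esub> \<in> H" using cls_one M.mor_id[OF subgroup_self] by (auto simp: H_def intro!: image_eqI)
    fix x y assume "x \<in> H"
    then obtain \<alpha> where \<alpha>: "m' (carrier S) \<alpha>" "x = cls \<alpha>" by (auto simp: H_def)
    have "inv\<^bsub>Gam\<^esub> x = cls (inv_into (carrier S) \<alpha>)" using cls_inv[OF le[OF \<alpha>(1)]] \<alpha>(2) by simp
    then show "inv\<^bsub>Gam\<^esub> x \<in> H" using M.aut_inv_mor[OF \<alpha>(1)] by (auto simp: H_def)
    assume "y \<in> H"
    then obtain \<beta> where \<beta>: "m' (carrier S) \<beta>" "y = cls \<beta>" by (auto simp: H_def)
    have "x \<otimes>\<^bsub>Gam\<^esub> y = cls (\<lambda>z. \<alpha> (\<beta> z))" using cls_mult[OF le[OF \<beta>(1)] le[OF \<alpha>(1)]] \<alpha>(2) \<beta>(2) by simp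
    moreover have "m' (carrier S) (\<lambda>z. \<alpha> (\<beta> z))"
      using M.mor_comp[OF \<beta>(1)] \<alpha>(1) M.mor_carrier_image[OF \<beta>(1)] by simp
    ultimately show "x \<otimes>\<^bsub>Gam\<^esub> y \<in> H" by (auto simp: H_def)
  qed
  have "aut_of H = ?A"
  proof (intro subset_antisym subsetI)
    fix \<alpha> assume "\<alpha> \<in> aut_of H"
    then obtain \<beta> where \<alpha>: "m (carrier S) \<alpha>" and \<beta>: "m' (carrier S) \<beta>" "cls \<alpha> = cls \<beta>" by (auto simp: aut_of_def H_def)
    note i = aut_inv_mor[OF le[OF \<beta>(1)]]
    let ?g = "\<lambda>x. \<alpha> (inv_into (carrier S) \<beta> x)"
    have mg: "m (carrier S) ?g" using mor_comp'[OF i \<alpha>] mor_carrier_image[OF i] by simp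
    have "cls ?g = cls \<alpha> \<otimes>\<^bsub>Gam\<^esub> inv\<^bsub>Gam\<^esub> cls \<beta>" using cls_mult[OF i \<alpha>] cls_inv[OF le[OF \<beta>(1)]] by simp
    then have "cls ?g = \<one>\<^bsub>Gam\<^esub>" using \<beta>(2) group.r_inv[OF Gam cls_closed[OF \<alpha>]] by simp
    then obtain \<gamma> where \<gamma>: "m' (carrier S) \<gamma>" "\<forall>x\<in>carrier S. ?g x = \<gamma> x" using cls_kernel[OF A mg] by auto
    have "m' (carrier S) (\<lambda>x. \<gamma> (\<beta> x))" using M.mor_comp[OF \<beta>(1)] \<gamma>(1) M.mor_carrier_image[OF \<beta>(1)] by simp
    then have "m' (carrier S) \<alpha>"
    proof (rule M.mor_cong)
      fix x assume x: "x \<in> carrier S"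
      have "\<gamma> (\<beta> x) = \<alpha> (inv_into (carrier S) \<beta> (\<beta> x))" using \<gamma>(2) M.mor_closed[OF \<beta>(1) x] by simp
      then show "\<gamma> (\<beta> x) = \<alpha> x" using M.aut_inv(1)[OF \<beta>(1) x] by simp
    qed
    then show "\<alpha> \<in> ?A" by simp
  next
    fix \<alpha> assume "\<alpha> \<in> ?A"
    then show "\<alpha> \<in> aut_of H" using le by (auto simp: aut_of_def H_def)
  qed
  then have "F_sub p S (fam m) H = fam (gen_by O_rel ?A)" using F_sub_eq[OF H] by simp
  also have "gen_by O_rel ?A = m'" using subsystem_prime_index(2)[OF m' le pm'] by (intro ext) blast
  finally have "F_sub p S (fam m) H = F'" using fm by simp
  then show "F' \<in> F_sub p S (fam m) ` {H. subgroup H Gam}" using H by blast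
qed

end

theorem theorem5p4:
  fixes p :: nat and S :: "('a, 'b) monoid_scheme" and F :: "'a hom_family"
  assumes "prime p"
    and "finite_p_group p S"
    and "saturated p S F"
  shows "bij_betw (F_sub p S F)
           {H. subgroup H (Gamma_p' p S F)}
           {F'. index_prime_to_p p S F F'}"
proof -
  interpret p_group S p
    using assms(1,2) by (simp add: p_group_def p_group_axioms_def finite_p_group_def)
  have fs: "fusion_system S F" using assms(3) by (simp add: saturated_def)
  have F: "fam (mo F) = F" by (rule fam_mo[OF fs])
  interpret fus S p "mo F" by (rule mo_fus[OF fs])
  interpret sat S p "mo F" using saturated_fam_sat assms(3) F by simp
  show ?thesis using correspondence assms(3) unfolding F .
qed

end
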